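(* Let $H$ be a finite Abelian group having at least one element of order greater than $9$. Then every 3-net in $\mathbb{P}^2$ realizing $H$ is algebraic.
   Context: A 3-net in $\mathbb{P}^2$ is a pair $(\mathcal{A},\mathcal{X})$ where $\mathcal{A}$ is a finite set of lines in the complex projective plane partitioned into 3 classes $\mathcal{A}=\mathcal{A}_1\cup\mathcal{A}_2\cup\mathcal{A}_3$ and $\mathcal{X}$ is a finite set of points such that: (i) for every $i\neq j$ and every $l\in\mathcal{A}_i$, $l'\in\mathcal{A}_j$, $l\cap l'\in\mathcal{X}$; (ii) for every $X\in\mathcal{X}$ and every $i$ there is a unique $l\in\mathcal{A}_i$ through $X$. A 3-net realizes a group $H$ if there are bijections $\phi_i:H\to\mathcal{A}_i$ ($i=1,2,3$) such that for all $a,b\in H$ the line $\phi_3(ab)$ passes through the point $\phi_1(a)\cap\phi_2(b)$. Let $\mathcal{A}^*$ be the set of points in the dual projective plane $\mathbb{P}^*$ dual to the lines of $\mathcal{A}$. The 3-net is algebraic if there exists a cubic curve $\mathcal{C}\subset\mathbb{P}^*$ (not necessarily smooth or irreducible) such that $\mathcal{A}^*$ is contained in the set of regular (nonsingular) points of $\mathcal{C}$. *)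

theory Defs
  imports "HOL-Analysis.Cartesian_Space" "HOL-Algebra.Multiplicative_Group"
begin

(* The complex projective plane as the lattice of linear subspaces of complex^3: points are the
   1-dimensional subspaces, lines the 2-dimensional ones, incidence is inclusion, and the common
   point of two distinct lines is literally their intersection. *)

definition proj_points :: "(complex ^ 3) set set" where
  "proj_points = {P. vec.subspace P \<and> vec.dim P = 1}"

definition proj_lines :: "(complex ^ 3) set set" where
  "proj_lines = {l. vec.subspace l \<and> vec.dim l = 2}"

(* The dual plane is the plane of linear forms in dual coordinates: a covector a stands for the form
   x \<mapsto> a_1 x_1 + a_2 x_2 + a_3 x_3 (bilinear, no complex conjugation), and the
   dual point of a line is its annihilator. *)

definition dual_point :: "(complex ^ 3) set \<Rightarrow> (complex ^ 3) set" where
  "dual_point l = {a. \<forall>x\<in>l. (\<Sum>i\<in>UNIV. a $ i * x $ i) = 0}"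

(* The index type 3 has the three elements 1, 2 and 3 (= 0). *)

definition three_net :: "(3 \<Rightarrow> (complex ^ 3) set set) \<Rightarrow> (complex ^ 3) set set \<Rightarrow> bool" where
  "three_net A X \<longleftrightarrow>
     finite (\<Union>i. A i) \<and> (\<Union>i. A i) \<subseteq> proj_lines \<and>
     (\<forall>i. A i \<noteq> {}) \<and> (\<forall>i j. i \<noteq> j \<longrightarrow> A i \<inter> A j = {}) \<and>
     finite X \<and> X \<subseteq> proj_points \<and>
     (\<forall>i j. i \<noteq> j \<longrightarrow> (\<forall>l\<in>A i. \<forall>l'\<in>A j. l \<inter> l' \<in> X)) \<and>
     (\<forall>P\<in>X. \<forall>i. \<exists>!l. l \<in> A i \<and> P \<subseteq> l)"

definition realizes_group ::
    "(3 \<Rightarrow> (complex ^ 3) set set) \<Rightarrow> ('g, 'm) monoid_scheme \<Rightarrow> bool" where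
  "realizes_group A H \<longleftrightarrow>
     (\<exists>\<phi> :: 3 \<Rightarrow> 'g \<Rightarrow> (complex ^ 3) set.
        (\<forall>i. bij_betw (\<phi> i) (carrier H) (A i)) \<and>
        (\<forall>a\<in>carrier H. \<forall>b\<in>carrier H. \<phi> 1 a \<inter> \<phi> 2 b \<subseteq> \<phi> 3 (a \<otimes>\<^bsub>H\<^esub> b)))"

(* A ternary cubic form is given by its coefficients c m, indexed by exponent vectors m of total
   degree 3; values of c at other exponent vectors are irrelevant. *)

definition cubic_exponents :: "(3 \<Rightarrow> nat) set" where
  "cubic_exponents = {m. (\<Sum>i\<in>UNIV. m i) = 3}"

lemma finite_cubic_exponents: "finite cubic_exponents"
proof (rule finite_subset)
  show "cubic_exponents \<subseteq> UNIV \<rightarrow>\<^sub>E {..3}"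
    unfolding cubic_exponents_def
  proof (intro subsetI PiE_I)
    fix m :: "3 \<Rightarrow> nat" and i
    assume "m \<in> {m. (\<Sum>i\<in>UNIV. m i) = 3}"
    then show "m i \<in> {..3}"
      using member_le_sum[of i UNIV m] by simp
  qed simp
  show "finite (UNIV \<rightarrow>\<^sub>E {..3} :: (3 \<Rightarrow> nat) set)"
    by (intro finite_PiE) auto
qed

definition cubic_form :: "((3 \<Rightarrow> nat) \<Rightarrow> complex) \<Rightarrow> complex ^ 3 \<Rightarrow> complex" where
  "cubic_form c x = (\<Sum>m\<in>cubic_exponents. c m * (\<Prod>j\<in>UNIV. x $ j ^ m j))"

(* Formal partial derivative with respect to the i-th coordinate; terms with m i = 0 vanish, so the
   truncated subtraction does no harm. *)

definition cubic_partial :: "((3 \<Rightarrow> nat) \<Rightarrow> complex) \<Rightarrow> 3 \<Rightarrow> complex ^ 3 \<Rightarrow> complex" where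
  "cubic_partial c i x =
     (\<Sum>m\<in>cubic_exponents. c m * of_nat (m i) * (\<Prod>j\<in>UNIV. x $ j ^ (if j = i then m j - 1 else m j)))"

definition nonzero_cubic :: "((3 \<Rightarrow> nat) \<Rightarrow> complex) \<Rightarrow> bool" where
  "nonzero_cubic c \<longleftrightarrow> (\<exists>m\<in>cubic_exponents. c m \<noteq> 0)"

definition cubic_curve :: "((3 \<Rightarrow> nat) \<Rightarrow> complex) \<Rightarrow> (complex ^ 3) set set" where
  "cubic_curve c = {P \<in> proj_points. \<forall>x\<in>P. cubic_form c x = 0}"

definition regular_points :: "((3 \<Rightarrow> nat) \<Rightarrow> complex) \<Rightarrow> (complex ^ 3) set set" where
  "regular_points c =
     {P \<in> cubic_curve c. \<forall>x\<in>P. x \<noteq> 0 \<longrightarrow> (\<exists>i. cubic_partial c i x \<noteq> 0)}"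

definition algebraic_net :: "(3 \<Rightarrow> (complex ^ 3) set set) \<Rightarrow> bool" where
  "algebraic_net A \<longleftrightarrow>
     (\<exists>c. nonzero_cubic c \<and> dual_point ` (\<Union>i. A i) \<subseteq> regular_points c)"

end

theory Submission imports Defs "HOL-Computational_Algebra.Fundamental_Theorem_Algebra" begin

text \<open>
  Dualise: the net becomes three families of points \<open>A x\<close>, \<open>B y\<close>, \<open>C z\<close> indexed by \<open>H\<close> (the third one
  reindexed by inversion) such that \<open>A x\<close>, \<open>B y\<close>, \<open>C z\<close> are collinear iff \<open>x y z = 1\<close>. By
  Cayley--Bacharach, a cubic through eight points of a \<open>3 \<times> 3\<close> grid of net lines passes through the ninth.
  Inside the cyclic subgroup generated by an element \<open>g\<close> of order at least 10 this propagates a cubic \<open>F\<close>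
  through nine well-chosen points to all points with index in that subgroup.

  A coset of that subgroup carries a subnet sharing one class, hence at least ten points, with the first one. If \<open>F\<close> or the
  cubic of the subnet contains no line, Bezout shows that they agree. Otherwise a cubic containing a line is a line plus a conic or
  three lines, with each class on one component. The conic case is settled by Pascal's theorem. In the case of three lines the
  points of each class form a geometric progression with respect to the vertices of the triangle
  (Menelaus), which determines the vertices and hence the lines. So \<open>F\<close> passes through all points.

  Finally, if a point of the net were singular on \<open>F\<close>, every net line through it would be a component of \<open>F\<close>.
\<close>

section \<open>Ternary forms\<close>

text \<open>The order bound comes from Bezout: cubics that share a single class must already be
  comparable, and ten is the first number exceeding 3 * 3. Bezout itself is proved by counting
  dimensions of spaces of forms. Irreducibility is only used as absence of lines, since a reducible
  conic or cubic has a linear factor. One manoeuvre recurs: force an extra zero on a line by tuning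
  a constant or a linear form, split the line off, and continue in lower degree. The obstacle is the
  passage to a coset. About its representative \<open>h\<close> one knows only that it lies outside
  the cyclic subgroup; its square may lie inside. Hence the Pascal argument has to compare two
  grids, and the three-line case needs two neighbouring subnets, one sharing the third class and one
  the second, which share the shifted first class with each other.\<close>

definition lin :: "complex ^ 3 \<Rightarrow> complex ^ 3 \<Rightarrow> complex" where
  "lin l x = l $ 1 * x $ 1 + l $ 2 * x $ 2 + l $ 3 * x $ 3"

text \<open>Cross product: coordinates of the line through two points and, dually, of the common
  point of two lines. For nonzero vectors its vanishing means proportionality, so it is the test for
  equal projective points.\<close>

definition crs :: "complex ^ 3 \<Rightarrow> complex ^ 3 \<Rightarrow> complex ^ 3" where
  "crs p q = vector [p $ 2 * q $ 3 - p $ 3 * q $ 2, p $ 3 * q $ 1 - p $ 1 * q $ 3,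
                     p $ 1 * q $ 2 - p $ 2 * q $ 1]"

definition det3 :: "complex ^ 3 \<Rightarrow> complex ^ 3 \<Rightarrow> complex ^ 3 \<Rightarrow> complex" where
  "det3 p q r = lin (crs p q) r"

lemma crs_nth [simp]:
  "crs p q $ 1 = p $ 2 * q $ 3 - p $ 3 * q $ 2"
  "crs p q $ 2 = p $ 3 * q $ 1 - p $ 1 * q $ 3"
  "crs p q $ 3 = p $ 1 * q $ 2 - p $ 2 * q $ 1"
  by (simp_all add: crs_def)

lemma vec3_eq_iff: "(x :: complex ^ 3) = y \<longleftrightarrow> x $ 1 = y $ 1 \<and> x $ 2 = y $ 2 \<and> x $ 3 = y $ 3"
  by (simp add: vec_eq_iff forall_3)

lemma lin_add [simp]: "lin l (x + y) = lin l x + lin l y"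
  and lin_scale [simp]: "lin l (t *s x) = t * lin l x"
  and lin_diff [simp]: "lin l (x - y) = lin l x - lin l y"
  and lin_zero [simp]: "lin l 0 = 0"
  by (simp_all add: lin_def algebra_simps)

lemma lin_add_left [simp]: "lin (x + y) l = lin x l + lin y l"
  and lin_scale_left [simp]: "lin (t *s x) l = t * lin x l"
  and lin_zero_left [simp]: "lin 0 l = 0"
  by (simp_all add: lin_def algebra_simps)

lemma crs_self [simp]: "crs p p = 0"
  by (simp add: vec3_eq_iff)

lemma crs_anticomm: "crs q p = - crs p q"
  by (simp add: vec3_eq_iff)

lemma crs_eq_0_commute: "crs q p = 0 \<longleftrightarrow> crs p q = 0"
  using crs_anticomm[of p q] by simp

lemma lin_crs [simp]: "lin (crs p q) p = 0" "lin (crs p q) q = 0"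
  by (simp_all add: lin_def algebra_simps)

lemma det3_rotate: "det3 q r p = det3 p q r"
  and det3_swap: "det3 q p r = - det3 p q r"
  by (simp_all add: det3_def lin_def algebra_simps)

lemma crs_zero [simp]: "crs 0 p = 0" "crs p 0 = 0"
  by (simp_all add: vec3_eq_iff)

lemma crs_scale [simp]: "crs (t *s p) q = t *s crs p q" "crs p (t *s q) = t *s crs p q"
  by (simp_all add: vec3_eq_iff algebra_simps)

lemma crs_eq_0_imp_multiple:
  assumes "crs p q = 0" "q \<noteq> 0"
  shows "\<exists>t. p = t *s q"
proof -
  have e: "p $ 2 * q $ 3 = p $ 3 * q $ 2" "p $ 3 * q $ 1 = p $ 1 * q $ 3" "p $ 1 * q $ 2 = p $ 2 * q $ 1"
    using assms(1) by (simp_all add: vec3_eq_iff)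
  consider "q $ 1 \<noteq> 0" | "q $ 2 \<noteq> 0" | "q $ 3 \<noteq> 0" using assms(2) by (auto simp: vec3_eq_iff)
  then show ?thesis
  proof cases
    case 1
    then show ?thesis using e by (intro exI[of _ "p $ 1 / q $ 1"]) (auto simp: vec3_eq_iff field_simps)
  next
    case 2
    then show ?thesis using e by (intro exI[of _ "p $ 2 / q $ 2"]) (auto simp: vec3_eq_iff field_simps)
  next
    case 3
    then show ?thesis using e by (intro exI[of _ "p $ 3 / q $ 3"]) (auto simp: vec3_eq_iff field_simps)
  qed
qed

lemma crs_crs: "crs (crs p q) r = lin p r *s q - lin q r *s p"
  by (simp add: vec3_eq_iff lin_def algebra_simps)

lemma lin_commute: "lin p q = lin q p"
  by (simp add: lin_def mult.commute)

lemma line_through: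
  assumes "lin l p = 0" "lin l q = 0" "crs p q \<noteq> 0"
  shows "\<exists>t. l = t *s crs p q"
proof -
  have "crs (crs p q) l = 0"
    using assms by (simp add: crs_crs lin_commute[of _ l])
  then have "crs l (crs p q) = 0" by (simp add: crs_eq_0_commute)
  then show ?thesis using assms(3) by (rule crs_eq_0_imp_multiple)
qed

lemma in_line_combination:
  assumes "lin l p = 0" "lin l q = 0" "crs p q \<noteq> 0" "l \<noteq> 0" "lin l x = 0"
  shows "\<exists>u v. x = u *s p + v *s q"
proof -
  define n where "n = crs p q"
  obtain t where t: "l = t *s n" using line_through assms n_def by blast
  then have "t \<noteq> 0" using assms(4) by auto
  then have nx: "lin n x = 0" using t assms(5) by simp
  obtain r where r: "lin r n \<noteq> 0"
  proof -
    consider "n $ 1 \<noteq> 0" | "n $ 2 \<noteq> 0" | "n $ 3 \<noteq> 0" using assms(3) n_def by (auto simp: vec3_eq_iff)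
    then show ?thesis
      by cases (rule that[of "axis 1 1"] that[of "axis 2 1"] that[of "axis 3 1"], simp add: lin_def axis_def)+
  qed
  \<comment> \<open>Cramer's rule with respect to \<open>p\<close>, \<open>q\<close>,
    \<open>r\<close>; the last term drops out because \<open>x\<close> lies on the line.\<close>
  have id: "lin r (crs p q) *s x = lin r (crs x q) *s p + lin r (crs p x) *s q + lin (crs p q) x *s r"
    unfolding vec3_eq_iff lin_def by (simp add: algebra_simps)
  then have "lin r n *s x = lin r (crs x q) *s p + lin r (crs p x) *s q"
    using nx by (simp add: n_def)
  then have "(1 / lin r n) *s (lin r n *s x) = (1 / lin r n) *s (lin r (crs x q) *s p + lin r (crs p x) *s q)"
    by simp
  then have "x = (lin r (crs x q) / lin r n) *s p + (lin r (crs p x) / lin r n) *s q"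
    using r by (simp add: vec3_eq_iff field_simps)
  then show ?thesis by blast
qed

lemma det3_eq_0_imp_combination:
  assumes "det3 p q r = 0" "crs p q \<noteq> 0"
  shows "\<exists>u v. r = u *s p + v *s q"
  using in_line_combination[of "crs p q" p q r] assms by (simp add: det3_def)

lemma lin_eq_zero_iff: "(\<forall>x. lin l x = 0) \<longleftrightarrow> l = 0"
proof
  assume "\<forall>x. lin l x = 0"
  then have "lin l (axis i 1) = 0" for i by blast
  from this[of 1] this[of 2] this[of 3] show "l = 0"
    by (simp add: lin_def axis_def vec3_eq_iff)
qed simp

section \<open>Homogeneous forms as functions\<close>

text \<open>Polynomials are represented by their functions. The zero function is thus a form of
  every degree, and division by a line can be proved by induction on the generation of the
  form.\<close>

inductive form :: "nat \<Rightarrow> (complex ^ 3 \<Rightarrow> complex) \<Rightarrow> bool" where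
  const: "form 0 (\<lambda>x. c)"
| coord: "form d f \<Longrightarrow> form (Suc d) (\<lambda>x. x $ i * f x)"
| add: "form d f \<Longrightarrow> form d g \<Longrightarrow> form d (\<lambda>x. f x + g x)"

lemma form_scale: "form d f \<Longrightarrow> form d (\<lambda>x. c * f x)"
proof (induction rule: form.induct)
  case (const c')
  show ?case by (rule form.const)
next
  case (coord d f i)
  have "form (Suc d) (\<lambda>x. x $ i * (c * f x))" by (rule form.coord) fact
  then show ?case by (simp add: algebra_simps)
next
  case (add d f g)
  have "form d (\<lambda>x. c * f x + c * g x)" by (rule form.add) fact+
  then show ?case by (simp add: algebra_simps)
qed

lemma form_zero: "form d (\<lambda>x. 0)"
proof (induction d)
  case 0 show ?case by (rule form.const)
next
  case (Suc d)
  from form.coord[OF Suc, of 1] show ?case by simp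
qed

lemma form_diff: "form d f \<Longrightarrow> form d g \<Longrightarrow> form d (\<lambda>x. f x - g x)"
  using form.add[OF _ form_scale[of d g "-1"], of f] by simp

lemma form_sum: "(\<And>i. i \<in> I \<Longrightarrow> form d (f i)) \<Longrightarrow> form d (\<lambda>x. \<Sum>i\<in>I. f i x)"
  by (induction I rule: infinite_finite_induct) (auto intro: form_zero form.add)

lemma form_mult: "form d f \<Longrightarrow> form e g \<Longrightarrow> form (d + e) (\<lambda>x. f x * g x)"
proof (induction rule: form.induct)
  case (const c)
  then show ?case by (simp add: form_scale)
next
  case (coord d f i)
  have "form (Suc (d + e)) (\<lambda>x. x $ i * (f x * g x))" by (rule form.coord) (use coord in blast)
  then show ?case by (simp add: algebra_simps)
next
  case (add d f f')
  have "form (d + e) (\<lambda>x. f x * g x + f' x * g x)" by (rule form.add) (use add in blast)+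
  then show ?case by (simp add: algebra_simps)
qed

lemma form_lin: "form 1 (lin l)"
proof -
  have c: "form 1 (\<lambda>x. x $ i * c)" for i c
    using form.coord[OF form.const, of i c] by simp
  have "form 1 (\<lambda>x. (x $ 1 * l $ 1 + x $ 2 * l $ 2) + x $ 3 * l $ 3)"
    by (intro form.add c)
  then show ?thesis by (simp add: lin_def[abs_def] algebra_simps)
qed

lemma form_lin_mult: "form d f \<Longrightarrow> form (Suc d) (\<lambda>x. lin l x * f x)"
  using form_mult[OF form_lin] by simp

lemma form_homogeneous: "form d f \<Longrightarrow> f (t *s x) = t ^ d * f x"
  by (induction rule: form.induct) (auto simp: algebra_simps)

lemma form_compose_proj:
  assumes "form d f"
  shows "form d (\<lambda>x. f (x - lin l x *s v))"
  using assms
proof (induction rule: form.induct)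
  case (const c)
  show ?case by (rule form.const)
next
  case (coord d f i)
  have "form (Suc d) (\<lambda>x. x $ i * f (x - lin l x *s v) - v $ i * (lin l x * f (x - lin l x *s v)))"
    by (intro form_diff form.coord form_scale form_lin_mult coord)
  then show ?case by (simp add: algebra_simps)
next
  case (add d f g)
  then show ?case by (intro form.add)
qed

text \<open>Division by \<open>l\<close> whose remainder is the substituted form: the argument
  changes only by a multiple of \<open>lin l x\<close>. Degree 0 is separate because the quotient
  would have degree -1.\<close>

lemma form_proj_diff:
  assumes "form d f"
  shows "(d = 0 \<longrightarrow> (\<forall>x. f (x - lin l x *s v) = f x)) \<and>
         (\<forall>e. d = Suc e \<longrightarrow> (\<exists>g. form e g \<and> (\<forall>x. f x = f (x - lin l x *s v) + lin l x * g x)))"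
  using assms
proof (induction rule: form.induct)
  case (const c)
  show ?case by simp
next
  case (coord d f i)
  show ?case
  proof (cases d)
    case 0
    then have "\<forall>x. f (x - lin l x *s v) = f x" using coord by simp
    moreover have "form 0 (\<lambda>x. v $ i * f x)" using coord.hyps 0 by (simp add: form_scale)
    ultimately show ?thesis using 0 by (auto intro!: exI[of _ "\<lambda>x. v $ i * f x"] simp: algebra_simps)
  next
    case (Suc e)
    then obtain g where g: "form e g" "\<forall>x. f x = f (x - lin l x *s v) + lin l x * g x"
      using coord by auto
    \<comment> \<open>Product rule: \<open>lin l x * v $ i * f (x - lin l x *s v)\<close> is added
      and subtracted.\<close>
    define k where "k = (\<lambda>x. x $ i * g x + v $ i * f (x - lin l x *s v))"
    have "form d k"
      unfolding k_def Suc using coord.hyps g(1) unfolding Suc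
      by (intro form.add form.coord form_scale form_compose_proj)
    moreover have "x $ i * f x = (x - lin l x *s v) $ i * f (x - lin l x *s v) + lin l x * k x" for x
    proof -
      have "x $ i * f x = x $ i * (f (x - lin l x *s v) + lin l x * g x)" using g(2) by metis
      then show ?thesis by (simp add: k_def algebra_simps)
    qed
    ultimately show ?thesis by auto
  qed
next
  case (add d f f')
  show ?case
  proof (cases d)
    case 0
    then show ?thesis using add by simp
  next
    case (Suc e)
    then obtain g g' where g: "form e g" "\<forall>x. f x = f (x - lin l x *s v) + lin l x * g x"
      "form e g'" "\<forall>x. f' x = f' (x - lin l x *s v) + lin l x * g' x"
      using add by auto
    have "form e (\<lambda>x. g x + g' x)" using g by (intro form.add)
    moreover have "f x + f' x = f (x - lin l x *s v) + f' (x - lin l x *s v) + lin l x * (g x + g' x)" for x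
    proof -
      have "f x + f' x = (f (x - lin l x *s v) + lin l x * g x) + (f' (x - lin l x *s v) + lin l x * g' x)"
        using g(2,4) by metis
      then show ?thesis by (simp add: algebra_simps)
    qed
    ultimately show ?thesis using Suc by blast
  qed
qed

text \<open>With \<open>lin l v = 1\<close> the substitution in \<open>form_proj_diff\<close> is a
  projection onto the line, where \<open>f\<close> vanishes, so no remainder is left.\<close>

lemma form_divide:
  assumes "form (Suc d) f" "l \<noteq> 0" "\<And>x. lin l x = 0 \<Longrightarrow> f x = 0"
  shows "\<exists>g. form d g \<and> (\<forall>x. f x = lin l x * g x)"
proof -
  obtain w where w: "lin l w \<noteq> 0" using assms(2) lin_eq_zero_iff by blast
  define v where "v = (1 / lin l w) *s w"
  have v: "lin l v = 1" using w by (simp add: v_def)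
  obtain g where g: "form d g" "\<forall>x. f x = f (x - lin l x *s v) + lin l x * g x"
    using form_proj_diff[OF assms(1)] by blast
  have "f (x - lin l x *s v) = 0" for x by (rule assms(3)) (simp add: v)
  then show ?thesis using g by (metis add_0)
qed

text \<open>The parametrisation misses \<open>q\<close>, the point at infinity of the line. The
  coefficient of degree \<open>d\<close> records the value there, so a zero at \<open>q\<close>
  shows up as a drop in degree.\<close>

lemma form_on_line:
  assumes "form d f"
  shows "\<exists>r. degree r \<le> d \<and> coeff r d = f q \<and> (\<forall>t. f (p + t *s q) = poly r t)"
  using assms
proof (induction rule: form.induct)
  case (const c)
  show ?case by (intro exI[of _ "[:c:]"]) simp
next
  case (coord d f i)
  then obtain r where r: "degree r \<le> d" "coeff r d = f q" "\<forall>t. f (p + t *s q) = poly r t" by blast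
  have "degree ([:p $ i, q $ i:] * r) \<le> Suc d"
    using degree_mult_le[of "[:p $ i, q $ i:]" r] r(1) by (simp split: if_splits)
  moreover have "coeff ([:p $ i, q $ i:] * r) (Suc d) = q $ i * f q"
    using r by (simp add: coeff_eq_0)
  ultimately show ?case using r(3) by (intro exI[of _ "[:p $ i, q $ i:] * r"]) (auto simp: algebra_simps)
next
  case (add d f g)
  then obtain r s where "degree r \<le> d" "coeff r d = f q" "\<forall>t. f (p + t *s q) = poly r t"
    "degree s \<le> d" "coeff s d = g q" "\<forall>t. g (p + t *s q) = poly s t" by blast
  then show ?case by (intro exI[of _ "r + s"]) (auto intro: degree_add_le)
qed

text \<open>Restrict to the line joining a point where \<open>f\<close> is nonzero to one where
  \<open>g\<close> is nonzero: polynomials in one variable have no zero divisors. Taking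
  \<open>l = 0\<close> gives the whole plane.\<close>

lemma form_domain:
  assumes "form d f" "form e g" "\<And>x. lin l x = 0 \<Longrightarrow> f x * g x = 0"
  shows "(\<forall>x. lin l x = 0 \<longrightarrow> f x = 0) \<or> (\<forall>x. lin l x = 0 \<longrightarrow> g x = 0)"
proof (rule ccontr)
  assume "\<not> ?thesis"
  then obtain x y where xy: "lin l x = 0" "f x \<noteq> 0" "lin l y = 0" "g y \<noteq> 0" by blast
  obtain r where r: "\<forall>t. f (x + t *s (y - x)) = poly r t" using form_on_line[OF assms(1)] by blast
  obtain s where s: "\<forall>t. g (x + t *s (y - x)) = poly s t" using form_on_line[OF assms(2)] by blast
  have "poly (r * s) t = 0" for t
    using assms(3)[of "x + t *s (y - x)"] xy r s by simp
  then have "r * s = 0" using poly_all_0_iff_0 by blast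
  moreover have "poly r 0 \<noteq> 0" using r[rule_format, of 0] xy by (simp add: vec3_eq_iff)
  moreover have "poly s 1 \<noteq> 0" using s[rule_format, of 1] xy by simp
  ultimately show False by auto
qed

lemma form_domain_UNIV:
  assumes "form d f" "form e g" "\<And>x. f x * g x = 0"
  shows "(\<forall>x. f x = 0) \<or> (\<forall>x. g x = 0)"
  using form_domain[OF assms(1,2), of 0] assms(3) by simp

lemma form_vanish_on_pencil:
  assumes "form d f" "f q = 0" "finite T" "card T \<ge> d" "\<And>t. t \<in> T \<Longrightarrow> f (p + t *s q) = 0"
  shows "f (u *s p + v *s q) = 0"
proof -
  obtain r where r: "degree r \<le> d" "coeff r d = f q" "\<forall>t. f (p + t *s q) = poly r t"
    using form_on_line[OF assms(1)] by blast
  have "r = 0"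
  proof (rule ccontr)
    assume nz: "r \<noteq> 0"
    have "degree r \<noteq> d" using nz r(2) assms(2) leading_coeff_0_iff by fastforce
    then have "degree r < d" using r(1) by simp
    moreover have "card T \<le> card {x. poly r x = 0}"
      using assms(5) r(3) by (intro card_mono poly_roots_finite nz) auto
    moreover have "card {x. poly r x = 0} \<le> degree r" by (rule card_poly_roots_bound) fact
    ultimately show False using assms(4) by simp
  qed
  show ?thesis
  proof (cases "u = 0")
    case True
    then show ?thesis using form_homogeneous[OF assms(1), of v q] assms(2) by simp
  next
    case False
    then have "u *s p + v *s q = u *s (p + (v / u) *s q)"
      by (simp add: vec3_eq_iff field_simps)
    then show ?thesis using form_homogeneous[OF assms(1)] r(3) \<open>r = 0\<close> by simp
  qed
qed

text \<open>One point becomes the point at infinity of a coordinate on the line; the others get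
  distinct finite coordinates, since equal ones would make the vectors proportional.\<close>

lemma form_vanish_on_line:
  assumes f: "form d f" "d \<ge> 1" and S: "finite S" "card S > d"
    and l: "l \<noteq> 0" "\<And>x. x \<in> S \<Longrightarrow> lin l x = 0" and fS: "\<And>x. x \<in> S \<Longrightarrow> f x = 0"
    and ind: "\<And>x y. x \<in> S \<Longrightarrow> y \<in> S \<Longrightarrow> x \<noteq> y \<Longrightarrow> crs x y \<noteq> 0"
    and x: "lin l x = 0"
  shows "f x = 0"
proof -
  obtain q where q: "q \<in> S" using S f(2) by (metis card.empty equals0I less_nat_zero_code)
  have "card (S - {q}) \<ge> d" using S q by simp
  then obtain p where p: "p \<in> S" "p \<noteq> q" using f(2)
    by (metis DiffE card.empty equals0I insertI1 le_zero_eq not_one_le_zero)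
  have pq: "crs p q \<noteq> 0" using ind p q by blast
  have "\<exists>u v. y = u *s p + v *s q" if "y \<in> S" for y
    using in_line_combination l that p q pq by blast
  then obtain U V where UV: "\<And>y. y \<in> S \<Longrightarrow> y = U y *s p + V y *s q" by metis
  have U0: "U y \<noteq> 0" if "y \<in> S - {q}" for y
  proof
    assume "U y = 0"
    then have "y = V y *s q" using UV[of y] that by simp
    then have "crs y q = 0" by (metis crs_scale(1) crs_self vec.scale_zero_right)
    then show False using ind[of y q] that q by auto
  qed
  define t where "t = (\<lambda>y. V y / U y)"
  have y_eq: "y = U y *s (p + t y *s q)" if "y \<in> S - {q}" for y
    using UV[of y] U0[OF that] that by (simp add: t_def vec3_eq_iff field_simps)
  have "inj_on t (S - {q})"
  proof (rule inj_onI, rule ccontr)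
    fix y z assume yz: "y \<in> S - {q}" "z \<in> S - {q}" "t y = t z" "y \<noteq> z"
    have "crs (U y *s (p + t y *s q)) (U z *s (p + t y *s q)) = 0" by simp
    then have "crs y z = 0" using y_eq[OF yz(1)] y_eq[OF yz(2)] yz(3) by metis
    then show False using ind yz by blast
  qed
  then have "card (t ` (S - {q})) \<ge> d" using \<open>card (S - {q}) \<ge> d\<close> by (simp add: card_image)
  moreover have "f (p + s *s q) = 0" if s: "s \<in> t ` (S - {q})" for s
  proof -
    obtain y where y: "y \<in> S - {q}" "s = t y" using s by blast
    have "f y = U y ^ d * f (p + s *s q)"
      using y_eq[OF y(1)] form_homogeneous[OF f(1)] y(2) by metis
    then show ?thesis using fS[of y] U0[of y] y by simp
  qed
  ultimately have "f (u *s p + v *s q) = 0" for u v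
    using S fS[OF q] by (intro form_vanish_on_pencil[OF f(1), where T = "t ` (S - {q})"]) auto
  then show ?thesis
    using in_line_combination[of l p q x] l p q pq x by auto
qed

section \<open>Monomials, coefficients and dimension counts\<close>

definition exps :: "nat \<Rightarrow> (3 \<Rightarrow> nat) set" where
  "exps d = {m. (\<Sum>i\<in>UNIV. m i) = d}"

definition monom3 :: "(3 \<Rightarrow> nat) \<Rightarrow> complex ^ 3 \<Rightarrow> complex" where
  "monom3 m x = (\<Prod>j\<in>UNIV. x $ j ^ m j)"

definition expo :: "nat \<Rightarrow> nat \<Rightarrow> nat \<Rightarrow> 3 \<Rightarrow> nat" where
  "expo d i j = (\<lambda>k. if k = 1 then i else if k = 2 then j else d - i - j)"

lemma prod_UNIV_3: "(\<Prod>i\<in>(UNIV :: 3 set). f i) = f 1 * f 2 * f 3" for f :: "3 \<Rightarrow> 'a :: comm_monoid_mult"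
proof -
  have "(1::3) \<noteq> 2" "(1::3) \<noteq> 3" "(2::3) \<noteq> 3" by simp_all
  then show ?thesis unfolding UNIV_3 by (simp add: mult.assoc)
qed

lemma exps_eq: "exps d = (\<lambda>(i, j). expo d i j) ` (SIGMA i:{..d}. {..d - i})"
proof (intro equalityI subsetI)
  fix m assume m: "m \<in> exps d"
  then have "m 1 + m 2 + m 3 = d" by (simp add: exps_def sum_3)
  then have "m = expo d (m 1) (m 2)" "m 1 \<le> d" "m 2 \<le> d - m 1"
    by (auto simp: expo_def fun_eq_iff forall_3)
  then show "m \<in> (\<lambda>(i, j). expo d i j) ` (SIGMA i:{..d}. {..d - i})"
    by (intro image_eqI[of _ _ "(m 1, m 2)"]) auto
next
  fix m assume "m \<in> (\<lambda>(i, j). expo d i j) ` (SIGMA i:{..d}. {..d - i})"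
  then obtain i j where ij: "m = expo d i j" "i \<le> d" "j \<le> d - i" by force
  have "m 1 = i" "m 2 = j" "m 3 = d - i - j" by (simp_all add: ij(1) expo_def)
  then show "m \<in> exps d" using ij by (simp add: exps_def sum_3)
qed

lemma inj_expo: "inj_on (\<lambda>(i, j). expo d i j) (SIGMA i:{..d}. {..d - i})"
proof (rule inj_onI)
  fix u v assume "(case u of (i, j) \<Rightarrow> expo d i j) = (case v of (i, j) \<Rightarrow> expo d i j)"
  then have "expo d (fst u) (snd u) k = expo d (fst v) (snd v) k" for k by (simp add: case_prod_beta)
  from this[of 1] this[of 2] show "u = v" by (simp add: expo_def prod_eq_iff)
qed

lemma finite_exps: "finite (exps d)"
  unfolding exps_eq by (intro finite_imageI finite_SigmaI) auto

lemma card_exps: "card (exps d) = (\<Sum>i\<le>d. Suc (d - i))"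
  unfolding exps_eq card_image[OF inj_expo] by simp

lemma monom3_expo: "monom3 (expo d i j) x = x $ 1 ^ i * x $ 2 ^ j * x $ 3 ^ (d - i - j)"
  by (simp add: monom3_def prod_UNIV_3 expo_def)

lemma sum_exps: "(\<Sum>m\<in>exps d. g m) = (\<Sum>i\<le>d. \<Sum>j\<le>d - i. g (expo d i j))"
proof -
  have "(\<Sum>m\<in>exps d. g m) = (\<Sum>(i, j)\<in>(SIGMA i:{..d}. {..d - i}). g (expo d i j))"
    unfolding exps_eq sum.reindex[OF inj_expo] by (simp add: case_prod_beta)
  then show ?thesis by (simp add: sum.Sigma)
qed

text \<open>Setting the third coordinate to 1 loses nothing in a fixed degree; the remaining two
  variables are treated one at a time.\<close>

lemma monomials_independent:
  assumes "\<And>x. (\<Sum>m\<in>exps d. c m * monom3 m x) = 0" and m: "m \<in> exps d"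
  shows "c m = 0"
proof -
  have z: "(\<Sum>i\<le>d. (\<Sum>j\<le>d - i. c (expo d i j) * v ^ j) * u ^ i) = 0" for u v :: complex
    using assms(1)[of "vector [u, v, 1]"]
    by (simp add: sum_exps monom3_expo sum_distrib_left sum_distrib_right ac_simps)
  have "(\<Sum>j\<le>d - i. c (expo d i j) * v ^ j) = 0" if "i \<le> d" for i v
    using z[of v] that polyfun_eq_0[where n = d and c = "\<lambda>i. \<Sum>j\<le>d - i. c (expo d i j) * v ^ j"] by simp
  then have "c (expo d i j) = 0" if "i \<le> d" "j \<le> d - i" for i j
    using that polyfun_eq_0[where n = "d - i" and c = "\<lambda>j. c (expo d i j)"] by simp
  then show ?thesis using m by (auto simp: exps_eq)
qed

lemma form_monom3: "form (\<Sum>i\<in>UNIV. m i) (monom3 m)"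
proof -
  have p: "form k (\<lambda>x. x $ i ^ k)" for k i
  proof (induction k)
    case 0 then show ?case using form.const[of 1] by simp
  next
    case (Suc k) then show ?case using form.coord[of k _ i] by simp
  qed
  have "form (m 1 + m 2 + m 3) (\<lambda>x. x $ 1 ^ m 1 * x $ 2 ^ m 2 * x $ 3 ^ m 3)"
    by (intro form_mult p)
  then show ?thesis by (simp add: sum_3 monom3_def[abs_def] prod_UNIV_3)
qed

lemma form_of_coeffs: "form d (\<lambda>x. \<Sum>m\<in>exps d. c m * monom3 m x)"
proof (intro form_sum form_scale)
  fix m assume "m \<in> exps d"
  then show "form d (monom3 m)" using form_monom3[of m] by (simp add: exps_def)
qed

lemma form_coeffs: "form d f \<Longrightarrow> \<exists>c. \<forall>x. f x = (\<Sum>m\<in>exps d. c m * monom3 m x)"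
proof (induction rule: form.induct)
  case (const c)
  then show ?case by (intro exI[of _ "\<lambda>_. c"]) (simp add: sum_exps monom3_expo)
next
  case (coord d f i)
  then obtain c where c: "\<forall>x. f x = (\<Sum>m\<in>exps d. c m * monom3 m x)" by blast
  define up where "up = (\<lambda>m::3 \<Rightarrow> nat. m(i := Suc (m i)))"
  define down where "down = (\<lambda>m::3 \<Rightarrow> nat. m(i := m i - 1))"
  have down_up: "down (up m) = m" for m by (simp add: up_def down_def)
  have inj: "inj_on up (exps d)" by (metis down_up inj_onI)
  have sub: "up ` exps d \<subseteq> exps (Suc d)"
    using exhaust_3[of i] by (auto simp: exps_def sum_3 up_def)
  have mono_up: "monom3 (up m) x = x $ i * monom3 m x" for m x
    using exhaust_3[of i] by (auto simp: monom3_def prod_UNIV_3 up_def)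
  define c' where "c' = (\<lambda>m. if m \<in> up ` exps d then c (down m) else 0)"
  have "x $ i * f x = (\<Sum>m\<in>exps (Suc d). c' m * monom3 m x)" for x
  proof -
    have "x $ i * f x = (\<Sum>m\<in>exps d. c' (up m) * monom3 (up m) x)"
      unfolding c[rule_format] sum_distrib_left
      by (rule sum.cong) (auto simp: c'_def down_up mono_up)
    also have "\<dots> = (\<Sum>m\<in>up ` exps d. c' m * monom3 m x)"
      by (simp add: sum.reindex[OF inj])
    also have "\<dots> = (\<Sum>m\<in>exps (Suc d). c' m * monom3 m x)"
      by (rule sum.mono_neutral_left) (auto simp: finite_exps sub[THEN subsetD] c'_def)
    finally show ?thesis .
  qed
  then show ?case by blast
next
  case (add d f g)
  then obtain c c' where "\<forall>x. f x = (\<Sum>m\<in>exps d. c m * monom3 m x)"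
    "\<forall>x. g x = (\<Sum>m\<in>exps d. c' m * monom3 m x)" by blast
  then show ?case by (intro exI[of _ "\<lambda>m. c m + c' m"]) (simp add: algebra_simps sum.distrib)
qed

text \<open>Gaussian elimination: a pivot \<open>k\<close> removes the equation \<open>j\<close> and
  one unknown, so the surplus of unknowns survives.\<close>

lemma underdetermined_system:
  fixes a :: "'i \<Rightarrow> 'j \<Rightarrow> complex"
  assumes "finite J" "finite I" "card J < card I"
  shows "\<exists>c. (\<exists>i\<in>I. c i \<noteq> 0) \<and> (\<forall>j\<in>J. (\<Sum>i\<in>I. c i * a i j) = 0)"
  using assms
proof (induction J arbitrary: I a rule: finite_induct)
  case empty
  then have "I \<noteq> {}" by auto
  then show ?case by (auto intro!: exI[of _ "\<lambda>_. 1"])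
next
  case (insert j J)
  show ?case
  proof (cases "\<forall>i\<in>I. a i j = 0")
    case True
    obtain c where "\<exists>i\<in>I. c i \<noteq> 0" "\<forall>j\<in>J. (\<Sum>i\<in>I. c i * a i j) = 0"
      using insert.IH[of I a] insert.prems insert.hyps by auto
    then show ?thesis using True by (intro exI[of _ c]) auto
  next
    case False
    then obtain k where k: "k \<in> I" "a k j \<noteq> 0" by blast
    have "finite (I - {k})" "card J < card (I - {k})"
      using insert.prems insert.hyps k by auto
    then obtain c where c: "\<exists>i\<in>I - {k}. c i \<noteq> 0"
      "\<forall>j'\<in>J. (\<Sum>i\<in>I - {k}. c i * (a i j' - a i j / a k j * a k j')) = 0"
      using insert.IH[of "I - {k}" "\<lambda>i j'. a i j' - a i j / a k j * a k j'"] by blast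
    \<comment> \<open>The value of the pivot unknown that makes equation \<open>j\<close> hold; the
      modified matrix then makes the other equations hold as well.\<close>
    define s where "s = - (\<Sum>i\<in>I - {k}. c i * a i j) / a k j"
    define c' where "c' = c(k := s)"
    have split: "(\<Sum>i\<in>I. c' i * a i j') = s * a k j' + (\<Sum>i\<in>I - {k}. c i * a i j')" for j'
      using insert.prems(1) k(1) by (subst sum.remove[of _ k]) (auto simp: c'_def intro!: sum.cong)
    have "(\<Sum>i\<in>I. c' i * a i j') = 0" if "j' \<in> J" for j'
    proof -
      have "0 = (\<Sum>i\<in>I - {k}. c i * a i j') - (\<Sum>i\<in>I - {k}. c i * a i j) / a k j * a k j'"
        using c(2)[rule_format, OF that]
        by (simp add: right_diff_distrib sum_subtractf sum_distrib_right sum_divide_distrib mult.assoc)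
      then show ?thesis by (simp add: split s_def)
    qed
    moreover have "(\<Sum>i\<in>I. c' i * a i j) = 0" using k by (simp add: split s_def)
    moreover have "\<exists>i\<in>I. c' i \<noteq> 0" using c(1) by (auto simp: c'_def)
    ultimately show ?thesis by blast
  qed
qed

lemma forms_dependent:
  assumes "finite I" "card (exps d) < card I" "\<And>i. i \<in> I \<Longrightarrow> form d (f i)"
  shows "\<exists>c. (\<exists>i\<in>I. c i \<noteq> 0) \<and> (\<forall>x. (\<Sum>i\<in>I. c i * f i x) = 0)"
proof -
  have "\<forall>i\<in>I. \<exists>c. \<forall>x. f i x = (\<Sum>m\<in>exps d. c m * monom3 m x)"
    using assms(3) form_coeffs by blast
  then obtain a where a: "\<And>i x. i \<in> I \<Longrightarrow> f i x = (\<Sum>m\<in>exps d. a i m * monom3 m x)" by metis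
  obtain c where c: "\<exists>i\<in>I. c i \<noteq> 0" "\<forall>m\<in>exps d. (\<Sum>i\<in>I. c i * a i m) = 0"
    using underdetermined_system[OF finite_exps assms(1,2), of a] by blast
  have "(\<Sum>i\<in>I. c i * f i x) = 0" for x
  proof -
    have "(\<Sum>i\<in>I. c i * f i x) = (\<Sum>i\<in>I. \<Sum>m\<in>exps d. (c i * a i m) * monom3 m x)"
      by (rule sum.cong) (auto simp: a sum_distrib_left mult.assoc)
    also have "\<dots> = (\<Sum>m\<in>exps d. (\<Sum>i\<in>I. c i * a i m) * monom3 m x)"
      by (subst sum.swap) (simp add: sum_distrib_right)
    also have "\<dots> = 0" using c(2) by simp
    finally show ?thesis .
  qed
  then show ?thesis using c(1) by blast
qed

lemma form_through_points:
  assumes "finite S" "card S < card (exps d)"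
  shows "\<exists>f. form d f \<and> (\<exists>x. f x \<noteq> 0) \<and> (\<forall>x\<in>S. f x = 0)"
proof -
  obtain c where c: "\<exists>m\<in>exps d. c m \<noteq> 0" "\<forall>x\<in>S. (\<Sum>m\<in>exps d. c m * monom3 m x) = 0"
    using underdetermined_system[OF assms(1) finite_exps assms(2)] by metis
  have "\<exists>x. (\<Sum>m\<in>exps d. c m * monom3 m x) \<noteq> 0"
    using monomials_independent[where d = d and c = c] c(1) by blast
  then show ?thesis using c(2) form_of_coeffs by blast
qed

lemma form_0: "form 0 f \<Longrightarrow> f x = f 0"
proof -
  assume "form 0 f"
  then have a: "f (0 *s x) = 0 ^ 0 * f x" by (rule form_homogeneous)
  have b: "0 *s x = 0" by simp
  from a show "f x = f 0" unfolding b by simp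
qed

lemma form_1:
  assumes "form 1 f"
  shows "\<exists>l. \<forall>x. f x = lin l x"
proof -
  obtain c where "\<forall>x. f x = (\<Sum>m\<in>exps 1. c m * monom3 m x)"
    using form_coeffs[OF assms] by (rule exE)
  then have c: "f x = (\<Sum>m\<in>exps 1. c m * monom3 m x)" for x by (rule spec)
  have "f x = lin (vector [c (expo 1 1 0), c (expo 1 0 1), c (expo 1 0 0)]) x" for x
    unfolding c sum_exps monom3_expo lin_def by simp
  then show ?thesis by blast
qed

section \<open>Conics and cubics\<close>

text \<open>Stands for irreducibility: in degree 2 or 3 a proper factorisation contains a linear
  factor. It also excludes the zero form.\<close>

definition noline :: "(complex ^ 3 \<Rightarrow> complex) \<Rightarrow> bool" where
  "noline f \<longleftrightarrow> \<not> (\<exists>l. l \<noteq> 0 \<and> (\<forall>x. lin l x = 0 \<longrightarrow> f x = 0))"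

lemma crs_nonzero_if_separated:
  assumes "lin l p = 0" "lin l q \<noteq> 0" "p \<noteq> 0"
  shows "crs p q \<noteq> 0"
proof
  assume "crs p q = 0"
  then have "crs q p = 0" by (simp add: crs_eq_0_commute)
  then obtain t where "q = t *s p" using crs_eq_0_imp_multiple assms(3) by blast
  then show False using assms by simp
qed

lemma conic_vanish_on_line:
  assumes "form 2 f" "l \<noteq> 0" "lin l p = 0" "lin l q = 0" "lin l r = 0" "f p = 0" "f q = 0" "f r = 0"
    "crs p q \<noteq> 0" "crs p r \<noteq> 0" "crs q r \<noteq> 0" "lin l x = 0"
  shows "f x = 0"
proof (rule form_vanish_on_line[where S = "{p, q, r}" and l = l])
  have "p \<noteq> q" "p \<noteq> r" "q \<noteq> r" using assms by auto
  then show "2 < card {p, q, r}" by simp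
  show "crs u v \<noteq> 0" if "u \<in> {p, q, r}" "v \<in> {p, q, r}" "u \<noteq> v" for u v
    using that assms(9-11) by (auto simp: crs_eq_0_commute)
qed (use assms in auto)

lemma cubic_vanish_on_line:
  assumes "form 3 f" "l \<noteq> 0" "lin l p = 0" "lin l q = 0" "lin l r = 0" "lin l s = 0"
    "f p = 0" "f q = 0" "f r = 0" "f s = 0"
    "crs p q \<noteq> 0" "crs p r \<noteq> 0" "crs p s \<noteq> 0" "crs q r \<noteq> 0" "crs q s \<noteq> 0" "crs r s \<noteq> 0" "lin l x = 0"
  shows "f x = 0"
proof (rule form_vanish_on_line[where S = "{p, q, r, s}" and l = l])
  have "p \<noteq> q" "p \<noteq> r" "p \<noteq> s" "q \<noteq> r" "q \<noteq> s" "r \<noteq> s" using assms by auto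
  then show "3 < card {p, q, r, s}" by simp
  show "crs u v \<noteq> 0" if "u \<in> {p, q, r, s}" "v \<in> {p, q, r, s}" "u \<noteq> v" for u v
    using that assms(11-16) by (auto simp: crs_eq_0_commute)
qed (use assms in auto)

lemma conic_divide:
  assumes "form 2 f" "l \<noteq> 0" "\<And>x. lin l x = 0 \<Longrightarrow> f x = 0"
  shows "\<exists>g. form 1 g \<and> (\<forall>x. f x = lin l x * g x)"
  using form_divide[of 1 f l] assms unfolding Suc_1 by blast

lemma cubic_divide:
  assumes "form 3 f" "l \<noteq> 0" "\<And>x. lin l x = 0 \<Longrightarrow> f x = 0"
  shows "\<exists>g. form 2 g \<and> (\<forall>x. f x = lin l x * g x)"
  using form_divide[of 2 f l] assms unfolding eval_nat_numeral by blast

lemma form_lin_conic: "form 2 Q \<Longrightarrow> form 3 (\<lambda>x. lin l x * Q x)"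
  using form_mult[OF form_lin, of 2 Q l] by (simp add: numeral_3_eq_3)

lemma linear_form_eq_0:
  assumes "form 1 k" "k p = 0" "k q = 0" "k r = 0" "det3 p q r \<noteq> 0"
  shows "k x = 0"
proof -
  obtain l where l: "\<And>x. k x = lin l x" using form_1[OF assms(1)] by blast
  have pq: "crs p q \<noteq> 0" using assms(5) by (auto simp: det3_def)
  obtain t where "l = t *s crs p q" using line_through[of l p q] assms(2,3) l pq by auto
  moreover have "t * det3 p q r = 0" using assms(4) l calculation by (simp add: det3_def)
  ultimately show ?thesis using l assms(5) by simp
qed

lemma noline_conic_not_collinear:
  assumes "form 2 f" "noline f" "f p = 0" "f q = 0" "f r = 0"
    "crs p q \<noteq> 0" "crs p r \<noteq> 0" "crs q r \<noteq> 0"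
  shows "det3 p q r \<noteq> 0"
proof
  assume "det3 p q r = 0"
  then have "f x = 0" if "lin (crs p q) x = 0" for x
    using conic_vanish_on_line[OF assms(1), of "crs p q" p q r x] assms that by (simp add: det3_def)
  then show False using assms(2,6) by (auto simp: noline_def)
qed

lemma crs_add_right: "crs p (q + r) = crs p q + crs p r"
  and crs_diff_right: "crs p (q - r) = crs p q - crs p r"
  by (simp_all add: vec3_eq_iff algebra_simps)

text \<open>A third zero would put the whole secant on the conic. This supplies auxiliary points at
  which division by the value of \<open>f\<close> is possible.\<close>

lemma noline_conic_secant:
  assumes "form 2 f" "noline f" "f p = 0" "f q = 0" "crs p q \<noteq> 0" "a \<noteq> 0" "b \<noteq> 0"
  shows "f (a *s p + b *s q) \<noteq> 0"
proof
  assume "f (a *s p + b *s q) = 0"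
  moreover have "crs p (a *s p + b *s q) \<noteq> 0" "crs q (a *s p + b *s q) \<noteq> 0"
    using assms crs_eq_0_commute[of p q] by (auto simp: crs_add_right)
  moreover have "det3 p q (a *s p + b *s q) = 0" by (simp add: det3_def)
  ultimately show False using noline_conic_not_collinear[OF assms(1,2,3,4)] assms(5) by blast
qed

lemma obtain_distinct:
  assumes "finite S" "n \<le> card S"
  shows "\<exists>p. inj_on p {..<n} \<and> p ` {..<n} \<subseteq> S"
proof -
  obtain T where T: "T \<subseteq> S" "card T = n" using obtain_subset_with_card_n[OF assms(2)] by blast
  have "finite T" using T assms(1) finite_subset by blast
  then obtain h where "bij_betw h {0..<card T} T" using ex_bij_betw_nat_finite by blast
  then show ?thesis using T by (intro exI[of _ h]) (auto simp: bij_betw_def atLeast0LessThan)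
qed

text \<open>The constant \<open>c\<close> is tuned so that \<open>g - c f\<close> has a third zero
  on the secant of \<open>p 0\<close> and \<open>p 1\<close>. Splitting off that line leaves a
  linear form with three non-collinear zeros.\<close>

lemma noline_conic_unique:
  assumes f: "form 2 f" "noline f" and g: "form 2 g"
    and S: "finite S" "card S \<ge> 5" "\<And>x. x \<in> S \<Longrightarrow> f x = 0" "\<And>x. x \<in> S \<Longrightarrow> g x = 0"
    and ind: "\<And>x y. x \<in> S \<Longrightarrow> y \<in> S \<Longrightarrow> x \<noteq> y \<Longrightarrow> crs x y \<noteq> 0"
  shows "\<exists>c. \<forall>x. g x = c * f x"
proof -
  obtain p where p: "inj_on p {..<5::nat}" "p ` {..<5} \<subseteq> S" using obtain_distinct[OF S(1,2)] by blast
  have z: "f (p i) = 0" "g (p i) = 0" if "i < 5" for i using p that S by auto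
  have pi: "crs (p i) (p j) \<noteq> 0" if "i < 5" "j < 5" "i \<noteq> j" for i j
    using ind[of "p i" "p j"] p that by (auto simp: inj_on_def)
  have d: "det3 (p i) (p j) (p k) \<noteq> 0" if "i < 5" "j < 5" "k < 5" "i \<noteq> j" "i \<noteq> k" "j \<noteq> k" for i j k
    using noline_conic_not_collinear[OF f] z pi that by simp
  define l where "l = crs (p 0) (p 1)"
  define r where "r = p 0 + p 1"
  have fr: "f r \<noteq> 0" using noline_conic_secant[OF f, of "p 0" "p 1" 1 1] z pi by (simp add: r_def)
  define c where "c = g r / f r"
  define h where "h = (\<lambda>x. g x - c * f x)"
  have h: "form 2 h" unfolding h_def by (intro form_diff form_scale f g)
  have "crs (p 0) (p 1) \<noteq> 0" "crs (p 1) (p 0) \<noteq> 0" using pi[of 0 1] pi[of 1 0] by auto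
  moreover have "h r = 0" using fr by (simp add: h_def c_def)
  moreover have "h (p 0) = 0" "h (p 1) = 0" using z by (simp_all add: h_def)
  ultimately have "h x = 0" if "lin l x = 0" for x
    using conic_vanish_on_line[OF h, of l "p 0" "p 1" r x] that
    by (simp add: l_def r_def crs_add_right)
  then obtain k where k: "form 1 k" "\<forall>x. h x = lin l x * k x"
    using conic_divide[OF h, of l] pi[of 0 1] by (auto simp: l_def)
  have "k (p i) = 0" if "i \<in> {2, 3, 4}" for i
  proof -
    have "h (p i) = 0" using that z by (auto simp: h_def)
    moreover have "lin l (p i) \<noteq> 0" using d[of 0 1 i] that by (auto simp: l_def det3_def)
    ultimately show ?thesis using k(2) by simp
  qed
  then have "k x = 0" for x using linear_form_eq_0[OF k(1), of "p 2" "p 3" "p 4"] d[of 2 3 4] by simp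
  then have "h x = 0" for x using k(2) by simp
  then have "\<forall>x. g x = c * f x" by (simp add: h_def)
  then show ?thesis by blast
qed

lemma linear_form_interpolation:
  assumes "det3 r s t \<noteq> 0"
  shows "\<exists>l. lin l r = a \<and> lin l s = b \<and> lin l t = c"
proof -
  define D where "D = det3 r s t"
  define l where "l = (a / D) *s crs s t + ((b / D) *s crs t r + (c / D) *s crs r s)"
  have "lin (crs s t) r = D" "lin (crs t r) s = D" "lin (crs r s) t = D"
    by (simp_all add: D_def det3_def lin_def algebra_simps)
  then have "lin l r = a" "lin l s = b" "lin l t = c"
    using assms by (simp_all add: l_def D_def)
  then show ?thesis by blast
qed

text \<open>Bezout, as 7 > 2 * 3. The three coefficients of \<open>l\<close> are spent on giving
  \<open>F - l Q\<close> two extra zeros on the secant \<open>l1\<close> and one on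
  \<open>l2\<close>. Both lines then split off, and the remaining linear form has three
  non-collinear zeros.\<close>

lemma cubic_containing_conic:
  assumes Q: "form 2 Q" "noline Q" and F: "form 3 F"
    and S: "finite S" "card S \<ge> 7" "\<And>x. x \<in> S \<Longrightarrow> Q x = 0" "\<And>x. x \<in> S \<Longrightarrow> F x = 0"
    and ind: "\<And>x y. x \<in> S \<Longrightarrow> y \<in> S \<Longrightarrow> x \<noteq> y \<Longrightarrow> crs x y \<noteq> 0"
  shows "\<exists>l. \<forall>x. F x = lin l x * Q x"
proof -
  obtain p where p: "inj_on p {..<7::nat}" "p ` {..<7} \<subseteq> S" using obtain_distinct[OF S(1,2)] by blast
  have z: "Q (p i) = 0" "F (p i) = 0" if "i < 7" for i using p that S by auto
  have pi: "crs (p i) (p j) \<noteq> 0" if "i < 7" "j < 7" "i \<noteq> j" for i j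
    using ind[of "p i" "p j"] p that by (auto simp: inj_on_def)
  have d: "det3 (p i) (p j) (p k) \<noteq> 0" if "i < 7" "j < 7" "k < 7" "i \<noteq> j" "i \<noteq> k" "j \<noteq> k" for i j k
    using noline_conic_not_collinear[OF Q] z pi that by simp
  define l1 where "l1 = crs (p 0) (p 1)"
  define l2 where "l2 = crs (p 2) (p 3)"
  define r where "r = 1 *s p 0 + 1 *s p 1"
  define s where "s = 1 *s p 0 + (-1) *s p 1"
  have l1p2: "lin l1 (p i) \<noteq> 0" if "i \<in> {2, 3, 4, 5, 6}" for i
    using d[of 0 1 i] that by (auto simp: l1_def det3_def)
  have l2p: "lin l2 (p i) \<noteq> 0" if "i \<in> {4, 5, 6}" for i
    using d[of 2 3 i] that by (auto simp: l2_def det3_def)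
  \<comment> \<open>Not both \<open>p 2 + p 3\<close> and \<open>p 2 - p 3\<close> lie on
    \<open>l1\<close>, else \<open>p 2\<close> would. The point \<open>t\<close> must avoid
    \<open>l1\<close> for independence from \<open>r\<close>, \<open>s\<close> and to pass its zero
    on to \<open>K\<close>.\<close>
  obtain b :: complex where b: "b \<noteq> 0" "lin l1 (p 2 + b *s p 3) \<noteq> 0"
  proof (cases "lin l1 (p 2 + 1 *s p 3) = 0")
    case True
    then have "lin l1 (p 2 + (-1) *s p 3) \<noteq> 0" using l1p2[of 2] l1p2[of 3] by (auto simp: eq_neg_iff_add_eq_0)
    then show ?thesis using that[of "-1"] by simp
  next
    case False
    then show ?thesis using that[of 1] by simp
  qed
  define t where "t = 1 *s p 2 + b *s p 3"
  have t1: "lin l1 t \<noteq> 0" using b by (simp add: t_def)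
  have Qn: "Q r \<noteq> 0" "Q s \<noteq> 0" "Q t \<noteq> 0"
    unfolding r_def s_def t_def
    using z pi b(1) by (intro noline_conic_secant[OF Q]; simp)+
  have "det3 r s t = -2 * lin l1 t"
    by (simp add: r_def s_def l1_def det3_def lin_def algebra_simps)
  then have "det3 r s t \<noteq> 0" using t1 by simp
  then obtain l where l: "lin l r = F r / Q r" "lin l s = F s / Q s" "lin l t = F t / Q t"
    using linear_form_interpolation by blast
  define h where "h = (\<lambda>x. F x - lin l x * Q x)"
  have h: "form 3 h" unfolding h_def by (intro form_diff form_lin_conic F Q)
  have hz: "h r = 0" "h s = 0" "h t = 0" using l Qn by (simp_all add: h_def)
  have hp: "h (p i) = 0" if "i < 7" for i using z that by (simp add: h_def)
  have "h x = 0" if "lin l1 x = 0" for x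
  proof (rule cubic_vanish_on_line[OF h, of l1 "p 0" "p 1" r s])
    show "crs r s \<noteq> 0"
    proof -
      have "crs r s = (-2) *s crs (p 0) (p 1)"
        by (simp add: r_def s_def vec3_eq_iff algebra_simps)
      then show ?thesis using pi[of 0 1] by simp
    qed
  qed (use that hz hp[of 0] hp[of 1] pi[of 0 1] pi[of 1 0] in
      \<open>simp_all add: l1_def r_def s_def crs_add_right crs_diff_right\<close>)
  then obtain K where K: "form 2 K" "\<forall>x. h x = lin l1 x * K x"
    using cubic_divide[OF h, of l1] pi[of 0 1] by (auto simp: l1_def)
  have Kz: "K (p i) = 0" if "i \<in> {2, 3, 4, 5, 6}" for i
    using K(2) hp[of i] l1p2[OF that] that by auto
  have "K t = 0" using K(2) hz(3) t1 by auto
  have "K x = 0" if "lin l2 x = 0" for x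
    by (rule conic_vanish_on_line[OF K(1), of l2 "p 2" "p 3" t])
      (use that \<open>K t = 0\<close> Kz[of 2] Kz[of 3] pi[of 2 3] pi[of 3 2] b(1) in
        \<open>simp_all add: l2_def t_def crs_add_right\<close>)
  then obtain k where k: "form 1 k" "\<forall>x. K x = lin l2 x * k x"
    using conic_divide[OF K(1), of l2] pi[of 2 3] by (auto simp: l2_def)
  have "k (p i) = 0" if "i \<in> {4, 5, 6}" for i
    using k(2) Kz[of i] l2p[OF that] that by auto
  then have "k x = 0" for x using linear_form_eq_0[OF k(1), of "p 4" "p 5" "p 6"] d[of 4 5 6] by simp
  then have "h x = 0" for x using K(2) k(2) by simp
  then have "\<forall>x. F x = lin l x * Q x" by (simp add: h_def)
  then show ?thesis by blast
qed

lemma noline_nonzero: "noline f \<Longrightarrow> \<exists>x. f x \<noteq> 0"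
  unfolding noline_def by (metis zero_neq_one axis_eq_0_iff)

lemma lin_crs_eq_det3: "lin (crs q r) p = det3 p q r"
  using det3_rotate[of q r p] by (simp add: det3_def lin_def algebra_simps)

section \<open>Bezout for two cubics\<close>

lemma obtain_basis:
  assumes "q \<noteq> 0"
  shows "\<exists>u v. det3 u v q \<noteq> 0"
proof -
  obtain v where v: "crs v q \<noteq> 0"
  proof -
    consider "q $ 1 \<noteq> 0" | "q $ 2 \<noteq> 0" | "q $ 3 \<noteq> 0" using assms by (auto simp: vec3_eq_iff)
    then show ?thesis
      by cases (rule that[of "axis 2 1"] that[of "axis 1 1"], simp add: vec3_eq_iff axis_def)+
  qed
  obtain u where "lin (crs v q) u \<noteq> 0" using v lin_eq_zero_iff by blast
  then have "det3 u v q \<noteq> 0" by (simp add: lin_crs_eq_det3)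
  then show ?thesis by blast
qed

text \<open>Every line through a point \<open>q\<close> off the conic meets it: the restricted
  polynomial has leading coefficient \<open>Q q\<close>, hence degree 2 and a root. Distinct lines
  of the pencil give distinct points.\<close>

lemma noline_conic_points:
  assumes Q: "form 2 Q" "noline Q"
  shows "\<exists>S. finite S \<and> card S = N \<and> (\<forall>x\<in>S. Q x = 0) \<and> (\<forall>x\<in>S. \<forall>y\<in>S. x \<noteq> y \<longrightarrow> crs x y \<noteq> 0)"
proof -
  obtain q where q: "Q q \<noteq> 0" using noline_nonzero Q(2) by blast
  have "q \<noteq> 0" using q form_homogeneous[OF Q(1), of 0 q] by auto
  then obtain u v where uv: "det3 u v q \<noteq> 0" using obtain_basis by blast
  have "\<exists>s. Q ((u + t *s v) + s *s q) = 0" for t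
  proof -
    obtain r where r: "degree r \<le> 2" "coeff r 2 = Q q" "\<forall>s. Q ((u + t *s v) + s *s q) = poly r s"
      using form_on_line[OF Q(1)] by blast
    then have "degree r = 2" using q le_degree[of r 2] by simp
    then have "\<not> constant (poly r)" by (simp add: constant_degree)
    then show ?thesis using fundamental_theorem_of_algebra r(3) by auto
  qed
  then obtain s where s: "\<And>t. Q ((u + t *s v) + s t *s q) = 0" by metis
  define P where "P = (\<lambda>t. (u + t *s v) + s t *s q)"
  have lP: "lin (crs v q) (P t) = det3 u v q" "lin (crs q u) (P t) = t * det3 u v q" for t
    by (simp_all add: P_def det3_def lin_def algebra_simps)
  have ind: "t = t'" if z: "crs (P t) (P t') = 0" for t t'
  proof -
    have "P t' \<noteq> 0" using lP(1)[of t'] uv by auto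
    then obtain a where a: "P t = a *s P t'" using crs_eq_0_imp_multiple z by blast
    have "det3 u v q = a * det3 u v q" using lP(1)[of t] lP(1)[of t'] by (simp add: a)
    then have "a = 1" using uv by simp
    then have "P t = P t'" using a by simp
    then have "t * det3 u v q = t' * det3 u v q" using lP(2)[of t] lP(2)[of t'] by metis
    then show ?thesis using uv by simp
  qed
  then have inj: "inj P" by (metis crs_self injI)
  have "inj (\<lambda>n. P (of_nat n))" by (rule injI, drule injD[OF inj]) simp
  then have "card ((\<lambda>n. P (of_nat n)) ` {..<N}) = N"
    by (subst card_image) (auto intro: inj_on_subset)
  moreover have "crs x y \<noteq> 0" if "x \<in> (\<lambda>n. P (of_nat n)) ` {..<N}" "y \<in> (\<lambda>n. P (of_nat n)) ` {..<N}" "x \<noteq> y" for x y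
    using that ind by (metis imageE)
  ultimately show ?thesis
    by (intro exI[of _ "(\<lambda>n. P (of_nat n)) ` {..<N}"]) (auto simp: s P_def)
qed

text \<open>As \<open>F\<close> is irreducible of degree 3, it shares no factor with the conic
  \<open>Q\<close>, so \<open>Q\<close> must divide \<open>P\<close>. Lines in \<open>Q\<close> are
  cancelled one by one; without lines, counting zeros on \<open>Q\<close> decides.\<close>

lemma noline_cubic_syzygy:
  assumes F: "form 3 F" "noline F" and G: "form 3 G" and P: "form 2 P" and Q: "form 2 Q"
    and rel: "\<And>x. P x * F x + Q x * G x = 0" and nz: "(\<exists>x. P x \<noteq> 0) \<or> (\<exists>x. Q x \<noteq> 0)"
  shows "\<exists>c. \<forall>x. G x = c * F x"
proof -
  have Qnz: "\<exists>x. Q x \<noteq> 0"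
  proof (rule ccontr)
    assume Q0: "\<not> ?thesis"
    then have "P x * F x = 0" for x using rel[of x] by simp
    then show False using form_domain_UNIV[OF P F(1)] noline_nonzero[OF F(2)] nz Q0 by blast
  qed
  \<comment> \<open>Cancels a nonzero form: a remaining line in the first case, \<open>Q\<close>
    itself in the second.\<close>
  have concl: ?thesis if R: "form d R" "\<exists>x. R x \<noteq> 0" "\<And>x. R x * (c * F x + G x) = 0" for d R c
  proof -
    have "form 3 (\<lambda>x. c * F x + G x)" by (intro form.add form_scale F G)
    then have "\<forall>x. c * F x + G x = 0" using form_domain_UNIV[OF R(1)] R(2,3) by blast
    then have "\<forall>x. G x = - c * F x" by (simp add: add_eq_0_iff)
    then show ?thesis by blast
  qed
  show ?thesis
  proof (cases "noline Q")
    case False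
    then obtain l where l: "l \<noteq> 0" "\<And>x. lin l x = 0 \<Longrightarrow> Q x = 0" by (auto simp: noline_def)
    have "P x * F x = 0" if "lin l x = 0" for x using rel[of x] l(2)[OF that] by simp
    then have "\<And>x. lin l x = 0 \<Longrightarrow> P x = 0"
      using form_domain[OF P F(1), of l] F(2) l(1) unfolding noline_def by blast
    then obtain P1 where P1: "form 1 P1" "\<forall>x. P x = lin l x * P1 x" using conic_divide[OF P l(1)] by blast
    obtain Q1 where Q1: "form 1 Q1" "\<forall>x. Q x = lin l x * Q1 x" using conic_divide[OF Q l] by blast
    have f4: "form 4 (\<lambda>x. P1 x * F x + Q1 x * G x)"
      using form.add[OF form_mult[OF P1(1) F(1)] form_mult[OF Q1(1) G]] by simp
    have "lin l x * (P1 x * F x + Q1 x * G x) = 0" for x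
      using rel[of x] P1(2) Q1(2) by (simp add: algebra_simps)
    then have rel1: "P1 x * F x + Q1 x * G x = 0" for x
      using form_domain_UNIV[OF form_lin f4] l(1) lin_eq_zero_iff by blast
    obtain n where n: "\<And>x. Q1 x = lin n x" using form_1[OF Q1(1)] by blast
    have "n \<noteq> 0" using Qnz Q1(2) n by auto
    have "P1 x * F x = 0" if "lin n x = 0" for x using rel1[of x] that by (simp add: n)
    then have "\<And>x. lin n x = 0 \<Longrightarrow> P1 x = 0"
      using form_domain[OF P1(1) F(1), of n] F(2) \<open>n \<noteq> 0\<close> unfolding noline_def by blast
    then obtain k where k: "form 0 k" "\<forall>x. P1 x = lin n x * k x"
      using form_divide[of 0 P1 n] P1(1) \<open>n \<noteq> 0\<close> by auto
    have "lin n x * (k 0 * F x + G x) = 0" for x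
      using rel1[of x] k(2) form_0[OF k(1), of x] by (simp add: n algebra_simps)
    then show ?thesis using concl[OF form_lin, of n] \<open>n \<noteq> 0\<close> lin_eq_zero_iff by blast
  next
    case True
    \<comment> \<open>11 = 4 + 6 + 1: each point is a zero of \<open>P\<close> or of
      \<open>F\<close>. Five zeros of \<open>P\<close> make it a multiple of \<open>Q\<close>; seven
      zeros of \<open>F\<close> would make \<open>Q\<close> divide \<open>F\<close>.\<close>
    obtain S where S: "finite S" "card S = 11" "\<forall>x\<in>S. Q x = 0" "\<forall>x\<in>S. \<forall>y\<in>S. x \<noteq> y \<longrightarrow> crs x y \<noteq> 0"
      using noline_conic_points[OF Q True] by blast
    define S1 where "S1 = {x \<in> S. P x = 0}"
    define S2 where "S2 = {x \<in> S. F x = 0}"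
    have fin: "finite S1" "finite S2" using S(1) by (auto simp: S1_def S2_def)
    have "P x = 0 \<or> F x = 0" if "x \<in> S" for x using rel[of x] S(3) that by auto
    then have "S = S1 \<union> S2" by (auto simp: S1_def S2_def)
    then have "11 \<le> card S1 + card S2" using card_Un_le[of S1 S2] S(2) by simp
    then consider "card S1 \<ge> 5" | "card S2 \<ge> 7" by linarith
    then show ?thesis
    proof cases
      case 1
      have "\<exists>c. \<forall>x. P x = c * Q x"
        by (rule noline_conic_unique[OF Q True P fin(1) 1]) (use S(3,4) in \<open>simp_all add: S1_def\<close>)
      then obtain c where c: "\<forall>x. P x = c * Q x" by blast
      have "Q x * (c * F x + G x) = 0" for x
        using rel[of x] c by (simp add: algebra_simps)
      then show ?thesis using concl[OF Q Qnz] by blast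
    next
      case 2
      have "\<exists>l. \<forall>x. F x = lin l x * Q x"
        by (rule cubic_containing_conic[OF Q True F(1) fin(2) 2]) (use S(3,4) in \<open>simp_all add: S2_def\<close>)
      then obtain l where l: "\<forall>x. F x = lin l x * Q x" by blast
      have "l \<noteq> 0" using l noline_nonzero[OF F(2)] by auto
      then have False using F(2) l by (auto simp: noline_def)
      then show ?thesis ..
    qed
  qed
qed

text \<open>A product of lines missing \<open>p\<close>: one through a single point and one through
  each of \<open>k\<close> pairs. By the last hypothesis, any three points of \<open>S\<close>
  contain two whose line misses \<open>p\<close>.\<close>

lemma separating_form:
  assumes "finite S" "card S = 2 * k + 1" "p \<noteq> 0" "\<And>x. x \<in> S \<Longrightarrow> crs p x \<noteq> 0"
    and "\<And>x y z. x \<in> S \<Longrightarrow> y \<in> S \<Longrightarrow> z \<in> S \<Longrightarrow> x \<noteq> y \<Longrightarrow> x \<noteq> z \<Longrightarrow> y \<noteq> z \<Longrightarrow>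
           det3 p x y \<noteq> 0 \<or> det3 p x z \<noteq> 0"
  shows "\<exists>E. form (k + 1) E \<and> E p \<noteq> 0 \<and> (\<forall>x\<in>S. E x = 0)"
  using assms
proof (induction k arbitrary: S)
  case 0
  then obtain x where x: "S = {x}" by (auto simp: card_1_singleton_iff)
  obtain w where w: "lin (crs p x) w \<noteq> 0" using lin_eq_zero_iff 0(4) x by blast
  have "lin (crs x w) p \<noteq> 0" using w lin_crs_eq_det3[of x w p] by (simp add: det3_def)
  then show ?case using x form_lin[of "crs x w"] by (intro exI[of _ "lin (crs x w)"]) auto
next
  case (Suc k)
  obtain q where q: "inj_on q {..<3::nat}" "q ` {..<3} \<subseteq> S" using obtain_distinct[OF Suc.prems(1), of 3] Suc.prems(2) by auto
  have q': "q 0 \<in> S" "q 1 \<in> S" "q 2 \<in> S" "q 0 \<noteq> q 1" "q 0 \<noteq> q 2" "q 1 \<noteq> q 2"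
    using q(2) by (auto dest!: inj_onD[OF q(1)])
  obtain x y where xy: "x \<in> S" "y \<in> S" "x \<noteq> y" "det3 p x y \<noteq> 0"
    using Suc.prems(5)[of "q 0" "q 1" "q 2"] q' by blast
  define S' where "S' = S - {x, y}"
  have "card S' = 2 * k + 1" using Suc.prems(1,2) xy by (simp add: S'_def card_Diff_subset)
  moreover have sub: "S' \<subseteq> S" "finite S'" using Suc.prems(1) by (auto simp: S'_def)
  ultimately have "\<exists>E. form (k + 1) E \<and> E p \<noteq> 0 \<and> (\<forall>x\<in>S'. E x = 0)"
    by (intro Suc.IH) (use Suc.prems(3-5) in blast)+
  then obtain E where E: "form (k + 1) E" "E p \<noteq> 0" "\<forall>x\<in>S'. E x = 0" by blast
  have "lin (crs x y) p \<noteq> 0" using xy(4) by (simp add: lin_crs_eq_det3)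
  moreover have "form (Suc k + 1) (\<lambda>z. lin (crs x y) z * E z)" using form_lin_mult[OF E(1)] by simp
  ultimately show ?case using E by (intro exI[of _ "\<lambda>z. lin (crs x y) z * E z"]) (auto simp: S'_def)
qed

lemma card_exps_2: "card (exps 2) = 6" and card_exps_3: "card (exps 3) = 10" and card_exps_5: "card (exps 5) = 21"
  by (simp_all add: card_exps eval_nat_numeral)

text \<open>Six conic multiples of \<open>F\<close>, six of \<open>G\<close> and ten quintics dual
  to the points exceed the dimension 21 of the quintics. Evaluating a linear dependency at the
  points removes the ten and leaves a syzygy of \<open>F\<close> and \<open>G\<close>.\<close>

lemma noline_cubic_unique:
  assumes F: "form 3 F" "noline F" and G: "form 3 G"
    and S: "finite S" "card S = 10" "\<And>x. x \<in> S \<Longrightarrow> F x = 0" "\<And>x. x \<in> S \<Longrightarrow> G x = 0"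
    and ind: "\<And>x y. x \<in> S \<Longrightarrow> y \<in> S \<Longrightarrow> x \<noteq> y \<Longrightarrow> crs x y \<noteq> 0"
  shows "\<exists>c. \<forall>x. G x = c * F x"
proof -
  have nz: "p \<noteq> 0" if p: "p \<in> S" for p
  proof -
    have "S \<noteq> {p}" using S(2) by auto
    then obtain q where "q \<in> S" "q \<noteq> p" using p by blast
    then show ?thesis using ind[of p q] p by auto
  qed
  have nc: "det3 p x y \<noteq> 0 \<or> det3 p x z \<noteq> 0"
    if h: "p \<in> S" "x \<in> S" "y \<in> S" "z \<in> S" "p \<noteq> x" "p \<noteq> y" "p \<noteq> z" "x \<noteq> y" "x \<noteq> z" "y \<noteq> z" for p x y z
  proof (rule ccontr)
    assume "\<not> ?thesis"
    then have "F w = 0" if "lin (crs p x) w = 0" for w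
      using cubic_vanish_on_line[OF F(1), of "crs p x" p x y z w] that h S(3) ind by (simp add: det3_def)
    then show False using F(2) ind[of p x] h by (auto simp: noline_def)
  qed
  have "\<exists>E. form 5 E \<and> E p \<noteq> 0 \<and> (\<forall>x\<in>S - {p}. E x = 0)" if p: "p \<in> S" for p
  proof -
    \<comment> \<open>The other 9 = 2 * 4 + 1 points need five lines, hence degree 5.\<close>
    have "\<exists>E. form (4 + 1) E \<and> E p \<noteq> 0 \<and> (\<forall>x\<in>S - {p}. E x = 0)"
    proof (rule separating_form)
      show "card (S - {p}) = 2 * 4 + 1" using S(1,2) p by simp
      show "crs p x \<noteq> 0" if "x \<in> S - {p}" for x using that ind[of p x] p by auto
      show "det3 p x y \<noteq> 0 \<or> det3 p x z \<noteq> 0"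
        if "x \<in> S - {p}" "y \<in> S - {p}" "z \<in> S - {p}" "x \<noteq> y" "x \<noteq> z" "y \<noteq> z" for x y z
        using nc[of p x y z] that p by blast
    qed (use S(1) nz p in auto)
    then show ?thesis by simp
  qed
  then obtain E where E: "\<And>p. p \<in> S \<Longrightarrow> form 5 (E p)" "\<And>p. p \<in> S \<Longrightarrow> E p p \<noteq> 0"
      "\<And>p x. p \<in> S \<Longrightarrow> x \<in> S \<Longrightarrow> x \<noteq> p \<Longrightarrow> E p x = 0"
    by (metis Diff_iff singletonD)
  define I where "I = exps 2 <+> (exps 2 <+> S)"
  define f where "f = case_sum (\<lambda>m x. monom3 m x * F x) (case_sum (\<lambda>m x. monom3 m x * G x) E)"
  have finI: "finite I" using S(1) by (auto simp: I_def finite_exps)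
  have cardI: "card I = 22" using S(1,2) by (simp add: I_def finite_exps card_Plus card_exps_2)
  have m2: "form 2 (monom3 m)" if "m \<in> exps 2" for m using form_monom3[of m] that by (simp add: exps_def)
  have mF: "form 5 (\<lambda>x. monom3 m x * F x)" "form 5 (\<lambda>x. monom3 m x * G x)" if "m \<in> exps 2" for m
    using form_mult[OF m2[OF that] F(1)] form_mult[OF m2[OF that] G] by simp_all
  have "form 5 (f i)" if "i \<in> I" for i using that mF E(1) by (auto simp: I_def f_def)
  then obtain c where c: "\<exists>i\<in>I. c i \<noteq> 0" "\<forall>x. (\<Sum>i\<in>I. c i * f i x) = 0"
    using forms_dependent[of I 5 f] finI cardI card_exps_5 by auto
  define P where "P = (\<lambda>x. \<Sum>m\<in>exps 2. c (Inl m) * monom3 m x)"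
  define Q where "Q = (\<lambda>x. \<Sum>m\<in>exps 2. c (Inr (Inl m)) * monom3 m x)"
  have sum0: "P x * F x + Q x * G x + (\<Sum>s\<in>S. c (Inr (Inr s)) * E s x) = 0" for x
  proof -
    have "(\<Sum>i\<in>I. c i * f i x) = P x * F x + (Q x * G x + (\<Sum>s\<in>S. c (Inr (Inr s)) * E s x))"
      unfolding I_def using S(1)
      by (simp add: sum.Plus finite_exps f_def P_def Q_def sum_distrib_right mult.assoc)
    then show ?thesis using c(2) by (simp add: add.assoc)
  qed
  have cS: "c (Inr (Inr s)) = 0" if "s \<in> S" for s
  proof -
    have "(\<Sum>t\<in>S. c (Inr (Inr t)) * E t s) = (\<Sum>t\<in>S. if t = s then c (Inr (Inr s)) * E s s else 0)"
      using E(3) that by (intro sum.cong) auto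
    then have "c (Inr (Inr s)) * E s s = 0" using sum0[of s] S that by simp
    then show ?thesis using E(2)[OF that] by simp
  qed
  then have rel: "P x * F x + Q x * G x = 0" for x using sum0[of x] by simp
  have "(\<exists>x. P x \<noteq> 0) \<or> (\<exists>x. Q x \<noteq> 0)"
  proof (rule ccontr)
    assume "\<not> ?thesis"
    then have "\<And>m. m \<in> exps 2 \<Longrightarrow> c (Inl m) = 0" "\<And>m. m \<in> exps 2 \<Longrightarrow> c (Inr (Inl m)) = 0"
      using monomials_independent[where c = "\<lambda>m. c (Inl m)" and d = 2]
        monomials_independent[where c = "\<lambda>m. c (Inr (Inl m))" and d = 2]
      by (auto simp: P_def Q_def)
    then show False using c(1) cS by (auto simp: I_def)
  qed
  moreover have "form 2 P" "form 2 Q" unfolding P_def Q_def by (rule form_of_coeffs)+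
  ultimately show ?thesis using noline_cubic_syzygy[OF F G _ _ rel] by blast
qed

text \<open>Subtracting a multiple of the product of the \<open>M j\<close>, which vanishes on the
  whole grid, creates a fourth zero \<open>r\<close> on \<open>L 0\<close>. Then \<open>L 0\<close>
  splits off, next \<open>L 1\<close> by three zeros, and the remaining linear form has two zeros on
  \<open>L 2\<close>, hence vanishes on it.\<close>

lemma cayley_bacharach:
  fixes p :: "nat \<Rightarrow> nat \<Rightarrow> complex ^ 3"
  assumes f: "form 3 f"
    and L: "\<And>i i' j. i < 3 \<Longrightarrow> i' < 3 \<Longrightarrow> j < 3 \<Longrightarrow> lin (L i) (p i' j) = 0 \<longleftrightarrow> i = i'"
    and M: "\<And>i j j'. i < 3 \<Longrightarrow> j < 3 \<Longrightarrow> j' < 3 \<Longrightarrow> lin (M j) (p i j') = 0 \<longleftrightarrow> j = j'"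
    and z: "\<And>i j. i < 3 \<Longrightarrow> j < 3 \<Longrightarrow> i \<noteq> 2 \<or> j \<noteq> 2 \<Longrightarrow> f (p i j) = 0"
  shows "f (p 2 2) = 0"
proof -
  have pnz: "p i j \<noteq> 0" if ij: "i < 3" "j < 3" for i j
  proof -
    obtain j' where "j' < (3::nat)" "j' \<noteq> j" by (cases "j = 0") (auto intro: that[of 0] that[of 1])
    then show ?thesis using M[of i j' j] ij by auto
  qed
  have ind: "crs (p i j) (p i j') \<noteq> 0" if "i < 3" "j < 3" "j' < 3" "j \<noteq> j'" for i j j'
    using crs_nonzero_if_separated[of "M j" "p i j" "p i j'"] M pnz that by simp
  have Lnz: "L i \<noteq> 0" if i: "i < 3" for i
  proof -
    obtain i' where "i' < (3::nat)" "i' \<noteq> i" by (cases "i = 0") (auto intro: that[of 0] that[of 1])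
    then show ?thesis using L[of i i' 0] i by auto
  qed
  \<comment> \<open>The point \<open>r\<close> must avoid every \<open>M j\<close>, so that the
    product is nonzero there; a choice of sign suffices to avoid \<open>M 2\<close>.\<close>
  obtain t :: complex where t: "t \<noteq> 0" "lin (M 2) (p 0 0 + t *s p 0 1) \<noteq> 0"
  proof (cases "lin (M 2) (p 0 0 + 1 *s p 0 1) = 0")
    case True
    have "lin (M 2) (p 0 0) \<noteq> 0" using M[of 0 2 0] by simp
    then have "lin (M 2) (p 0 0 + (-1) *s p 0 1) \<noteq> 0" using True by (auto simp: eq_neg_iff_add_eq_0)
    then show ?thesis using that[of "-1"] by simp
  next
    case False
    then show ?thesis using that[of 1] by simp
  qed
  define r where "r = p 0 0 + t *s p 0 1"
  have Mr: "lin (M j) r \<noteq> 0" if j: "j < 3" for j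
  proof -
    consider "j = 0" | "j = 1" | "j = 2" using j by linarith
    then show ?thesis using t M[of 0 0 0] M[of 0 0 1] M[of 0 1 0] M[of 0 1 1] by cases (auto simp: r_def)
  qed
  define m where "m = (\<lambda>x. lin (M 0) x * (lin (M 1) x * lin (M 2) x))"
  have m: "form 3 m" unfolding m_def
    using form_lin_conic[of "\<lambda>x. lin (M 1) x * lin (M 2) x" "M 0"] form_lin_mult[OF form_lin, of "M 1" "M 2"]
    by (simp add: numeral_2_eq_2)
  have mz: "m (p i j) = 0" if ij: "i < 3" "j < 3" for i j
  proof -
    consider "j = 0" | "j = 1" | "j = 2" using ij by linarith
    then show ?thesis using M[of i j j] ij by cases (auto simp: m_def)
  qed
  have "m r \<noteq> 0" using Mr by (simp add: m_def)
  define c where "c = f r / m r"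
  define g where "g = (\<lambda>x. f x - c * m x)"
  have g: "form 3 g" unfolding g_def by (intro form_diff form_scale f m)
  have gz: "g (p i j) = 0" if "i < 3" "j < 3" "i \<noteq> 2 \<or> j \<noteq> 2" for i j
    using z mz that by (simp add: g_def)
  have gr: "g r = 0" using \<open>m r \<noteq> 0\<close> by (simp add: g_def c_def)
  have indr: "crs (p 0 j) r \<noteq> 0" if "j < 3" for j
    using crs_nonzero_if_separated[of "M j" "p 0 j" r] M[of 0 j j] Mr[OF that] pnz[of 0 j] that by simp
  have Lr: "lin (L 0) r = 0" using L[of 0 0 0] L[of 0 0 1] by (simp add: r_def)
  have "g x = 0" if "lin (L 0) x = 0" for x
    by (rule cubic_vanish_on_line[OF g, of "L 0" "p 0 0" "p 0 1" "p 0 2" r])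
      (use that gz gr ind indr Lr Lnz L in simp_all)
  then obtain Q where Q: "form 2 Q" "\<forall>x. g x = lin (L 0) x * Q x"
    using cubic_divide[OF g, of "L 0"] Lnz by auto
  have Qz: "Q (p i j) = 0" if "i < 3" "j < 3" "i \<noteq> 0" "i \<noteq> 2 \<or> j \<noteq> 2" for i j
    using Q(2) gz[OF that(1,2,4)] L[of 0 i j] that by simp
  have "Q x = 0" if "lin (L 1) x = 0" for x
    by (rule conic_vanish_on_line[OF Q(1), of "L 1" "p 1 0" "p 1 1" "p 1 2"])
      (use that Qz ind Lnz L in simp_all)
  then obtain k where k: "form 1 k" "\<forall>x. Q x = lin (L 1) x * k x"
    using conic_divide[OF Q(1), of "L 1"] Lnz by auto
  have kz: "k (p 2 j) = 0" if "j < 2" for j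
    using k(2) Qz[of 2 j] L[of 1 2 j] that by simp
  have "k (p 2 2) = 0"
    by (rule form_vanish_on_line[OF k(1), of "{p 2 0, p 2 1}" "L 2"])
      (use kz ind[of 2 0 1] ind[of 2 1 0] Lnz[of 2] L in \<open>auto simp: card_insert_if\<close>)
  then have "g (p 2 2) = 0" using Q(2) k(2) by simp
  then show ?thesis using mz[of 2 2] by (simp add: g_def)
qed

section \<open>Nets of points and Cayley--Bacharach\<close>

text \<open>The index group \<open>'i\<close> maps onto a subgroup of \<open>H\<close>, and \<open>Z\<close> is the kernel: \<open>n\<int>\<close> for a cyclic
  subgroup, a subgroup of \<open>\<int> \<times> \<int>\<close> when a coset representative is adjoined.\<close>

definition net :: "'i::ab_group_add set \<Rightarrow> ('i \<Rightarrow> complex ^ 3) \<Rightarrow> ('i \<Rightarrow> complex ^ 3) \<Rightarrow> ('i \<Rightarrow> complex ^ 3) \<Rightarrow> bool"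
  where "net Z A B C \<longleftrightarrow>
    (\<forall>x y z. det3 (A x) (B y) (C z) = 0 \<longleftrightarrow> x + y + z \<in> Z) \<and>
    0 \<in> Z \<and> (\<forall>x\<in>Z. \<forall>y\<in>Z. x - y \<in> Z) \<and> Z \<noteq> UNIV"

lemma net_det3: "net Z A B C \<Longrightarrow> det3 (A x) (B y) (C z) = 0 \<longleftrightarrow> x + y + z \<in> Z"
  and net_0: "net Z A B C \<Longrightarrow> 0 \<in> Z"
  and net_diff: "net Z A B C \<Longrightarrow> x \<in> Z \<Longrightarrow> y \<in> Z \<Longrightarrow> x - y \<in> Z"
  by (simp_all add: net_def)

lemma net_minus: "net Z A B C \<Longrightarrow> - x \<in> Z \<longleftrightarrow> x \<in> Z"
  using net_diff[of Z A B C 0 x] net_diff[of Z A B C 0 "- x"] net_0[of Z A B C] by auto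

lemma net_diff_commute: "net Z A B C \<Longrightarrow> x - y \<in> Z \<longleftrightarrow> y - x \<in> Z"
  using net_minus[of Z A B C "x - y"] by simp

lemma net_rotate:
  assumes "net Z A B C"
  shows "net Z B C A"
proof -
  have "det3 (B y) (C z) (A x) = 0 \<longleftrightarrow> y + z + x \<in> Z" for x y z
    using net_det3[OF assms, of x y z] det3_rotate[of "B y" "C z" "A x"] by (simp add: ac_simps)
  then show ?thesis using assms unfolding net_def by blast
qed

lemma net_swap:
  assumes "net Z A B C"
  shows "net Z B A C"
proof -
  have "det3 (B y) (A x) (C z) = 0 \<longleftrightarrow> y + x + z \<in> Z" for x y z
    using net_det3[OF assms, of x y z] det3_swap[of "B y" "A x" "C z"] by (simp add: ac_simps)
  then show ?thesis using assms unfolding net_def by blast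
qed

text \<open>Some index sum lies outside \<open>Z\<close> and gives a non-collinear triple; this is
  the use of \<open>Z \<noteq> UNIV\<close>.\<close>

lemma net_crs:
  assumes "net Z A B C"
  shows "crs (A x) (B y) \<noteq> 0"
proof -
  obtain w where "w \<notin> Z" using assms by (auto simp: net_def)
  then have "det3 (A x) (B y) (C (w - x - y)) \<noteq> 0" using net_det3[OF assms] by simp
  then show ?thesis by (auto simp: det3_def)
qed

lemma net_nonzero: "net Z A B C \<Longrightarrow> A x \<noteq> 0"
  using net_crs[of Z A B C x 0] by auto

lemma net_line_C: "net Z A B C \<Longrightarrow> lin (crs (A x) (B y)) (C z) = 0 \<longleftrightarrow> x + y + z \<in> Z"
  using net_det3[of Z A B C x y z] by (simp add: det3_def)

text \<open>The line also joins \<open>B y\<close> to \<open>C (- x - y)\<close>, which turns the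
  question into an instance of the net relation.\<close>

lemma net_line_A:
  assumes "net Z A B C"
  shows "lin (crs (A x) (B y)) (A x') = 0 \<longleftrightarrow> x - x' \<in> Z"
proof -
  define z where "z = - x - y"
  have "lin (crs (A x) (B y)) (C z) = 0"
    using net_line_C[OF assms, of x y z] net_0[OF assms] by (simp add: z_def)
  moreover have "crs (B y) (C z) \<noteq> 0" by (rule net_crs[OF net_rotate[OF assms]])
  ultimately obtain t where t: "crs (A x) (B y) = t *s crs (B y) (C z)"
    using line_through[of "crs (A x) (B y)" "B y" "C z"] by auto
  then have "t \<noteq> 0" using net_crs[OF assms, of x y] by auto
  then have "lin (crs (A x) (B y)) (A x') = 0 \<longleftrightarrow> y + z + x' \<in> Z"
    using net_line_C[OF net_rotate[OF assms], of y z x'] t by simp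
  also have "y + z + x' = x' - x" by (simp add: z_def)
  finally show ?thesis using net_diff_commute[OF assms] by simp
qed

lemma net_line_B:
  assumes "net Z A B C"
  shows "lin (crs (A x) (B y)) (B y') = 0 \<longleftrightarrow> y - y' \<in> Z"
proof -
  have "lin (crs (A x) (B y)) (B y') = - lin (crs (B y) (A x)) (B y')"
    by (simp add: lin_def algebra_simps)
  then show ?thesis using net_line_A[OF net_swap[OF assms], of y x y'] by simp
qed

lemmas net_line = net_line_A net_line_B net_line_C

lemma net_crs_same:
  assumes "net Z A B C" "x - x' \<notin> Z"
  shows "crs (A x) (A x') \<noteq> 0"
proof
  assume "crs (A x) (A x') = 0"
  then have "crs (A x') (A x) = 0" by (simp add: crs_eq_0_commute)
  then obtain t where "A x' = t *s A x" using crs_eq_0_imp_multiple net_nonzero assms(1) by blast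
  then have "lin (crs (A x) (B 0)) (A x') = 0" by simp
  then show False using net_line_A[OF assms(1)] assms(2) by blast
qed

lemma net_translate:
  assumes "net Z A B C" "r + s + t = 0"
  shows "net Z (\<lambda>x. A (r + x)) (\<lambda>y. B (s + y)) (\<lambda>z. C (t + z))"
proof -
  have "(r + x) + (s + y) + (t + z) = x + y + z" for x y z
    using assms(2) by (metis (no_types, lifting) add.assoc add.commute add_0)
  then have "\<forall>x y z. det3 (A (r + x)) (B (s + y)) (C (t + z)) = 0 \<longleftrightarrow> x + y + z \<in> Z"
    using net_det3[OF assms(1)] by metis
  then show ?thesis using assms(1) unfolding net_def by blast
qed

text \<open>The nine points form a square array in which each row and column has one point of each
  class and index sum 0. Rows and columns are the two triples of net lines; the conditions on
  \<open>a\<close>, \<open>a'\<close>, \<open>x\<close> keep each line away from the grid points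
  outside its own row or column.\<close>

lemma net_cayley_bacharach:
  assumes N: "net Z A B C" and f: "form 3 f"
    and d: "a - a' \<notin> Z" "a - x \<notin> Z" "a' - x \<notin> Z"
    and z: "f (A a) = 0" "f (A a') = 0" "f (A x) = 0" "f (B (b + a' - x)) = 0" "f (B (b + a - x)) = 0"
      "f (C (- b - a)) = 0" "f (C (- b - a')) = 0" "f (C (x - b - a - a')) = 0"
  shows "f (B b) = 0"
proof -
  define p where "p = (\<lambda>i j. [[A x, B (b + a' - x), C (- b - a')],
    [B (b + a - x), C (x - b - a - a'), A a'], [C (- b - a), A a, B b]] ! i ! j)"
  define L where "L = (\<lambda>i. [crs (A x) (B (b + a' - x)), crs (A a') (B (b + a - x)), crs (A a) (B b)] ! i)"
  define M where "M = (\<lambda>i. [crs (A x) (B (b + a - x)), crs (A a) (B (b + a' - x)), crs (A a') (B b)] ! i)"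
  have d': "a' - a \<notin> Z" "x - a \<notin> Z" "x - a' \<notin> Z"
    using d net_diff_commute[OF N] by blast+
  have three: "i < 3 \<longleftrightarrow> i = 0 \<or> i = 1 \<or> i = 2" for i :: nat by auto
  have "f (p 2 2) = 0"
  proof (rule cayley_bacharach[OF f, of L p M])
    show "lin (L i) (p i' j) = 0 \<longleftrightarrow> i = i'" if "i < 3" "i' < 3" "j < 3" for i i' j
      using that d d' net_0[OF N] unfolding three
      by (elim disjE) (simp_all add: L_def p_def net_line[OF N] algebra_simps)
    show "lin (M j) (p i j') = 0 \<longleftrightarrow> j = j'" if "i < 3" "j < 3" "j' < 3" for i j j'
      using that d d' net_0[OF N] unfolding three
      by (elim disjE) (simp_all add: M_def p_def net_line[OF N] algebra_simps)
    show "f (p i j) = 0" if "i < 3" "j < 3" "i \<noteq> 2 \<or> j \<noteq> 2" for i j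
      using that z unfolding three by (elim disjE) (simp_all add: p_def)
  qed
  then show ?thesis by (simp add: p_def)
qed

abbreviation cyc :: "int \<Rightarrow> int set" where "cyc n \<equiv> {i. n dvd i}"

lemma not_dvd_small: "n > \<bar>i\<bar> \<Longrightarrow> i \<noteq> 0 \<Longrightarrow> \<not> n dvd i" for n i :: int
  using dvd_imp_le_int[of i n] by linarith

text \<open>Each new point is the ninth of a grid whose other eight lie in the window of nine given
  points or were just gained. Thus the window can be moved by one in either direction.\<close>

lemma cyclic_net_step:
  assumes N: "net (cyc n) A B C" and n: "n \<ge> 5" and f: "form 3 f"
    and z: "f (A 0) = 0" "f (A 1) = 0" "f (A 2) = 0" "f (B 0) = 0" "f (B 1) = 0" "f (B 2) = 0"
      "f (C (-4)) = 0" "f (C (-3)) = 0" "f (C (-2)) = 0"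
  shows "f (A 3) = 0" "f (A (-1)) = 0" "f (B 3) = 0" "f (B (-1)) = 0" "f (C (-1)) = 0" "f (C (-5)) = 0"
proof -
  have nd: "i \<notin> cyc n" if "\<bar>i\<bar> < 5" "i \<noteq> 0" for i using not_dvd_small[of i n] n that by simp
  note swap = net_swap[OF N] and acb = net_swap[OF net_rotate[OF net_rotate[OF N]]]
  show A3: "f (A 3) = 0"
    by (rule net_cayley_bacharach[OF swap f, of 0 1 2]) ((rule nd; simp) | simp add: z)+
  show Cm1: "f (C (-1)) = 0"
    by (rule net_cayley_bacharach[OF acb f, of 0 1 2]) ((rule nd; simp) | simp add: z)+
  show B3: "f (B 3) = 0"
    by (rule net_cayley_bacharach[OF N f, of 0 1 2]) ((rule nd; simp) | simp add: z)+
  show "f (A (-1)) = 0"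
    by (rule net_cayley_bacharach[OF swap f, of 2 3 0]) ((rule nd; simp) | simp add: z B3 Cm1)+
  show "f (B (-1)) = 0"
    by (rule net_cayley_bacharach[OF N f, of 2 3 1]) ((rule nd; simp) | simp add: z A3 Cm1)+
  show "f (C (-5)) = 0"
    by (rule net_cayley_bacharach[OF acb f, of 2 3 1]) ((rule nd; simp) | simp add: z A3 B3)+
qed

lemma cyclic_net_cubic:
  assumes N: "net (cyc n) A B C" and n: "n \<ge> 5"
  shows "\<exists>f. form 3 f \<and> (\<exists>x. f x \<noteq> 0) \<and> (\<forall>i. f (A i) = 0 \<and> f (B i) = 0 \<and> f (C i) = 0)"
proof -
  \<comment> \<open>Nine conditions on the ten coefficients of a cubic.\<close>
  define S where "S = set [A 0, A 1, A 2, B 0, B 1, B 2, C (-4), C (-3), C (-2)]"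
  have "card S \<le> 9" unfolding S_def by (rule order_trans[OF card_length]) simp
  then obtain f where f: "form 3 f" "\<exists>x. f x \<noteq> 0" "\<forall>x\<in>S. f x = 0"
    using form_through_points[of S 3] card_exps_3 by (auto simp: S_def)
  \<comment> \<open>The window of \<open>cyclic_net_step\<close> with \<open>A\<close> shifted by
    \<open>t\<close> and \<open>B\<close> by \<open>u\<close>; the indices of \<open>C\<close> shift
    by \<open>- t - u\<close>.\<close>
  define W where "W = (\<lambda>t u. (\<forall>i. i - t \<in> {0..2} \<longrightarrow> f (A i) = 0) \<and> (\<forall>i. i - u \<in> {0..2} \<longrightarrow> f (B i) = 0)
    \<and> (\<forall>i. i + t + u \<in> {-4..-2} \<longrightarrow> f (C i) = 0))"
  have step: "W (t + 1) u \<and> W (t - 1) u \<and> W t (u + 1) \<and> W t (u - 1)" if w: "W t u" for t u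
  proof -
    have N': "net (cyc n) (\<lambda>x. A (t + x)) (\<lambda>y. B (u + y)) (\<lambda>z. C (- t - u + z))"
      by (rule net_translate[OF N]) simp
    have s: "f (A i) = 0" if "i - t \<in> {0..2}" for i using w that by (simp add: W_def)
    have s': "f (B i) = 0" if "i - u \<in> {0..2}" for i using w that by (simp add: W_def)
    have s'': "f (C i) = 0" if "i + t + u \<in> {-4..-2}" for i using w that by (simp add: W_def)
    have z: "f (A (t + 0)) = 0" "f (A (t + 1)) = 0" "f (A (t + 2)) = 0"
      "f (B (u + 0)) = 0" "f (B (u + 1)) = 0" "f (B (u + 2)) = 0"
      "f (C (- t - u + - 4)) = 0" "f (C (- t - u + - 3)) = 0" "f (C (- t - u + - 2)) = 0"
      by (rule s s' s''; simp)+
    note new = cyclic_net_step[OF N' n f(1) z]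
    have a: "f (A i) = 0" if "i - t \<in> {-1..3}" for i
    proof (cases "i - t \<in> {0..2}")
      case False
      then have "i = t + 3 \<or> i = t + - 1" using that by auto
      then show ?thesis using new(1,2) by blast
    qed (rule s)
    have b: "f (B i) = 0" if "i - u \<in> {-1..3}" for i
    proof (cases "i - u \<in> {0..2}")
      case False
      then have "i = u + 3 \<or> i = u + - 1" using that by auto
      then show ?thesis using new(3,4) by blast
    qed (rule s')
    have c: "f (C i) = 0" if "i + t + u \<in> {-5..-1}" for i
    proof (cases "i + t + u \<in> {-4..-2}")
      case False
      then have "i = - t - u + - 1 \<or> i = - t - u + - 5" using that by auto
      then show ?thesis using new(5,6) by blast
    qed (rule s'')
    show ?thesis unfolding W_def by (intro conjI allI impI; (rule a b c); simp)
  qed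
  have W0: "W 0 0"
  proof -
    have "f (A i) = 0" if "i - 0 \<in> {0..2}" for i
    proof -
      have "i = 0 \<or> i = 1 \<or> i = 2" using that by auto
      then show ?thesis using f(3) by (auto simp: S_def)
    qed
    moreover have "f (B i) = 0" if "i - 0 \<in> {0..2}" for i
    proof -
      have "i = 0 \<or> i = 1 \<or> i = 2" using that by auto
      then show ?thesis using f(3) by (auto simp: S_def)
    qed
    moreover have "f (C i) = 0" if "i + 0 + 0 \<in> {-4..-2}" for i
    proof -
      have "i = -4 \<or> i = -3 \<or> i = -2" using that by auto
      then show ?thesis using f(3) by (auto simp: S_def)
    qed
    ultimately show ?thesis unfolding W_def by blast
  qed
  have Wt: "W t 0" for t
    by (induction t rule: int_induct[where k = 0]) (use W0 step in blast)+
  have W: "W t u" for t u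
    by (induction u rule: int_induct[where k = 0]) (use Wt step in blast)+
  have "f (A i) = 0 \<and> f (B i) = 0 \<and> f (C i) = 0" for i
    using W[of i 0] W[of 0 i] W[of "- 2 - i" 0] by (simp add: W_def)
  then show ?thesis using f by blast
qed

section \<open>Cubics through a cyclic net\<close>

lemma lin_vanish_on_line_imp_parallel:
  assumes "\<And>x. lin l x = 0 \<Longrightarrow> lin m x = 0"
  shows "crs m l = 0"
proof -
  have "lin (crs m l) w = 0" for w
  proof -
    have "lin m (crs l w) = 0" by (rule assms) (simp add: lin_commute[of l])
    then show ?thesis by (simp add: lin_def algebra_simps)
  qed
  then show ?thesis using lin_eq_zero_iff by blast
qed

lemma form_vanish_on_lines:
  assumes "form d f" "\<And>i. i \<le> d \<Longrightarrow> l i \<noteq> 0"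
    and "\<And>i j. i \<le> d \<Longrightarrow> j \<le> d \<Longrightarrow> i \<noteq> j \<Longrightarrow> crs (l i) (l j) \<noteq> 0"
    and "\<And>i x. i \<le> d \<Longrightarrow> lin (l i) x = 0 \<Longrightarrow> f x = 0"
  shows "f x = 0"
  using assms
proof (induction d arbitrary: f x)
  case 0
  have "f 0 = 0" using "0.prems"(4)[of 0 0] by simp
  then show ?case using form_0[OF "0.prems"(1), of x] by simp
next
  case (Suc d)
  obtain g where g: "form d g" "\<forall>x. f x = lin (l (Suc d)) x * g x"
    using form_divide[OF Suc.prems(1), of "l (Suc d)"] Suc.prems(2,4) by blast
  have "g y = 0" if i: "i \<le> d" and y: "lin (l i) y = 0" for i y
  proof -
    have "lin (l (Suc d)) z * g z = 0" if "lin (l i) z = 0" for z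
      using g(2) Suc.prems(4)[of i z] i that by simp
    moreover have "\<not> (\<forall>z. lin (l i) z = 0 \<longrightarrow> lin (l (Suc d)) z = 0)"
      using lin_vanish_on_line_imp_parallel[of "l i" "l (Suc d)"] Suc.prems(3)[of "Suc d" i] i by auto
    ultimately show ?thesis using form_domain[OF form_lin g(1), of "l i" "l (Suc d)"] y by blast
  qed
  then have "g x = 0" using Suc.IH[OF g(1)] Suc.prems(2,3) by simp
  then show ?case using g(2) by simp
qed

lemma net_pencil_not_parallel:
  assumes "net Z A B C" "y - y' \<notin> Z"
  shows "crs (crs (A x) (B y)) (crs (A x) (B y')) \<noteq> 0"
proof (rule crs_nonzero_if_separated[of "B y"])
  have "y' - y \<notin> Z" using assms net_diff_commute by blast
  then show "lin (B y) (crs (A x) (B y')) \<noteq> 0"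
    using net_line_B[OF assms(1), of x y' y] by (simp add: lin_commute[of "B y"])
qed (use net_crs[OF assms(1)] in \<open>simp_all add: lin_commute[of "B y"]\<close>)

text \<open>Net lines through one point with distinct indices modulo \<open>Z\<close> are distinct,
  and a nonzero form of degree \<open>d\<close> contains at most \<open>d\<close> lines. Used to
  refute curves containing too many net lines.\<close>

lemma net_pencil_vanish:
  assumes N: "net Z A B C" and f: "form d f"
    and y: "\<And>i j. i \<le> d \<Longrightarrow> j \<le> d \<Longrightarrow> i \<noteq> j \<Longrightarrow> y i - y j \<notin> Z"
    and z: "\<And>i x. i \<le> d \<Longrightarrow> lin (crs (A a) (B (y i))) x = 0 \<Longrightarrow> f x = 0"
  shows "f x = 0"
  by (rule form_vanish_on_lines[OF f, of "\<lambda>i. crs (A a) (B (y i))"])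
    (use net_crs[OF N] net_pencil_not_parallel[OF N y] z in auto)

lemma net_collinear:
  assumes "net Z A B C" "x + y + z \<in> Z"
  shows "lin (crs (A x) (B y)) (C z) = 0" "crs (A x) (B y) \<noteq> 0" "crs (A x) (C z) \<noteq> 0" "crs (B y) (C z) \<noteq> 0"
  using net_line_C[OF assms(1)] assms(2) net_crs[OF assms(1)] net_crs[OF net_rotate[OF assms(1)]]
    net_crs[OF net_swap[OF net_rotate[OF net_rotate[OF assms(1)]]]] by auto

lemma net_conic_on_line:
  assumes N: "net Z A B C" and K: "form 2 K" and xyz: "x + y + z \<in> Z"
    and z: "K (A x) = 0" "K (B y) = 0" "K (C z) = 0" and w: "lin (crs (A x) (B y)) w = 0"
  shows "K w = 0"
  using conic_vanish_on_line[OF K, of "crs (A x) (B y)" "A x" "B y" "C z" w] net_collinear[OF N xyz] z w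
  by simp

lemma net_noline_conic:
  assumes N: "net Z A B C" and K: "form 2 K" "noline K" and xyz: "x + y + z \<in> Z"
    and z: "K (A x) = 0" "K (B y) = 0"
  shows "K (C z) \<noteq> 0"
proof
  assume "K (C z) = 0"
  then show False
    using net_conic_on_line[OF N K(1) xyz z] K(2) net_crs[OF N, of x y] by (auto simp: noline_def)
qed

text \<open>With a point of another class on it, \<open>l\<close> would be a net line, and a net
  line meets each class only once.\<close>

lemma net_line_two_points:
  assumes N: "net Z A B C" and l: "l \<noteq> 0" "lin l (A x) = 0" "lin l (A x') = 0" and x: "x - x' \<notin> Z"
  shows "lin l (B y) \<noteq> 0"
proof
  assume y: "lin l (B y) = 0"
  then obtain t where t: "l = t *s crs (A x) (B y)" using line_through[OF l(2)] net_crs[OF N] by blast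
  then have "t \<noteq> 0" using l(1) by auto
  then have "lin (crs (A x) (B y)) (A x') = 0" using l(3) t by simp
  then show False using net_line_A[OF N] x by blast
qed

lemma net_line_two_points':
  assumes N: "net Z A B C" and l: "l \<noteq> 0" "lin l (A x) = 0" "lin l (A x') = 0" and x: "x - x' \<notin> Z"
  shows "lin l (C y) \<noteq> 0"
  using net_line_two_points[OF net_swap[OF net_rotate[OF net_rotate[OF N]]] l x] .

lemma cyc_small: "n \<ge> (10::int) \<Longrightarrow> \<bar>i\<bar> < 10 \<Longrightarrow> i \<noteq> 0 \<Longrightarrow> i \<notin> cyc n"
  using not_dvd_small[of i n] by simp

lemma cyclic_net_points:
  assumes N: "net (cyc n) A B C" and n: "n \<ge> 10"
  shows "finite (A ` {0..9})" "card (A ` {0..9}) = 10"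
    "\<And>x y. x \<in> A ` {0..9} \<Longrightarrow> y \<in> A ` {0..9} \<Longrightarrow> x \<noteq> y \<Longrightarrow> crs x y \<noteq> 0"
proof -
  have c: "crs (A i) (A j) \<noteq> 0" if "i \<in> {0..9}" "j \<in> {0..9}" "i \<noteq> j" for i j
    using that by (intro net_crs_same[OF N] cyc_small[OF n]) auto
  then have "inj_on A {0..9}" by (metis crs_self inj_onI)
  then show "card (A ` {0..9}) = 10" by (simp add: card_image)
  show "\<And>x y. x \<in> A ` {0..9} \<Longrightarrow> y \<in> A ` {0..9} \<Longrightarrow> x \<noteq> y \<Longrightarrow> crs x y \<noteq> 0" using c by fast
qed simp

text \<open>Ten points of one class exceed the nine that Bezout allows, so subnets with just one
  class in common can be compared.\<close>

lemma cyclic_net_cubic_unique: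
  assumes N: "net (cyc n) A B C" and n: "n \<ge> 10"
    and F: "form 3 F" "noline F" "\<And>i. F (A i) = 0" and G: "form 3 G" "\<And>i. G (A i) = 0"
  shows "\<exists>c. \<forall>x. G x = c * F x"
  by (rule noline_cubic_unique[OF F(1,2) G(1) cyclic_net_points(1,2)[OF N n] _ _ cyclic_net_points(3)[OF N n]])
    (use F(3) G(2) in auto)

lemma cyclic_net_conic_unique:
  assumes N: "net (cyc n) A B C" and n: "n \<ge> 10"
    and F: "form 2 F" "noline F" "\<And>i. F (A i) = 0" and G: "form 2 G" "\<And>i. G (A i) = 0"
  shows "\<exists>c. \<forall>x. G x = c * F x"
  by (rule noline_conic_unique[OF F(1,2) G(1) cyclic_net_points(1)[OF N n] _ _ _ cyclic_net_points(3)[OF N n]])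
    (use F(3) G(2) cyclic_net_points(2)[OF N n] in auto)

lemma cyclic_net_conic_not_collinear:
  assumes N: "net (cyc n) A B C" and n: "n \<ge> 10"
    and K: "form 2 K" "noline K" "\<And>i. K (A i) = 0" and l: "l \<noteq> 0" "\<And>i. lin l (A i) = 0"
  shows False
proof -
  have "crs (A i) (A j) \<noteq> 0" if "i \<in> {0..9}" "j \<in> {0..9}" "i \<noteq> j" for i j
    using that by (intro net_crs_same[OF N] cyc_small[OF n]) auto
  then have "K x = 0" if "lin l x = 0" for x
    using conic_vanish_on_line[OF K(1) l(1), of "A 0" "A 1" "A 2" x] l(2) K(3) that by simp
  then show False using K(2) l(1) by (auto simp: noline_def)
qed

section \<open>Distribution of the classes on a cubic that contains a line\<close>

text \<open>Every net line through \<open>A a\<close> meets the conic in three points, hence lies on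
  it; three such lines are too many for degree 2.\<close>

lemma cyclic_net_conic_3:
  assumes N: "net (cyc n) A B C" and n: "n \<ge> 10"
    and K: "form 2 K" "K (A a) = 0" "\<And>j. K (B j) = 0" "\<And>k. K (C k) = 0"
  shows "K x = 0"
proof (rule net_pencil_vanish[OF N K(1), of "\<lambda>i. int i" a])
  show "int i - int j \<notin> cyc n" if "i \<le> 2" "j \<le> 2" "i \<noteq> j" for i j
    using that by (intro cyc_small[OF n]) auto
  show "K x = 0" if "lin (crs (A a) (B (int i))) x = 0" for i x
    using net_conic_on_line[OF N K(1), of a "int i" "- a - int i" x] K that by simp
qed

text \<open>Two points of one class on \<open>l\<close> keep the other classes off it, so these lie
  on \<open>K\<close>. A point of the first class off \<open>l\<close> would lie on \<open>K\<close>
  too, against \<open>cyclic_net_conic_3\<close>.\<close>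

lemma cyclic_net_line_component:
  assumes N: "net (cyc n) A B C" and n: "n \<ge> 10"
    and F: "\<exists>x. F x \<noteq> 0" "\<And>i. F (A i) = 0" "\<And>i. F (B i) = 0" "\<And>i. F (C i) = 0"
    and K: "form 2 K" "\<And>x. F x = lin l x * K x"
    and l: "l \<noteq> 0" "lin l (A i) = 0" "lin l (A i') = 0" "i - i' \<notin> cyc n"
  shows "(\<forall>i. lin l (A i) = 0) \<and> (\<forall>i. K (B i) = 0) \<and> (\<forall>i. K (C i) = 0)"
proof -
  have KBC: "K (B j) = 0" "K (C j) = 0" for j
    using F(3)[of j] F(4)[of j] K(2) net_line_two_points[OF N l] net_line_two_points'[OF N l] by auto
  have "lin l (A a) = 0" for a
  proof (rule ccontr)
    assume "lin l (A a) \<noteq> 0"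
    then have "K (A a) = 0" using F(2)[of a] K(2) by simp
    then have "K x = 0" for x using cyclic_net_conic_3[OF N n K(1)] KBC by blast
    then show False using F(1) K(2) by simp
  qed
  then show ?thesis using KBC by blast
qed

text \<open>Otherwise \<open>l\<close> meets each class at most once. Of ten net lines through some
  \<open>A a\<close> off \<open>l\<close>, at most two have their \<open>B\<close> or
  \<open>C\<close> point on \<open>l\<close>; three of the others lie on the conic \<open>K\<close>,
  which is too many.\<close>

lemma cyclic_net_line_points:
  assumes N: "net (cyc n) A B C" and n: "n \<ge> 10"
    and F: "\<exists>x. F x \<noteq> 0" "\<And>i. F (A i) = 0" "\<And>i. F (B i) = 0" "\<And>i. F (C i) = 0"
    and K: "form 2 K" "\<And>x. F x = lin l x * K x"
  shows "\<exists>i i'. i - i' \<notin> cyc n \<and>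
    (lin l (A i) = 0 \<and> lin l (A i') = 0 \<or> lin l (B i) = 0 \<and> lin l (B i') = 0 \<or> lin l (C i) = 0 \<and> lin l (C i') = 0)"
proof (rule ccontr)
  assume neg: "\<not> ?thesis"
  have "0 - 1 \<notin> cyc n" by (rule cyc_small[OF n]) auto
  then have "lin l (A 0) \<noteq> 0 \<or> lin l (A 1) \<noteq> 0" using neg by blast
  then obtain a where a: "lin l (A a) \<noteq> 0" by blast
  define J where "J = {j \<in> {0..9}. lin l (B j) = 0}"
  define J' where "J' = {j \<in> {0..9}. lin l (C (- a - j)) = 0}"
  have same: "i = j" if "i - j \<in> cyc n" "i \<in> {0..9}" "j \<in> {0..9}" for i j
  proof (rule ccontr)
    assume "i \<noteq> j"
    moreover have "\<bar>i - j\<bar> < 10" using that by auto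
    ultimately show False using cyc_small[OF n, of "i - j"] that(1) by simp
  qed
  have fin: "finite J" "finite J'" by (rule finite_subset[of _ "{0..9}"]; auto simp: J_def J'_def)+
  have "i = j" if "i \<in> J" "j \<in> J" for i j
    using that neg same[of i j] by (auto simp: J_def)
  then have "card J \<le> 1" using fin by (simp add: card_le_Suc0_iff_eq)
  have "i = j" if "i \<in> J'" "j \<in> J'" for i j
  proof -
    have "(- a - j) - (- a - i) \<in> cyc n" using that neg unfolding J'_def by blast
    then have "i - j \<in> cyc n" by simp
    then show ?thesis using that same[of i j] by (auto simp: J'_def)
  qed
  then have "card J' \<le> 1" using fin by (simp add: card_le_Suc0_iff_eq)
  define T where "T = {0..9} - (J \<union> J')"
  have "card (J \<union> J') \<le> 2" using card_Un_le[of J J'] \<open>card J \<le> 1\<close> \<open>card J' \<le> 1\<close> by linarith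
  then have "3 \<le> card T" using diff_card_le_card_Diff[of "J \<union> J'" "{0..9::int}"] fin by (simp add: T_def)
  then obtain y where y: "inj_on y {..<3::nat}" "y ` {..<3} \<subseteq> T"
    using obtain_distinct[of T 3] by (auto simp: T_def)
  have yT: "y i \<in> T" if "i \<le> 2" for i using y(2) that by auto
  have "K x = 0" for x
  proof (rule net_pencil_vanish[OF N K(1), of y a])
    show "y i - y j \<notin> cyc n" if "i \<le> 2" "j \<le> 2" "i \<noteq> j" for i j
      using same[of "y i" "y j"] yT[OF that(1)] yT[OF that(2)] inj_onD[OF y(1), of i j] that by (auto simp: T_def)
    show "K x = 0" if i: "i \<le> 2" and x: "lin (crs (A a) (B (y i))) x = 0" for i x
    proof -
      have "lin l (B (y i)) \<noteq> 0" "lin l (C (- a - y i)) \<noteq> 0" using yT[OF i] by (auto simp: T_def J_def J'_def)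
      then have "K (A a) = 0" "K (B (y i)) = 0" "K (C (- a - y i)) = 0"
        using F(2)[of a] F(3)[of "y i"] F(4)[of "- a - y i"] K(2) a by auto
      then show ?thesis using net_conic_on_line[OF N K(1), of a "y i" "- a - y i" x] x by simp
    qed
  qed
  then show False using F(1) K(2) by simp
qed

text \<open>A line plus an irreducible conic. The first class listed is the one on the line, so the
  three placements arise by permuting the arguments.\<close>

definition con_type :: "(complex ^ 3 \<Rightarrow> complex) \<Rightarrow> (int \<Rightarrow> complex ^ 3) \<Rightarrow> (int \<Rightarrow> complex ^ 3) \<Rightarrow> (int \<Rightarrow> complex ^ 3) \<Rightarrow> bool"
  where "con_type F A B C \<longleftrightarrow> (\<exists>l K. l \<noteq> 0 \<and> form 2 K \<and> noline K \<and> (\<forall>x. F x = lin l x * K x) \<and>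
    (\<forall>i. lin l (A i) = 0) \<and> (\<forall>i. K (B i) = 0) \<and> (\<forall>i. K (C i) = 0))"

definition lin_type :: "(complex ^ 3 \<Rightarrow> complex) \<Rightarrow> (int \<Rightarrow> complex ^ 3) \<Rightarrow> (int \<Rightarrow> complex ^ 3) \<Rightarrow> (int \<Rightarrow> complex ^ 3) \<Rightarrow> bool"
  where "lin_type F A B C \<longleftrightarrow> (\<exists>la lb lc. la \<noteq> 0 \<and> lb \<noteq> 0 \<and> lc \<noteq> 0 \<and>
    (\<forall>x. F x = lin la x * (lin lb x * lin lc x)) \<and>
    (\<forall>i. lin la (A i) = 0) \<and> (\<forall>i. lin lb (B i) = 0) \<and> (\<forall>i. lin lc (C i) = 0))"

text \<open>Two points of the second class on \<open>m\<close> keep the third class off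
  \<open>m\<close>, so it lies on \<open>m'\<close>. This in turn keeps the second class off
  \<open>m'\<close>, so it lies on \<open>m\<close>.\<close>

lemma two_lines_type:
  assumes N: "net (cyc n) A B C"
    and l: "l \<noteq> 0" "\<And>i. lin l (A i) = 0" and m: "m \<noteq> 0" "m' \<noteq> 0" "\<And>x. F x = lin l x * (lin m x * lin m' x)"
    and z: "\<And>i. lin m (B i) * lin m' (B i) = 0" "\<And>i. lin m (C i) * lin m' (C i) = 0"
    and b: "lin m (B j) = 0" "lin m (B j') = 0" "j - j' \<notin> cyc n"
  shows "lin_type F A B C"
proof -
  note N' = net_swap[OF N]
  have C: "lin m' (C k) = 0" for k
    using z(2)[of k] net_line_two_points'[OF N' m(1) b(1,2,3), of k] by simp
  have B: "lin m (B i) = 0" for i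
    using z(1)[of i] net_line_two_points[OF net_rotate[OF net_rotate[OF N]] m(2) C C b(3)]
      net_line_two_points'[OF net_rotate[OF net_rotate[OF N]] m(2) C C b(3), of i] by simp
  show ?thesis unfolding lin_type_def using l m B C by blast
qed

lemma lin_type_swap:
  assumes "lin_type F A C B"
  shows "lin_type F A B C"
proof -
  obtain la lb lc where "la \<noteq> 0" "lb \<noteq> 0" "lc \<noteq> 0" "\<forall>x. F x = lin la x * (lin lc x * lin lb x)"
    "\<forall>i. lin la (A i) = 0" "\<forall>i. lin lc (C i) = 0" "\<forall>i. lin lb (B i) = 0"
    using assms unfolding lin_type_def by blast
  then show ?thesis unfolding lin_type_def
    by (intro exI[of _ la] exI[of _ lb] exI[of _ lc]) (simp add: mult.commute)
qed

lemma lin_type_swap_left: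
  assumes "lin_type F B A C"
  shows "lin_type F A B C"
proof -
  obtain la lb lc where "la \<noteq> 0" "lb \<noteq> 0" "lc \<noteq> 0" "\<forall>x. F x = lin lb x * (lin la x * lin lc x)"
    "\<forall>i. lin la (A i) = 0" "\<forall>i. lin lc (C i) = 0" "\<forall>i. lin lb (B i) = 0"
    using assms unfolding lin_type_def by blast
  then show ?thesis unfolding lin_type_def
    by (intro exI[of _ la] exI[of _ lb] exI[of _ lc]) (simp add: mult.left_commute)
qed

lemma cyclic_net_line_type:
  assumes N: "net (cyc n) A B C" and n: "n \<ge> 10"
    and F: "\<exists>x. F x \<noteq> 0" "\<And>i. F (A i) = 0" "\<And>i. F (B i) = 0" "\<And>i. F (C i) = 0"
    and K: "form 2 K" "\<And>x. F x = lin l x * K x"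
    and l: "l \<noteq> 0" "lin l (A i) = 0" "lin l (A i') = 0" "i - i' \<notin> cyc n"
  shows "con_type F A B C \<or> lin_type F A B C"
proof (cases "noline K")
  case True
  then show ?thesis
    using cyclic_net_line_component[OF N n F K l] K l(1) unfolding con_type_def by blast
next
  case False
  have lK: "\<And>i. lin l (A i) = 0" "\<And>i. K (B i) = 0" "\<And>i. K (C i) = 0"
    using cyclic_net_line_component[OF N n F K l] by blast+
  obtain m where m: "m \<noteq> 0" "\<And>x. lin m x = 0 \<Longrightarrow> K x = 0" using False by (auto simp: noline_def)
  obtain k where k: "form 1 k" "\<forall>x. K x = lin m x * k x" using conic_divide[OF K(1) m] by blast
  obtain m' where m': "\<And>x. k x = lin m' x" using form_1[OF k(1)] by blast
  have Km: "K x = lin m x * lin m' x" for x using k(2) m' by simp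
  have "m' \<noteq> 0" using F(1) K(2) Km by auto
  have B: "lin m (B i) * lin m' (B i) = 0" "lin m' (B i) * lin m (B i) = 0" for i using lK(2)[of i] Km by auto
  have C: "lin m (C i) * lin m' (C i) = 0" "lin m' (C i) * lin m (C i) = 0" for i using lK(3)[of i] Km by auto
  have F': "F x = lin l x * (lin m x * lin m' x)" "F x = lin l x * (lin m' x * lin m x)" for x
    using K(2) Km by simp_all
  \<comment> \<open>Pigeonhole: of three \<open>B\<close> points on two lines, two share a
    line.\<close>
  have "\<exists>j j'. j - j' \<notin> cyc n \<and> (lin m (B j) = 0 \<and> lin m (B j') = 0 \<or> lin m' (B j) = 0 \<and> lin m' (B j') = 0)"
  proof -
    have "0 - 1 \<notin> cyc n" "0 - 2 \<notin> cyc n" "1 - 2 \<notin> cyc n" by (rule cyc_small[OF n]; simp)+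
    moreover have "lin m (B i) = 0 \<or> lin m' (B i) = 0" for i using B(1)[of i] by simp
    ultimately show ?thesis by meson
  qed
  then show ?thesis
    using two_lines_type[OF N l(1) lK(1) m(1) \<open>m' \<noteq> 0\<close> F'(1) B(1) C(1)]
      two_lines_type[OF N l(1) lK(1) \<open>m' \<noteq> 0\<close> m(1) F'(2) B(2) C(2)] by blast
qed

lemma cyclic_net_type:
  assumes N: "net (cyc n) A B C" and n: "n \<ge> 10"
    and F: "form 3 F" "\<exists>x. F x \<noteq> 0" "\<And>i. F (A i) = 0" "\<And>i. F (B i) = 0" "\<And>i. F (C i) = 0"
    and line: "\<not> noline F"
  shows "con_type F A B C \<or> con_type F B A C \<or> con_type F C A B \<or> lin_type F A B C"
proof -
  obtain l where l: "l \<noteq> 0" "\<And>x. lin l x = 0 \<Longrightarrow> F x = 0" using line by (auto simp: noline_def)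
  obtain K where K: "form 2 K" "\<And>x. F x = lin l x * K x" using cubic_divide[OF F(1) l] by blast
  obtain i i' where i: "i - i' \<notin> cyc n" and
    "lin l (A i) = 0 \<and> lin l (A i') = 0 \<or> lin l (B i) = 0 \<and> lin l (B i') = 0 \<or> lin l (C i) = 0 \<and> lin l (C i') = 0"
    using cyclic_net_line_points[OF N n F(2-5) K] by blast
  then consider "lin l (A i) = 0" "lin l (A i') = 0" | "lin l (B i) = 0" "lin l (B i') = 0"
    | "lin l (C i) = 0" "lin l (C i') = 0" by blast
  then show ?thesis
  proof cases
    case 1
    then show ?thesis using cyclic_net_line_type[OF N n F(2-5) K l(1) _ _ i] by blast
  next
    case 2
    then show ?thesis
      using cyclic_net_line_type[OF net_swap[OF N] n F(2) F(4) F(3) F(5) K l(1) _ _ i] lin_type_swap_left by blast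
  next
    case 3
    then show ?thesis
      using cyclic_net_line_type[OF net_rotate[OF net_rotate[OF N]] n F(2) F(5) F(3) F(4) K l(1) _ _ i]
        lin_type_swap lin_type_swap_left by blast
  qed
qed

section \<open>Classes on three lines\<close>

lemma det3_basis:
  assumes "det3 a b c \<noteq> 0"
  shows "\<exists>p q r. v = p *s a + q *s b + r *s c"
proof -
  define D where "D = det3 a b c"
  have id: "D *s v = lin (crs b c) v *s a + lin (crs c a) v *s b + lin (crs a b) v *s c"
    unfolding D_def det3_def vec3_eq_iff lin_def by (simp add: algebra_simps)
  have "v = (lin (crs b c) v / D) *s a + (lin (crs c a) v / D) *s b + (lin (crs a b) v / D) *s c"
  proof -
    have "v = (1 / D) *s (D *s v)" using assms by (simp add: D_def)
    then show ?thesis unfolding id by (simp add: vec3_eq_iff algebra_simps add_divide_distrib)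
  qed
  then show ?thesis by blast
qed

lemma det3_independent:
  assumes "det3 a b c \<noteq> 0" "p *s a + q *s b + r *s c = 0"
  shows "p = 0" "q = 0" "r = 0"
proof -
  have "lin (crs b c) (p *s a + q *s b + r *s c) = p * det3 a b c"
    "lin (crs c a) (p *s a + q *s b + r *s c) = q * det3 a b c"
    "lin (crs a b) (p *s a + q *s b + r *s c) = r * det3 a b c"
    by (simp_all add: det3_def lin_def algebra_simps)
  from this[unfolded assms(2)] show "p = 0" "q = 0" "r = 0" using assms(1) by simp_all
qed

lemma det3_forms_zero:
  assumes "det3 a b c \<noteq> 0" "lin a v = 0" "lin b v = 0" "lin c v = 0"
  shows "v = 0"
proof -
  have "lin w v = 0" for w
    using det3_basis[OF assms(1), of w] assms(2-4) by auto
  then show ?thesis using lin_eq_zero_iff[of v] lin_commute by metis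
qed

lemma vandermonde_3:
  fixes x y z a b c :: complex
  assumes "x \<noteq> y" "x \<noteq> z" "y \<noteq> z" and e: "\<And>k. k < 3 \<Longrightarrow> a * x ^ k + b * y ^ k + c * z ^ k = 0"
  shows "a = 0" "b = 0" "c = 0"
proof -
  have e0: "a + b + c = 0" and e1: "a * x + b * y + c * z = 0" and e2: "a * x\<^sup>2 + b * y\<^sup>2 + c * z\<^sup>2 = 0"
    using e[of 0] e[of 1] e[of 2] by simp_all
  \<comment> \<open>Each unknown is isolated by the quadratic polynomial whose roots are the other
    two nodes.\<close>
  have "c * ((z - x) * (z - y)) = (a * x\<^sup>2 + b * y\<^sup>2 + c * z\<^sup>2) - (x + y) * (a * x + b * y + c * z) + x * y * (a + b + c)"
    "b * ((y - x) * (y - z)) = (a * x\<^sup>2 + b * y\<^sup>2 + c * z\<^sup>2) - (x + z) * (a * x + b * y + c * z) + x * z * (a + b + c)"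
    "a * ((x - y) * (x - z)) = (a * x\<^sup>2 + b * y\<^sup>2 + c * z\<^sup>2) - (y + z) * (a * x + b * y + c * z) + y * z * (a + b + c)"
    by (simp_all add: algebra_simps power2_eq_square)
  then show "a = 0" "b = 0" "c = 0" using assms(1-3) unfolding e0 e1 e2 by simp_all
qed

lemma vandermonde_4:
  fixes x y z w a b c d :: complex
  assumes "x \<noteq> y" "x \<noteq> z" "x \<noteq> w" "y \<noteq> z" "y \<noteq> w" "z \<noteq> w"
    and e: "\<And>k. k < 4 \<Longrightarrow> a * x ^ k + b * y ^ k + c * z ^ k + d * w ^ k = 0"
  shows "a = 0" "b = 0" "c = 0" "d = 0"
proof -
  \<comment> \<open>Raising the exponent by one and subtracting \<open>w\<close> times the original
    relation removes the node \<open>w\<close>.\<close>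
  have "a * (x - w) * x ^ k + b * (y - w) * y ^ k + c * (z - w) * z ^ k = 0" if "k < 3" for k
  proof -
    have "a * (x - w) * x ^ k + b * (y - w) * y ^ k + c * (z - w) * z ^ k =
      (a * x ^ Suc k + b * y ^ Suc k + c * z ^ Suc k + d * w ^ Suc k) - w * (a * x ^ k + b * y ^ k + c * z ^ k + d * w ^ k)"
      by (simp add: algebra_simps)
    then show ?thesis using e[of k] e[of "Suc k"] that by simp
  qed
  from vandermonde_3[OF assms(1,2,4) this] show abc: "a = 0" "b = 0" "c = 0" using assms(3,5,6) by simp_all
  then show "d = 0" using e[of 0] by simp
qed

text \<open>The characters with values 1, \<open>z\<close>, \<open>w\<close>, \<open>z * w\<close>
  are independent unless two coincide. As \<open>z\<close> and \<open>w\<close> differ from 1, only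
  \<open>z = w\<close> or \<open>z * w = 1\<close> can occur; then the conditions on the squares
  keep the three remaining nodes distinct.\<close>

lemma character_relation:
  fixes z w :: complex
  assumes z: "z \<noteq> 0" "z\<^sup>2 \<noteq> 1" and w: "w \<noteq> 0" "w\<^sup>2 \<noteq> 1"
    and e: "\<And>k. k < 4 \<Longrightarrow> c0 + c1 * z ^ k + c2 * w ^ k + c3 * (z * w) ^ k = 0"
  shows "z = w \<and> c0 = 0 \<and> c3 = 0 \<or> z * w = 1 \<and> c1 = 0 \<and> c2 = 0 \<or> c0 = 0 \<and> c1 = 0 \<and> c2 = 0 \<and> c3 = 0"
proof -
  have n1: "z \<noteq> 1" "w \<noteq> 1" using z w by auto
  consider "z = w" | "z * w = 1" | "z \<noteq> w" "z * w \<noteq> 1" by blast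
  then show ?thesis
  proof cases
    case 1
    have r: "c0 * 1 ^ k + (c1 + c2) * z ^ k + c3 * (z\<^sup>2) ^ k = 0" if "k < 3" for k
      using e[of k] that 1 by (simp add: algebra_simps power2_eq_square)
    have "1 \<noteq> z" "1 \<noteq> z\<^sup>2" "z \<noteq> z\<^sup>2" using n1 z by (auto simp: power2_eq_square)
    from vandermonde_3[OF this r] 1 show ?thesis by blast
  next
    case 2
    have r: "(c0 + c3) * 1 ^ k + c1 * z ^ k + c2 * w ^ k = 0" if "k < 3" for k
      using e[of k] that unfolding 2 by (simp add: algebra_simps)
    have "z \<noteq> w" using 2 z(2) by (auto simp: power2_eq_square)
    then have "1 \<noteq> z" "1 \<noteq> w" "z \<noteq> w" using n1 by auto
    from vandermonde_3[OF this r] 2 show ?thesis by blast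
  next
    case 3
    have r: "c0 * 1 ^ k + c1 * z ^ k + c2 * w ^ k + c3 * (z * w) ^ k = 0" if "k < 4" for k
      using e[of k] that by simp
    have "1 \<noteq> z" "1 \<noteq> w" "1 \<noteq> z * w" "z \<noteq> w" "z \<noteq> z * w" "w \<noteq> z * w" using n1 z w 3 by auto
    from vandermonde_4[OF this r] show ?thesis by blast
  qed
qed

lemma geometric:
  fixes g :: "int \<Rightarrow> complex"
  assumes "\<And>i. g (i + 1) = z * g i"
  shows "g (int k) = g 0 * z ^ k"
proof (induction k)
  case (Suc k)
  have "g (int (Suc k)) = z * g (int k)" using assms[of "int k"] by (simp add: add.commute)
  then show ?case using Suc by simp
qed simp

text \<open>Two projective coordinates on a line in which the same points form geometric progressions
  agree up to a factor or up to inversion.\<close>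

lemma geometric_coordinates:
  assumes ind: "det3 X Y W \<noteq> 0" and P: "\<And>i. lin W (P i) = 0"
    and nz: "\<And>i. lin X (P i) \<noteq> 0" "\<And>i. lin Y (P i) \<noteq> 0" "\<And>i. lin X' (P i) \<noteq> 0" "\<And>i. lin Y' (P i) \<noteq> 0"
    and z: "z \<noteq> 0" "z\<^sup>2 \<noteq> 1" and w: "w \<noteq> 0" "w\<^sup>2 \<noteq> 1"
    and g: "\<And>i::int. lin Y (P (i + 1)) / lin X (P (i + 1)) = z * (lin Y (P i) / lin X (P i))"
    and g': "\<And>i. lin Y' (P (i + 1)) / lin X' (P (i + 1)) = w * (lin Y' (P i) / lin X' (P i))"
  shows "z = w \<and> (\<exists>p e. X' = p *s X + e *s W) \<and> (\<exists>s e. Y' = s *s Y + e *s W) \<or>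
    z * w = 1 \<and> (\<exists>q e. X' = q *s Y + e *s W) \<and> (\<exists>r e. Y' = r *s X + e *s W)"
proof -
  obtain p q e where X': "X' = p *s X + q *s Y + e *s W" using det3_basis[OF ind] by blast
  obtain r s e' where Y': "Y' = r *s X + s *s Y + e' *s W" using det3_basis[OF ind] by blast
  define \<gamma> where "\<gamma> = lin Y (P 0) / lin X (P 0)"
  define \<gamma>' where "\<gamma>' = lin Y' (P 0) / lin X' (P 0)"
  have nz\<gamma>: "\<gamma> \<noteq> 0" "\<gamma>' \<noteq> 0" using nz by (simp_all add: \<gamma>_def \<gamma>'_def)
  \<comment> \<open>On the line \<open>W\<close>, \<open>Y' / X'\<close> is a fractional linear
    function of \<open>Y / X\<close>. Clearing the denominator along both progressions gives a
    relation between four characters.\<close>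
  have rel: "r + (s * \<gamma>) * z ^ k + (- p * \<gamma>') * w ^ k + (- q * \<gamma> * \<gamma>') * (z * w) ^ k = 0" for k
  proof -
    define x y where "x = lin X (P (int k))" and "y = lin Y (P (int k))"
    have xy: "x \<noteq> 0" "y \<noteq> 0" using nz by (simp_all add: x_def y_def)
    have G: "y / x = \<gamma> * z ^ k"
      using geometric[of "\<lambda>i. lin Y (P i) / lin X (P i)" z k] g by (simp add: \<gamma>_def x_def y_def)
    have "lin Y' (P (int k)) / lin X' (P (int k)) = \<gamma>' * w ^ k"
      using geometric[of "\<lambda>i. lin Y' (P i) / lin X' (P i)" w k] g' by (simp add: \<gamma>'_def)
    then have "lin Y' (P (int k)) = \<gamma>' * w ^ k * lin X' (P (int k))" using nz(3) by (simp add: divide_eq_eq)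
    then have "r * x + s * y = \<gamma>' * w ^ k * (p * x + q * y)" using P by (simp add: X' Y' x_def y_def)
    then have "(r * x + s * y) / x = \<gamma>' * w ^ k * ((p * x + q * y) / x)" by simp
    then have "r + s * (y / x) = \<gamma>' * w ^ k * (p + q * (y / x))" using xy by (simp add: add_divide_distrib)
    then show ?thesis unfolding G by (simp add: algebra_simps power_mult_distrib)
  qed
  \<comment> \<open>The all-zero relation enters as \<open>p = 0\<close>, \<open>q = 0\<close>; it
    would make \<open>X'\<close> a multiple of \<open>W\<close>, which vanishes at the
    points.\<close>
  have "z = w \<and> r = 0 \<and> q = 0 \<or> z * w = 1 \<and> s = 0 \<and> p = 0 \<or> p = 0 \<and> q = 0"
    using character_relation[OF z w rel] nz\<gamma> by auto
  then consider "z = w" "r = 0" "q = 0" | "z * w = 1" "s = 0" "p = 0" | "p = 0" "q = 0" by blast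
  then show ?thesis
  proof cases
    case 1
    then show ?thesis using X' Y' by auto
  next
    case 2
    then show ?thesis using X' Y' by auto
  next
    case 3
    then have "lin X' (P 0) = 0" using X' P by simp
    then show ?thesis using nz(3) by simp
  qed
qed

section \<open>Cyclic nets on the sides of a triangle\<close>

locale triangle_net =
  fixes n A B C la lb lc
  assumes N: "net (cyc n) A B C" and n: "n \<ge> 10"
    and nz: "la \<noteq> 0" "lb \<noteq> 0" "lc \<noteq> 0"
    and on: "\<And>i. lin la (A i) = 0" "\<And>i. lin lb (B i) = 0" "\<And>i. lin lc (C i) = 0"
begin

lemma off:
  "lin la (B i) \<noteq> 0" "lin la (C i) \<noteq> 0" "lin lb (A i) \<noteq> 0" "lin lb (C i) \<noteq> 0" "lin lc (A i) \<noteq> 0" "lin lc (B i) \<noteq> 0"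
proof -
  have c: "0 - 1 \<notin> cyc n" by (rule cyc_small[OF n]) auto
  show "lin la (B i) \<noteq> 0" "lin la (C i) \<noteq> 0"
    using net_line_two_points[OF N nz(1) on(1,1) c] net_line_two_points'[OF N nz(1) on(1,1) c] by blast+
  show "lin lb (C i) \<noteq> 0" "lin lb (A i) \<noteq> 0"
    using net_line_two_points[OF net_rotate[OF N] nz(2) on(2,2) c]
      net_line_two_points'[OF net_rotate[OF N] nz(2) on(2,2) c] by blast+
  show "lin lc (A i) \<noteq> 0" "lin lc (B i) \<noteq> 0"
    using net_line_two_points[OF net_rotate[OF net_rotate[OF N]] nz(3) on(3,3) c]
      net_line_two_points'[OF net_rotate[OF net_rotate[OF N]] nz(3) on(3,3) c] by blast+
qed

lemma combination:
  assumes "i + j + k \<in> cyc n"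
  shows "\<exists>u v. C k = u *s A i + v *s B j"
  using det3_eq_0_imp_combination[of "A i" "B j" "C k"] net_det3[OF N, of i j k] assms net_crs[OF N] by simp

text \<open>Apply the three forms to \<open>C k\<close> written as a combination of
  \<open>A i\<close> and \<open>B j\<close>: each form kills its own class, and the two coefficients
  cancel in the product.\<close>

lemma menelaus:
  assumes "i + j + k \<in> cyc n"
  shows "(lin lc (A i) / lin lb (A i)) * (lin la (B j) / lin lc (B j)) * (lin lb (C k) / lin la (C k)) = - 1"
proof -
  obtain u v where C: "C k = u *s A i + v *s B j" using combination[OF assms] by blast
  have a: "lin la (C k) = v * lin la (B j)" and b: "lin lb (C k) = u * lin lb (A i)"
    and c: "u * lin lc (A i) + v * lin lc (B j) = 0"
    using on(3)[of k] by (simp_all add: C on)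
  have "v \<noteq> 0" using a off(2)[of k] by auto
  have "u * lin lc (A i) = - v * lin lc (B j)" using c by (simp add: eq_neg_iff_add_eq_0)
  then show ?thesis unfolding a b using off \<open>v \<noteq> 0\<close> by (simp add: field_simps)
qed

text \<open>By Menelaus the product is unchanged when one index rises and another falls by one, so
  consecutive ratios have the same constant quotient in all three classes.\<close>

lemma ratio:
  "\<exists>z. z \<noteq> 0 \<and> (\<forall>i. lin lc (A (i + 1)) / lin lb (A (i + 1)) = z * (lin lc (A i) / lin lb (A i)))
     \<and> (\<forall>i. lin la (B (i + 1)) / lin lc (B (i + 1)) = z * (lin la (B i) / lin lc (B i)))
     \<and> (\<forall>i. lin lb (C (i + 1)) / lin la (C (i + 1)) = z * (lin lb (C i) / lin la (C i)))"
proof -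
  define \<alpha> where "\<alpha> = (\<lambda>i. lin lc (A i) / lin lb (A i))"
  define \<beta> where "\<beta> = (\<lambda>i. lin la (B i) / lin lc (B i))"
  define \<gamma> where "\<gamma> = (\<lambda>i. lin lb (C i) / lin la (C i))"
  have nz': "\<alpha> i \<noteq> 0" "\<beta> i \<noteq> 0" "\<gamma> i \<noteq> 0" for i using off by (simp_all add: \<alpha>_def \<beta>_def \<gamma>_def)
  have m: "\<alpha> i * \<beta> j * \<gamma> k = - 1" if "i + j + k = 0" for i j k
    using menelaus[of i j k] that by (simp add: \<alpha>_def \<beta>_def \<gamma>_def)
  have ab: "\<alpha> (i + 1) * \<beta> j = \<alpha> i * \<beta> (j + 1)" for i j
  proof -
    have "\<alpha> (i + 1) * \<beta> j * \<gamma> (- i - j - 1) = \<alpha> i * \<beta> (j + 1) * \<gamma> (- i - j - 1)"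
      using m[of "i + 1" j "- i - j - 1"] m[of i "j + 1" "- i - j - 1"] by simp
    then show ?thesis using nz' by simp
  qed
  have ac: "\<alpha> (i + 1) * \<gamma> k = \<alpha> i * \<gamma> (k + 1)" for i k
  proof -
    have "\<beta> (- i - k - 1) * (\<alpha> (i + 1) * \<gamma> k) = \<beta> (- i - k - 1) * (\<alpha> i * \<gamma> (k + 1))"
      using m[of "i + 1" "- i - k - 1" k] m[of i "- i - k - 1" "k + 1"] by (simp add: ac_simps)
    then show ?thesis using nz' by simp
  qed
  define z where "z = \<alpha> 1 / \<alpha> 0"
  have b: "\<beta> (j + 1) = z * \<beta> j" for j using ab[of 0 j] nz' by (simp add: z_def field_simps)
  have c: "\<gamma> (j + 1) = z * \<gamma> j" for j using ac[of 0 j] nz' by (simp add: z_def field_simps)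
  have a: "\<alpha> (i + 1) = z * \<alpha> i" for i using ab[of i 0] b[of 0] nz' by (simp add: field_simps)
  have "z \<noteq> 0" using nz' by (simp add: z_def)
  then show ?thesis using a b c unfolding \<alpha>_def \<beta>_def \<gamma>_def by blast
qed

text \<open>If the three lines were concurrent, the points of each class would form an arithmetic
  progression, which cannot be periodic in characteristic zero.\<close>

lemma not_concurrent: "det3 la lb lc \<noteq> 0"
proof
  assume det: "det3 la lb lc = 0"
  have "crs la lb \<noteq> 0"
    by (rule crs_nonzero_if_separated[of "A 0"]) (use on off nz in \<open>simp_all add: lin_commute[of "A 0"]\<close>)
  then obtain u v where lc: "lc = u *s la + v *s lb" using det3_eq_0_imp_combination[OF det] by blast
  have uv: "u \<noteq> 0" "v \<noteq> 0" using off(5)[of 0] off(6)[of 0] on by (auto simp: lc)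
  \<comment> \<open>For an arbitrary form \<open>d\<close>, the quotients \<open>\<tau>\<close>
    along the \<open>A\<close> points are arithmetic with difference \<open>\<delta>\<close>. Period
    \<open>n\<close> forces \<open>\<delta> = 0\<close>, so every \<open>d\<close> agrees on the
    rescaled \<open>A 0\<close> and \<open>A 1\<close>.\<close>
  have "lin d ((1 / lin lb (A 1)) *s A 1 - (1 / lin lb (A 0)) *s A 0) = 0" for d
  proof -
    define \<tau> where "\<tau> = (\<lambda>i. lin d (A i) / lin lb (A i))"
    define \<beta> where "\<beta> = (\<lambda>i. lin d (B i) / lin la (B i))"
    define \<gamma> where "\<gamma> = (\<lambda>i. lin d (C i) / lin la (C i))"
    \<comment> \<open>Concurrency expresses \<open>lc\<close> through \<open>la\<close> and
      \<open>lb\<close>, which makes the collinearity relation additive instead of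
      multiplicative.\<close>
    have rel: "\<gamma> k = \<beta> j - (u / v) * \<tau> i" if ijk: "i + j + k \<in> cyc n" for i j k
    proof -
      obtain p q where C: "C k = p *s A i + q *s B j" using combination[OF ijk] by blast
      have a: "lin la (C k) = q * lin la (B j)" using on by (simp add: C)
      have "p * (v * lin lb (A i)) + q * (u * lin la (B j)) = 0"
        using on(3)[of k] on by (simp add: C lc)
      then have p: "p = - (q * u * lin la (B j)) / (v * lin lb (A i))"
        using uv off by (simp add: field_simps eq_neg_iff_add_eq_0)
      have "q \<noteq> 0" using a off(2)[of k] by auto
      have "\<gamma> k = (p * lin d (A i) + q * lin d (B j)) / (q * lin la (B j))"
        by (simp add: \<gamma>_def a) (simp add: C)
      then have "\<gamma> k = p * lin d (A i) / (q * lin la (B j)) + \<beta> j"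
        using \<open>q \<noteq> 0\<close> by (simp add: \<beta>_def add_divide_distrib)
      moreover have "p * lin d (A i) / (q * lin la (B j)) = - (u / v) * \<tau> i"
        unfolding p \<tau>_def using uv off(1)[of j] off(3)[of i] \<open>q \<noteq> 0\<close> by (simp add: field_simps)
      ultimately show ?thesis by simp
    qed
    have step: "(u / v) * (\<tau> (i + 1) - \<tau> i) = \<beta> (- 1) - \<beta> 0" for i
      using rel[of "i + 1" "- 1" "- i"] rel[of i 0 "- i"] by (simp add: algebra_simps)
    define \<delta> where "\<delta> = (v / u) * (\<beta> (- 1) - \<beta> 0)"
    have step': "\<tau> (i + 1) = \<tau> i + \<delta>" for i
      using step[of i] uv by (simp add: \<delta>_def field_simps)
    have "\<tau> (int k) = \<tau> 0 + of_nat k * \<delta>" for k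
    proof (induction k)
      case (Suc k)
      then show ?case using step'[of "int k"] by (simp add: algebra_simps)
    qed simp
    from this[of "nat n"] have "\<tau> n = \<tau> 0 + of_nat (nat n) * \<delta>" using n by simp
    moreover have "\<tau> n = \<tau> 0" using rel[of n 0 0] rel[of 0 0 0] uv by simp
    ultimately have "\<delta> = 0" using n by simp
    then have "\<tau> 1 = \<tau> 0" using step'[of 0] by simp
    then show ?thesis by (simp add: \<tau>_def)
  qed
  then have "(1 / lin lb (A 1)) *s A 1 = (1 / lin lb (A 0)) *s A 0"
    using lin_eq_zero_iff lin_commute by (metis eq_iff_diff_eq_0)
  then have "crs ((1 / lin lb (A 1)) *s A 1) ((1 / lin lb (A 0)) *s A 0) = 0" by simp
  then have "crs (A 1) (A 0) = 0" using off(3) by simp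
  then show False using net_crs_same[OF N, of 1 0] cyc_small[OF n, of "1 - 0"] by simp
qed

text \<open>The ratio of \<open>lc\<close> to \<open>lb\<close> determines a point of the line
  \<open>la\<close>, so an involutive \<open>z\<close> would identify \<open>A 0\<close> with
  \<open>A 2\<close>.\<close>

lemma ratio_not_involutive:
  assumes "\<And>i. lin lc (A (i + 1)) / lin lb (A (i + 1)) = z * (lin lc (A i) / lin lb (A i))"
  shows "z\<^sup>2 \<noteq> 1"
proof
  assume z: "z\<^sup>2 = 1"
  have "lin lc (A 2) / lin lb (A 2) = z * (z * (lin lc (A 0) / lin lb (A 0)))"
    using assms[of 0] assms[of 1] by simp
  also have "\<dots> = z\<^sup>2 * (lin lc (A 0) / lin lb (A 0))" by (simp add: power2_eq_square)
  finally have e: "lin lc (A 2) * lin lb (A 0) = lin lc (A 0) * lin lb (A 2)"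
    using off(3) z by (simp add: field_simps)
  have "lin lb (A 0) *s A 2 - lin lb (A 2) *s A 0 = 0"
    by (rule det3_forms_zero[OF not_concurrent]) (use on e in \<open>simp_all add: algebra_simps\<close>)
  then have "lin lb (A 0) *s A 2 = lin lb (A 2) *s A 0" by simp
  then have "crs (lin lb (A 0) *s A 2) (lin lb (A 2) *s A 0) = 0" by simp
  then have "crs (A 2) (A 0) = 0" using off(3) by simp
  then show False using net_crs_same[OF N, of 2 0] cyc_small[OF n, of "2 - 0"] by simp
qed

end

text \<open>Any two of the triangles share a class: \<open>C\<close>, \<open>B\<close> or
  \<open>A'\<close>. On it \<open>geometric_coordinates\<close> compares the other two sides, up to
  an inversion. Without inversion along \<open>C\<close> and \<open>B\<close>, \<open>la'\<close>
  lies in the span of \<open>la\<close>, \<open>lc\<close> and in that of \<open>la\<close>,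
  \<open>lb\<close>, hence is a multiple of \<open>la\<close>. Each inverted case puts a point of
  one class on the line of another.\<close>

lemma triangle_nets_same_line:
  assumes T: "triangle_net n A B C la lb lc" and T': "triangle_net n A' B' C la' lb' lc"
    and T'': "triangle_net n A' B C' la' lb lc'"
  shows "\<exists>p. la' = p *s la"
proof -
  interpret T: triangle_net n A B C la lb lc by fact
  interpret T': triangle_net n A' B' C la' lb' lc by fact
  interpret T'': triangle_net n A' B C' la' lb lc' by fact
  obtain z where z: "z \<noteq> 0" "\<And>i. lin lc (A (i + 1)) / lin lb (A (i + 1)) = z * (lin lc (A i) / lin lb (A i))"
     "\<And>i. lin la (B (i + 1)) / lin lc (B (i + 1)) = z * (lin la (B i) / lin lc (B i))"
     "\<And>i. lin lb (C (i + 1)) / lin la (C (i + 1)) = z * (lin lb (C i) / lin la (C i))" using T.ratio by blast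
  obtain z' where z': "z' \<noteq> 0" "\<And>i. lin lc (A' (i + 1)) / lin lb' (A' (i + 1)) = z' * (lin lc (A' i) / lin lb' (A' i))"
     "\<And>i. lin lb' (C (i + 1)) / lin la' (C (i + 1)) = z' * (lin lb' (C i) / lin la' (C i))" using T'.ratio by blast
  obtain z'' where z'': "z'' \<noteq> 0" "\<And>i. lin lc' (A' (i + 1)) / lin lb (A' (i + 1)) = z'' * (lin lc' (A' i) / lin lb (A' i))"
     "\<And>i. lin la' (B (i + 1)) / lin lc' (B (i + 1)) = z'' * (lin la' (B i) / lin lc' (B i))" using T''.ratio by blast
  note sq = T.ratio_not_involutive[OF z(2)] T'.ratio_not_involutive[OF z'(2)] T''.ratio_not_involutive[OF z''(2)]
  note ind = T.not_concurrent
  have C: "z = z' \<and> (\<exists>p e. la' = p *s la + e *s lc) \<or> z * z' = 1 \<and> (\<exists>q e. la' = q *s lb + e *s lc)"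
    using geometric_coordinates[of la lb lc C la' lb' z z', OF ind T.on(3) T.off(2,4) T'.off(2,4) z(1) sq(1) z'(1) sq(2) z(4) z'(3)]
    by blast
  have ind': "det3 lc la lb \<noteq> 0" using ind det3_rotate[of lc la lb] det3_rotate[of la lb lc] by simp
  have B: "z = z'' \<and> (\<exists>p e. la' = p *s la + e *s lb) \<or> z * z'' = 1 \<and> (\<exists>q e. la' = q *s lc + e *s lb)"
    using geometric_coordinates[of lc la lb B lc' la' z z'', OF ind' T.on(2) T.off(6,1) T''.off(6,1) z(1) sq(1) z''(1) sq(3) z(3) z''(3)]
    by blast
  have ind'': "det3 lb' lc la' \<noteq> 0" using T'.not_concurrent det3_rotate[of lb' lc la'] by simp
  have A: "z' = z'' \<and> (\<exists>p e. lb = p *s lb' + e *s la') \<or> z' * z'' = 1"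
    using geometric_coordinates[of lb' lc la' A' lb lc' z' z'', OF ind'' T'.on(1) T'.off(3,5) T''.off(3,5) z'(1) sq(2) z''(1) sq(3) z'(2) z''(2)]
    by blast
  show ?thesis
  proof (cases "\<exists>p e. la' = p *s la + e *s lc")
    case True
    then obtain p e where pe: "la' = p *s la + e *s lc" by blast
    from B show ?thesis
    proof (elim disjE conjE exE)
      fix p' e' assume "la' = p' *s la + e' *s lb"
      then have "(p - p') *s la + (- e') *s lb + e *s lc = 0" using pe by (simp add: vec3_eq_iff algebra_simps)
      then have "e = 0" using det3_independent[OF ind] by blast
      then show ?thesis using pe by auto
    next
      fix q e' assume "la' = q *s lc + e' *s lb"
      then have "p *s la + (- e') *s lb + (e - q) *s lc = 0" using pe by (simp add: vec3_eq_iff algebra_simps)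
      then have "p = 0" using det3_independent[OF ind] by blast
      then have "lin la' (C 0) = 0" using pe T.on by simp
      then show ?thesis using T'.off(2) by blast
    qed
  next
    case False
    then obtain q e where qe: "z * z' = 1" "la' = q *s lb + e *s lc" using C by blast
    from B show ?thesis
    proof (elim disjE conjE exE)
      fix p' e' assume "la' = p' *s la + e' *s lb"
      then have "p' *s la + (e' - q) *s lb + (- e) *s lc = 0" using qe by (simp add: vec3_eq_iff algebra_simps)
      then have "- e = 0" using det3_independent(3)[OF ind] by blast
      then have "e = 0" by simp
      then have "lin la' (B 0) = 0" using qe T.on by simp
      then show ?thesis using T''.off(1) by blast
    next
      assume "z * z'' = 1"
      \<comment> \<open>Two inversions compose to none: along \<open>A'\<close> the ratios agree,
        and \<open>z'\<close> is not its own inverse.\<close>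
      then have "z' = z''" using qe(1) z(1) by (metis mult_left_cancel)
      then have "z' * z'' \<noteq> 1" using sq(2) by (simp add: power2_eq_square)
      then obtain p e' where pe: "lb = p *s lb' + e' *s la'" using A by blast
      have "la' = q *s (p *s lb' + e' *s la') + e *s lc" using qe(2) unfolding pe[symmetric] .
      then have "(q * p) *s lb' + e *s lc + (q * e' - 1) *s la' = 0" by (simp add: vec3_eq_iff algebra_simps)
      then have "q * p = 0" "q * e' - 1 = 0" using det3_independent[OF ind''] by blast+
      then have "p = 0" by auto
      then have "lin lb (A' 0) = 0" using pe T'.on by simp
      then show ?thesis using T''.off(3) by blast
    qed
  qed
qed

section \<open>Passing to a coset\<close>

definition net_cubic :: "(complex ^ 3 \<Rightarrow> complex) \<Rightarrow> (int \<Rightarrow> complex ^ 3) \<Rightarrow> (int \<Rightarrow> complex ^ 3) \<Rightarrow> (int \<Rightarrow> complex ^ 3) \<Rightarrow> bool"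
  where "net_cubic F A B C \<longleftrightarrow> form 3 F \<and> (\<exists>x. F x \<noteq> 0) \<and> (\<forall>i. F (A i) = 0 \<and> F (B i) = 0 \<and> F (C i) = 0)"

lemma net_cubicD:
  assumes "net_cubic F A B C"
  shows "form 3 F" "\<exists>x. F x \<noteq> 0" "F (A i) = 0" "F (B i) = 0" "F (C i) = 0"
  using assms by (auto simp: net_cubic_def)

lemma net_cubic_type:
  assumes "net (cyc n) A B C" "n \<ge> 10" "net_cubic F A B C" "\<not> noline F"
  shows "con_type F A B C \<or> con_type F B A C \<or> con_type F C A B \<or> lin_type F A B C"
  using cyclic_net_type[OF assms(1,2) net_cubicD[OF assms(3)] assms(4)] .

text \<open>Index \<open>(i, s)\<close> stands for the \<open>i\<close>-th power of \<open>g\<close>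
  times the \<open>s\<close>-th power of a coset representative. Only the indices
  \<open>(i, 1)\<close> are excluded from \<open>Z\<close>; some \<open>(i, 2)\<close> may belong to
  it.\<close>

locale coset_net =
  fixes n :: int and Z :: "(int \<times> int) set" and A B C :: "int \<times> int \<Rightarrow> complex ^ 3"
  assumes N: "net Z A B C" and n: "n \<ge> 10"
    and Z0: "\<And>i. (i, 0) \<in> Z \<longleftrightarrow> n dvd i" and Z1: "\<And>i. (i, 1) \<notin> Z"
begin

lemma Zm1: "(i, - 1) \<notin> Z"
  using net_minus[OF N, of "(i, - 1)"] Z1 by simp

lemma Z_small: "\<bar>i\<bar> < 10 \<Longrightarrow> i \<noteq> 0 \<Longrightarrow> (i, 0) \<notin> Z"
  using cyc_small[OF n, of i] Z0 by simp

lemma slice: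
  assumes "s + t + u = 0"
  shows "net (cyc n) (\<lambda>i. A (i, s)) (\<lambda>i. B (i, t)) (\<lambda>i. C (i, u))"
proof -
  have "det3 (A (x, s)) (B (y, t)) (C (z, u)) = 0 \<longleftrightarrow> n dvd x + y + z" for x y z
    using net_det3[OF N, of "(x, s)" "(y, t)" "(z, u)"] Z0 assms by simp
  moreover have "1 \<notin> cyc n" by (rule cyc_small[OF n]) auto
  then have "cyc n \<noteq> UNIV" by blast
  ultimately show ?thesis by (simp add: net_def)
qed

lemma coset_swap: "coset_net n Z B A C"
  using net_swap[OF N] n Z0 Z1 by unfold_locales

lemma coset_rotate: "coset_net n Z B C A"
  using net_rotate[OF N] n Z0 Z1 by unfold_locales

lemma coset_translate:
  "coset_net n Z (\<lambda>x. A ((0, 1) + x)) (\<lambda>x. B ((0, - 1) + x)) (\<lambda>x. C ((0, 0) + x))"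
  using net_translate[OF N, of "(0, 1)" "(0, - 1)" "(0, 0)"] n Z0 Z1 by unfold_locales (simp_all add: zero_prod_def)

text \<open>Apply Pascal's theorem to a grid with six points on the conic: the other three points
  are collinear, for two different choices of indices that cannot both satisfy the net relation.\<close>

lemma no_conic_through_shifted_class:
  assumes e: "e = 1 \<or> e = - 1" and K: "form 2 K" "noline K"
    and z: "\<And>i. K (A (i, e)) = 0" "\<And>i. K (B (i, 0)) = 0" "\<And>i. K (C (i, 0)) = 0"
  shows False
proof -
  have Ze: "(i, e) \<notin> Z" for i using e Z1 Zm1 by auto
  have claim: "(2 * w + 1, - 2 * e) \<in> Z" for w
  proof -
    \<comment> \<open>The six grid points on \<open>K\<close> are \<open>A\<close> at
      \<open>(- w, e)\<close>, \<open>(- 1 - w, e)\<close>, \<open>B\<close> at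
      \<open>(0, 0)\<close>, \<open>(1, 0)\<close> and \<open>C\<close> at \<open>(- 1, 0)\<close>,
      \<open>(0, 0)\<close>. With \<open>l\<close> through two of the other three, the cubic
      \<open>l\<close> times \<open>K\<close> contains eight grid points, hence the ninth.\<close>
    define l where "l = crs (A (0, 0)) (C (w, - e))"
    have f: "form 3 (\<lambda>x. lin l x * K x)" by (rule form_lin_conic[OF K(1)])
    have "lin l (B (1 + w, - e)) * K (B (1 + w, - e)) = 0"
    proof (rule net_cayley_bacharach[OF N f, of "(- w, e)" "(- 1 - w, e)" "(0, 0)"])
      show "(- w, e) - (- 1 - w, e) \<notin> Z" using Z_small[of 1] by simp
      show "(- w, e) - (0, 0) \<notin> Z" "(- 1 - w, e) - (0, 0) \<notin> Z" using Ze by simp_all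
    qed (use z z(2,3)[of 0, folded zero_prod_def] in \<open>simp_all add: l_def\<close>)
    moreover have "K (B (1 + w, - e)) \<noteq> 0"
      by (rule net_noline_conic[OF net_rotate[OF net_rotate[OF N]] K, of "(- 1, 0)" "(- w, e)"])
        (use z Z0[of 0] in simp_all)
    ultimately have "lin l (B (1 + w, - e)) = 0" by simp
    then show ?thesis
      using net_line_C[OF net_swap[OF net_rotate[OF net_rotate[OF N]]], of "(0, 0)" "(w, - e)" "(1 + w, - e)"]
      by (simp add: l_def)
  qed
  \<comment> \<open>The claims for \<open>w = 1\<close> and \<open>w = 0\<close> differ by
    \<open>(2, 0)\<close>. One claim alone is no contradiction, as \<open>(1, - 2 * e)\<close> may
    lie in \<open>Z\<close>.\<close>
  have "(2 * 1 + 1, - 2 * e) - (2 * 0 + 1, - 2 * e) \<in> Z" by (rule net_diff[OF N claim claim])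
  then show False using Z_small[of 2] by simp
qed

text \<open>The \<open>C\<close> points lie on \<open>K\<close>, so they are not collinear and the
  neighbouring cubic has them on its own conic. Ten common points identify that conic with
  \<open>K\<close>, and one shifted class comes along.\<close>

lemma conic_neighbour:
  assumes K: "form 2 K" "noline K" "\<And>i. K (C (i, 0)) = 0"
    and F': "net_cubic F' (\<lambda>i. A (i, 1)) (\<lambda>i. B (i, - 1)) (\<lambda>i. C (i, 0))" "\<not> noline F'"
  shows "(\<forall>i. K (B (i, - 1)) = 0) \<or> (\<forall>i. K (A (i, 1)) = 0)"
proof -
  have S: "net (cyc n) (\<lambda>i. A (i, 1)) (\<lambda>i. B (i, - 1)) (\<lambda>i. C (i, 0))" by (rule slice) simp
  note SC = net_rotate[OF net_rotate[OF S]]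
  have nc: False if "l \<noteq> 0" "\<And>i. lin l (C (i, 0)) = 0" for l
    using cyclic_net_conic_not_collinear[OF SC n K that] .
  have same: "K x = 0" if "form 2 K'" "noline K'" "\<And>i. K' (C (i, 0)) = 0" "K' x = 0" for K' x
    using cyclic_net_conic_unique[OF SC n that(1-3) K(1,3)] that(4) by auto
  from net_cubic_type[OF S n F'] show ?thesis
  proof (elim disjE)
    assume "con_type F' (\<lambda>i. A (i, 1)) (\<lambda>i. B (i, - 1)) (\<lambda>i. C (i, 0))"
    then show ?thesis unfolding con_type_def using same by blast
  next
    assume "con_type F' (\<lambda>i. B (i, - 1)) (\<lambda>i. A (i, 1)) (\<lambda>i. C (i, 0))"
    then show ?thesis unfolding con_type_def using same by blast
  next
    assume "con_type F' (\<lambda>i. C (i, 0)) (\<lambda>i. A (i, 1)) (\<lambda>i. B (i, - 1))"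
    then show ?thesis unfolding con_type_def using nc by blast
  next
    assume "lin_type F' (\<lambda>i. A (i, 1)) (\<lambda>i. B (i, - 1)) (\<lambda>i. C (i, 0))"
    then show ?thesis unfolding lin_type_def using nc by blast
  qed
qed

text \<open>Of the two options in \<open>conic_neighbour\<close>, a shifted \<open>B\<close> class
  on the conic through \<open>A\<close> and \<open>C\<close> is excluded by Pascal.\<close>

lemma extend_con_type_B:
  assumes F: "con_type F (\<lambda>i. B (i, 0)) (\<lambda>i. A (i, 0)) (\<lambda>i. C (i, 0))"
    and F': "net_cubic F' (\<lambda>i. A (i, 1)) (\<lambda>i. B (i, - 1)) (\<lambda>i. C (i, 0))" "\<not> noline F'"
  shows "F (A (0, 1)) = 0"
proof -
  obtain l K where K: "form 2 K" "noline K" "\<And>x. F x = lin l x * K x"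
    "\<And>i. K (A (i, 0)) = 0" "\<And>i. K (C (i, 0)) = 0" using F unfolding con_type_def by blast
  have "\<not> (\<forall>i. K (B (i, - 1)) = 0)"
    using coset_net.no_conic_through_shifted_class[OF coset_swap _ K(1,2), of "- 1"] K(4,5) by blast
  then have "K (A (0, 1)) = 0" using conic_neighbour[OF K(1,2,5) F'] by blast
  then show ?thesis using K(3) by simp
qed

text \<open>Pascal's theorem for a grid whose A-points are two points of one coset and one of the other,
  and whose six remaining points lie on the conic.\<close>

lemma extend_con_type_A:
  assumes F: "con_type F (\<lambda>i. A (i, 0)) (\<lambda>i. B (i, 0)) (\<lambda>i. C (i, 0))"
    and F': "net_cubic F' (\<lambda>i. A (i, 1)) (\<lambda>i. B (i, - 1)) (\<lambda>i. C (i, 0))" "\<not> noline F'"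
    and F'': "net_cubic F'' (\<lambda>i. A (i, 1)) (\<lambda>i. C (i, - 1)) (\<lambda>i. B (i, 0))" "\<not> noline F''"
  shows "F (A (0, 1)) = 0"
proof -
  obtain l K where l: "l \<noteq> 0" "\<And>i. lin l (A (i, 0)) = 0" and K: "form 2 K" "noline K" "\<And>x. F x = lin l x * K x"
    "\<And>i. K (B (i, 0)) = 0" "\<And>i. K (C (i, 0)) = 0" using F unfolding con_type_def by blast
  interpret S: coset_net n Z A C B
    by (rule coset_net.coset_swap[OF coset_net.coset_rotate[OF coset_rotate]])
  have nA: "\<not> (\<forall>i. K (A (i, 1)) = 0)" using no_conic_through_shifted_class[of 1 K] K by blast
  have KB: "K (B (i, - 1)) = 0" for i using conic_neighbour[OF K(1,2,5) F'] nA by blast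
  have KC: "K (C (i, - 1)) = 0" for i using S.conic_neighbour[OF K(1,2,4) F''] nA by blast
  \<comment> \<open>The fixed line through two points of the shifted class. Pascal puts
    \<open>A (b, 0)\<close> on it for every \<open>b\<close>, so it shares two points with
    \<open>l\<close> and coincides with it.\<close>
  define m where "m = crs (A (1, 1)) (A (0, 1))"
  have mA: "lin m (A (b, 0)) = 0" for b
  proof -
    have f: "form 3 (\<lambda>x. lin m x * K x)" by (rule form_lin_conic[OF K(1)])
    have "lin m (A (b, 0)) * K (A (b, 0)) = 0"
    proof (rule net_cayley_bacharach[OF net_swap[OF N] f, of "(- b, 0)" "(1 - b, 0)" "(0, - 1)"])
      show "(- b, 0) - (1 - b, 0) \<notin> Z" using Z_small[of "- 1"] by simp
      show "(- b, 0) - (0, - 1) \<notin> Z" "(1 - b, 0) - (0, - 1) \<notin> Z" using Z1 by simp_all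
    qed (use K KB KC K(5)[of 0, folded zero_prod_def] in \<open>simp_all add: m_def\<close>)
    moreover have "K (A (b, 0)) \<noteq> 0"
      by (rule net_noline_conic[OF net_rotate[OF N] K(1,2), of "(- b, 0)" "(0, 0)"])
        (use K Z0[of 0] in simp_all)
    ultimately show ?thesis by simp
  qed
  have "m \<noteq> 0" unfolding m_def by (rule net_crs_same[OF N]) (use Z_small[of 1] in simp)
  define c where "c = crs (A (0, 0)) (A (1, 0))"
  have "c \<noteq> 0" unfolding c_def by (rule net_crs_same[OF N]) (use Z_small[of "- 1"] in simp)
  then obtain t t' where t: "l = t *s c" "m = t' *s c"
    using line_through[of l "A (0, 0)" "A (1, 0)"] line_through[of m "A (0, 0)" "A (1, 0)"] l(2) mA
    unfolding c_def by blast
  have "t' \<noteq> 0" using t(2) \<open>m \<noteq> 0\<close> by auto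
  moreover have "lin m (A (0, 1)) = 0" by (simp add: m_def)
  ultimately have "lin c (A (0, 1)) = 0" using t(2) by simp
  then show ?thesis using t(1) K(3) by simp
qed

text \<open>With \<open>B\<close> and \<open>C\<close> collinear, the only alternative to three
  lines is a conic through the shifted \<open>A\<close> and \<open>B\<close>. Then the second
  neighbour has the shifted \<open>A\<close> and \<open>C\<close> on the same conic, and Pascal in
  the translated net forbids all three there.\<close>

lemma lin_neighbour:
  assumes lb: "lb \<noteq> 0" "\<And>i. lin lb (B (i, 0)) = 0" and lc: "lc \<noteq> 0" "\<And>i. lin lc (C (i, 0)) = 0"
    and F': "net_cubic F' (\<lambda>i. A (i, 1)) (\<lambda>i. B (i, - 1)) (\<lambda>i. C (i, 0))" "\<not> noline F'"
    and F'': "net_cubic F'' (\<lambda>i. A (i, 1)) (\<lambda>i. C (i, - 1)) (\<lambda>i. B (i, 0))" "\<not> noline F''"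
  shows "lin_type F' (\<lambda>i. A (i, 1)) (\<lambda>i. B (i, - 1)) (\<lambda>i. C (i, 0))"
proof -
  interpret S: coset_net n Z A C B
    by (rule coset_net.coset_swap[OF coset_net.coset_rotate[OF coset_rotate]])
  have S': "net (cyc n) (\<lambda>i. A (i, 1)) (\<lambda>i. B (i, - 1)) (\<lambda>i. C (i, 0))" by (rule slice) simp
  have S'': "net (cyc n) (\<lambda>i. A (i, 1)) (\<lambda>i. C (i, - 1)) (\<lambda>i. B (i, 0))" by (rule S.slice) simp
  have nC: False if "form 2 K" "noline K" "\<And>i. K (C (i, 0)) = 0" for K
    by (rule cyclic_net_conic_not_collinear[OF net_rotate[OF net_rotate[OF S']] n that lc])
  have nB: False if "form 2 K" "noline K" "\<And>i. K (B (i, 0)) = 0" for K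
    by (rule cyclic_net_conic_not_collinear[OF net_rotate[OF net_rotate[OF S'']] n that lb])
  have "\<not> con_type F' (\<lambda>i. C (i, 0)) (\<lambda>i. A (i, 1)) (\<lambda>i. B (i, - 1))"
  proof
    assume "con_type F' (\<lambda>i. C (i, 0)) (\<lambda>i. A (i, 1)) (\<lambda>i. B (i, - 1))"
    then obtain K where K: "form 2 K" "noline K" "\<And>i. K (A (i, 1)) = 0" "\<And>i. K (B (i, - 1)) = 0"
      unfolding con_type_def by blast
    have nA: False if "l \<noteq> 0" "\<And>i. lin l (A (i, 1)) = 0" for l
      by (rule cyclic_net_conic_not_collinear[OF S' n K(1-3) that])
    from net_cubic_type[OF S'' n F''] show False
    proof (elim disjE)
      assume "con_type F'' (\<lambda>i. C (i, - 1)) (\<lambda>i. A (i, 1)) (\<lambda>i. B (i, 0))"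
      then show False unfolding con_type_def using nB by blast
    next
      assume "con_type F'' (\<lambda>i. B (i, 0)) (\<lambda>i. A (i, 1)) (\<lambda>i. C (i, - 1))"
      then obtain K' where K': "form 2 K'" "noline K'" "\<And>i. K' (A (i, 1)) = 0" "\<And>i. K' (C (i, - 1)) = 0"
        unfolding con_type_def by blast
      have "K (C (i, - 1)) = 0" for i
        using cyclic_net_conic_unique[OF S' n K'(1-3) K(1,3)] K'(4) by auto
      then show False
        using coset_net.no_conic_through_shifted_class[OF
            coset_net.coset_rotate[OF coset_net.coset_rotate[OF coset_translate]] _ K(1,2), of "- 1"] K(3,4)
        by simp
    next
      assume "con_type F'' (\<lambda>i. A (i, 1)) (\<lambda>i. C (i, - 1)) (\<lambda>i. B (i, 0))"
      then show False unfolding con_type_def using nA by blast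
    next
      assume "lin_type F'' (\<lambda>i. A (i, 1)) (\<lambda>i. C (i, - 1)) (\<lambda>i. B (i, 0))"
      then show False unfolding lin_type_def using nA by blast
    qed
  qed
  moreover have "\<not> con_type F' (\<lambda>i. A (i, 1)) (\<lambda>i. B (i, - 1)) (\<lambda>i. C (i, 0))"
    "\<not> con_type F' (\<lambda>i. B (i, - 1)) (\<lambda>i. A (i, 1)) (\<lambda>i. C (i, 0))"
    unfolding con_type_def using nC by blast+
  ultimately show ?thesis using net_cubic_type[OF S' n F'] by blast
qed

text \<open>The slices with second indices (0, 0, 0), (1, -1, 0) and (1, 0, -1) pairwise share a
  class, as \<open>triangle_nets_same_line\<close> requires.\<close>

lemma extend_lin_type:
  assumes F: "lin_type F (\<lambda>i. A (i, 0)) (\<lambda>i. B (i, 0)) (\<lambda>i. C (i, 0))"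
    and F': "net_cubic F' (\<lambda>i. A (i, 1)) (\<lambda>i. B (i, - 1)) (\<lambda>i. C (i, 0))" "\<not> noline F'"
    and F'': "net_cubic F'' (\<lambda>i. A (i, 1)) (\<lambda>i. C (i, - 1)) (\<lambda>i. B (i, 0))" "\<not> noline F''"
  shows "F (A (0, 1)) = 0"
proof -
  interpret S: coset_net n Z A C B
    by (rule coset_net.coset_swap[OF coset_net.coset_rotate[OF coset_rotate]])
  obtain la lb lc where l: "la \<noteq> 0" "lb \<noteq> 0" "lc \<noteq> 0" "\<And>x. F x = lin la x * (lin lb x * lin lc x)"
    "\<And>i. lin la (A (i, 0)) = 0" "\<And>i. lin lb (B (i, 0)) = 0" "\<And>i. lin lc (C (i, 0)) = 0"
    using F unfolding lin_type_def by blast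
  obtain la' lb' where l': "la' \<noteq> 0" "lb' \<noteq> 0" "\<And>i. lin la' (A (i, 1)) = 0" "\<And>i. lin lb' (B (i, - 1)) = 0"
    using lin_neighbour[OF l(2,6) l(3,7) F' F''] unfolding lin_type_def by blast
  obtain lc' where l'': "lc' \<noteq> 0" "\<And>i. lin lc' (C (i, - 1)) = 0"
    using S.lin_neighbour[OF l(3,7) l(2,6) F'' F'] unfolding lin_type_def by blast
  have "triangle_net n (\<lambda>i. A (i, 0)) (\<lambda>i. B (i, 0)) (\<lambda>i. C (i, 0)) la lb lc"
    using slice[of 0 0 0] n l by unfold_locales simp_all
  moreover have "triangle_net n (\<lambda>i. A (i, 1)) (\<lambda>i. B (i, - 1)) (\<lambda>i. C (i, 0)) la' lb' lc"
    using slice[of 1 "- 1" 0] n l l' by unfold_locales simp_all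
  moreover have "triangle_net n (\<lambda>i. A (i, 1)) (\<lambda>i. B (i, 0)) (\<lambda>i. C (i, - 1)) la' lb lc'"
    using slice[of 1 0 "- 1"] n l l' l'' by unfold_locales simp_all
  ultimately obtain p where p: "la' = p *s la" using triangle_nets_same_line by blast
  then have "p \<noteq> 0" using l'(1) by auto
  then have "lin la (A (0, 1)) = 0" using l'(3)[of 0] p by simp
  then show ?thesis using l(4) by simp
qed

text \<open>The cubics \<open>F'\<close> and \<open>F''\<close> of two neighbouring slices share the
  class \<open>C\<close>, respectively \<open>B\<close>, with \<open>F\<close>. If one of the three
  contains no line, a shared class gives proportionality; otherwise the type of \<open>F\<close>
  decides.\<close>

lemma extend:
  assumes F: "net_cubic F (\<lambda>i. A (i, 0)) (\<lambda>i. B (i, 0)) (\<lambda>i. C (i, 0))"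
  shows "F (A (0, 1)) = 0"
proof -
  interpret S: coset_net n Z A C B
    by (rule coset_net.coset_swap[OF coset_net.coset_rotate[OF coset_rotate]])
  have N0: "net (cyc n) (\<lambda>i. A (i, 0)) (\<lambda>i. B (i, 0)) (\<lambda>i. C (i, 0))" by (rule slice) simp
  have N': "net (cyc n) (\<lambda>i. A (i, 1)) (\<lambda>i. B (i, - 1)) (\<lambda>i. C (i, 0))" by (rule slice) simp
  have N'': "net (cyc n) (\<lambda>i. A (i, 1)) (\<lambda>i. C (i, - 1)) (\<lambda>i. B (i, 0))" by (rule S.slice) simp
  have n5: "n \<ge> 5" using n by simp
  obtain F' where F': "net_cubic F' (\<lambda>i. A (i, 1)) (\<lambda>i. B (i, - 1)) (\<lambda>i. C (i, 0))"
    using cyclic_net_cubic[OF N' n5] unfolding net_cubic_def by blast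
  obtain F'' where F'': "net_cubic F'' (\<lambda>i. A (i, 1)) (\<lambda>i. C (i, - 1)) (\<lambda>i. B (i, 0))"
    using cyclic_net_cubic[OF N'' n5] unfolding net_cubic_def by blast
  note D = net_cubicD[OF F] and D' = net_cubicD[OF F'] and D'' = net_cubicD[OF F'']
  consider "noline F" | "noline F'" | "noline F''" | "\<not> noline F" "\<not> noline F'" "\<not> noline F''" by blast
  then show ?thesis
  proof cases
    case 1
    obtain c where c: "\<forall>x. F' x = c * F x"
      using cyclic_net_cubic_unique[OF net_rotate[OF net_rotate[OF N0]] n D(1) 1 D(5) D'(1) D'(5)] by blast
    then have "c \<noteq> 0" using D'(2) by auto
    then show ?thesis using c D'(3)[of 0] by simp
  next
    case 2
    obtain c where "\<forall>x. F x = c * F' x"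
      using cyclic_net_cubic_unique[OF net_rotate[OF net_rotate[OF N']] n D'(1) 2 D'(5) D(1) D(5)] by blast
    then show ?thesis using D'(3)[of 0] by simp
  next
    case 3
    obtain c where "\<forall>x. F x = c * F'' x"
      using cyclic_net_cubic_unique[OF net_rotate[OF net_rotate[OF N'']] n D''(1) 3 D''(5) D(1) D(4)] by blast
    then show ?thesis using D''(3)[of 0] by simp
  next
    case 4
    note F' = F' 4(2) and F'' = F'' 4(3)
    from net_cubic_type[OF N0 n F 4(1)] show ?thesis
    proof (elim disjE)
      assume "con_type F (\<lambda>i. A (i, 0)) (\<lambda>i. B (i, 0)) (\<lambda>i. C (i, 0))"
      then show ?thesis using extend_con_type_A F' F'' by blast
    next
      assume "con_type F (\<lambda>i. B (i, 0)) (\<lambda>i. A (i, 0)) (\<lambda>i. C (i, 0))"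
      then show ?thesis using extend_con_type_B F' by blast
    next
      assume "con_type F (\<lambda>i. C (i, 0)) (\<lambda>i. A (i, 0)) (\<lambda>i. B (i, 0))"
      then show ?thesis using S.extend_con_type_B F'' by blast
    next
      assume "lin_type F (\<lambda>i. A (i, 0)) (\<lambda>i. B (i, 0)) (\<lambda>i. C (i, 0))"
      then show ?thesis using extend_lin_type F' F'' by blast
    qed
  qed
qed

end

section \<open>Regularity and the theorem\<close>

lemma cubic_form_eq: "cubic_form c x = (\<Sum>m\<in>exps 3. c m * monom3 m x)"
  by (simp add: cubic_form_def cubic_exponents_def exps_def monom3_def)

lemma form_cubic_form: "form 3 (cubic_form c)"
  unfolding cubic_form_eq[abs_def] by (rule form_of_coeffs)

text \<open>Links the formal partial derivatives in the definition of regularity to restrictions to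
  lines, where a double root can be read off.\<close>

lemma cubic_form_derivative:
  "((\<lambda>t. cubic_form c (p + t *s q)) has_field_derivative (\<Sum>i\<in>UNIV. cubic_partial c i p * q $ i)) (at 0)"
proof -
  have c: "((\<lambda>t. (p $ j + t * q $ j) ^ k) has_field_derivative (of_nat k * p $ j ^ (k - 1) * q $ j)) (at 0)" for j k
    by (auto intro!: derivative_eq_intros)
  have "((\<lambda>t. c m * monom3 m (p + t *s q)) has_field_derivative
      (\<Sum>i\<in>UNIV. c m * of_nat (m i) * (\<Prod>j\<in>UNIV. p $ j ^ (if j = i then m j - 1 else m j)) * q $ i)) (at 0)" for m
  proof -
    have "((\<lambda>t. c m * ((p $ 1 + t * q $ 1) ^ m 1 * (p $ 2 + t * q $ 2) ^ m 2 * (p $ 3 + t * q $ 3) ^ m 3))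
      has_field_derivative
        c m * ((of_nat (m 1) * p $ 1 ^ (m 1 - 1) * q $ 1 * (p $ 2 + 0 * q $ 2) ^ m 2
          + of_nat (m 2) * p $ 2 ^ (m 2 - 1) * q $ 2 * (p $ 1 + 0 * q $ 1) ^ m 1) * (p $ 3 + 0 * q $ 3) ^ m 3
          + of_nat (m 3) * p $ 3 ^ (m 3 - 1) * q $ 3 * ((p $ 1 + 0 * q $ 1) ^ m 1 * (p $ 2 + 0 * q $ 2) ^ m 2))) (at 0)"
      by (intro DERIV_cmult DERIV_mult c)
    then show ?thesis
      by (simp add: monom3_def prod_UNIV_3 sum_3 algebra_simps)
  qed
  then have "((\<lambda>t. \<Sum>m\<in>exps 3. c m * monom3 m (p + t *s q)) has_field_derivative
      (\<Sum>m\<in>exps 3. \<Sum>i\<in>UNIV. c m * of_nat (m i) * (\<Prod>j\<in>UNIV. p $ j ^ (if j = i then m j - 1 else m j)) * q $ i)) (at 0)"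
    by (intro DERIV_sum)
  moreover have "(\<Sum>m\<in>exps 3. \<Sum>i\<in>UNIV. c m * of_nat (m i) * (\<Prod>j\<in>UNIV. p $ j ^ (if j = i then m j - 1 else m j)) * q $ i)
      = (\<Sum>i\<in>UNIV. cubic_partial c i p * q $ i)"
    by (subst sum.swap) (simp add: cubic_partial_def cubic_exponents_def exps_def sum_distrib_right)
  ultimately show ?thesis unfolding cubic_form_eq by simp
qed

text \<open>The restriction to the line has a double root at the singular point \<open>p\<close>,
  one at \<open>q\<close> and one at a third point: four roots in degree 3.\<close>

lemma singular_point_line:
  assumes sing: "\<And>i. cubic_partial c i p = 0"
    and z: "cubic_form c p = 0" "cubic_form c q = 0" "cubic_form c (a *s p + b *s q) = 0" "a \<noteq> 0" "b \<noteq> 0"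
  shows "cubic_form c (u *s p + v *s q) = 0"
proof -
  note F = form_cubic_form[of c]
  obtain r where r: "degree r \<le> 3" "coeff r 3 = cubic_form c q" "\<forall>t. cubic_form c (p + t *s q) = poly r t"
    using form_on_line[OF F] by blast
  have "((\<lambda>t. poly r t) has_field_derivative 0) (at 0)"
    using cubic_form_derivative[of c p q] sing r(3) by simp
  then have "poly (pderiv r) 0 = 0" using DERIV_unique[OF poly_DERIV] by blast
  then have c1: "coeff r 1 = 0" by (simp add: poly_0_coeff_0 coeff_pderiv)
  have c0: "coeff r 0 = 0" using r(3)[rule_format, of 0] z(1) by (simp add: poly_0_coeff_0)
  \<comment> \<open>The double root at \<open>t = 0\<close> kills the coefficients of degree 0 and
    1, the zero at \<open>q\<close> that of degree 3.\<close>
  have pr: "poly r t = coeff r 2 * t\<^sup>2" for t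
  proof -
    have "poly r t = (\<Sum>i\<le>3. coeff r i * t ^ i)"
      unfolding poly_altdef using r(1) by (intro sum.mono_neutral_left) (auto simp: coeff_eq_0)
    then show ?thesis using c0 c1 r(2) z(2) by (simp add: eval_nat_numeral)
  qed
  have "a *s p + b *s q = a *s (p + (b / a) *s q)" using z(4) by (simp add: vec3_eq_iff field_simps)
  then have "a ^ 3 * poly r (b / a) = 0" using form_homogeneous[OF F] r(3) z(3) by metis
  then have "coeff r 2 = 0" using pr[of "b / a"] z(4,5) by simp
  then have "cubic_form c (p + t *s q) = 0" for t using pr r(3) by simp
  then show ?thesis
    by (intro form_vanish_on_pencil[OF F z(2), of "{0, 1, 2}"]) auto
qed

lemma net_scale:
  assumes "net Z A B C" "t \<noteq> 0"
  shows "net Z (\<lambda>x. t *s A x) B C"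
  using assms by (simp add: net_def det3_def)

text \<open>A net line through a singular \<open>A 0\<close> also meets the cubic in
  \<open>B j\<close> and \<open>C (- j)\<close>, so it is a component; four such lines are too many.
  The factor \<open>t\<close> reflects that regularity is demanded of every nonzero
  representative.\<close>

lemma cyclic_net_regular:
  assumes N: "net (cyc n) A B C" and n: "n \<ge> 10" and F: "\<exists>x. cubic_form c x \<noteq> 0"
    and z: "\<And>i. cubic_form c (A i) = 0" "\<And>i. cubic_form c (B i) = 0" "\<And>i. cubic_form c (C i) = 0"
    and t: "t \<noteq> 0"
  shows "\<exists>i. cubic_partial c i (t *s A 0) \<noteq> 0"
proof (rule ccontr)
  assume "\<not> ?thesis"
  then have sing: "\<And>i. cubic_partial c i (t *s A 0) = 0" by blast
  note N' = net_scale[OF N t]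
  have zA: "cubic_form c (t *s A 0) = 0" using form_homogeneous[OF form_cubic_form] z(1) by simp
  have "cubic_form c x = 0" if x: "lin (crs (t *s A 0) (B j)) x = 0" for j x
  proof -
    have cr: "crs (t *s A 0) (B j) \<noteq> 0" by (rule net_crs[OF N'])
    have cr': "crs (B j) (C (- j)) \<noteq> 0" "crs (t *s A 0) (C (- j)) \<noteq> 0"
      using net_collinear[OF N', of 0 j "- j"] by simp_all
    have "det3 (t *s A 0) (B j) (C (- j)) = 0" using net_det3[OF N', of 0 j "- j"] by simp
    then obtain a b where ab: "C (- j) = a *s (t *s A 0) + b *s B j"
      using det3_eq_0_imp_combination cr by blast
    have "a \<noteq> 0" "b \<noteq> 0" using cr' unfolding ab by (auto simp: crs_add_right)
    moreover have "cubic_form c (a *s (t *s A 0) + b *s B j) = 0" using z(3)[of "- j"] ab by simp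
    moreover obtain u v where "x = u *s (t *s A 0) + v *s B j"
      using in_line_combination[of "crs (t *s A 0) (B j)" "t *s A 0" "B j" x] cr x lin_crs by metis
    ultimately show ?thesis using singular_point_line[OF sing zA z(2)[of j]] by simp
  qed
  note on_lines = this
  have "cubic_form c x = 0" for x
  proof (rule net_pencil_vanish[OF N' form_cubic_form, of "\<lambda>i. int i" 0])
    show "int i - int j \<notin> cyc n" if "i \<le> 3" "j \<le> 3" "i \<noteq> j" for i j
      using that by (intro cyc_small[OF n]) auto
  qed (rule on_lines)
  then show False using F by blast
qed

text \<open>The relation is symmetric in the three classes, so each statement is proved for the
  first class and carried over by rotation.\<close>

locale group_net = comm_group H for H (structure) +
  fixes A B C :: "'a \<Rightarrow> complex ^ 3" and g :: 'a
  assumes col: "\<And>x y z. x \<in> carrier H \<Longrightarrow> y \<in> carrier H \<Longrightarrow> z \<in> carrier H \<Longrightarrow>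
      det3 (A x) (B y) (C z) = 0 \<longleftrightarrow> x \<otimes> y \<otimes> z = \<one>"
    and g: "g \<in> carrier H" "ord g > 9"
begin

abbreviation n :: int where "n \<equiv> int (ord g)"

lemma group_net_rotate: "group_net H B C A g"
proof
  fix x y z assume c: "x \<in> carrier H" "y \<in> carrier H" "z \<in> carrier H"
  have "det3 (B x) (C y) (A z) = det3 (A z) (B x) (C y)" by (rule det3_rotate)
  then show "det3 (B x) (C y) (A z) = 0 \<longleftrightarrow> x \<otimes> y \<otimes> z = \<one>" using col[of z x y] c by (simp add: m_ac)
qed (rule g)+

lemma coset_slice:
  assumes c: "r \<in> carrier H" "s \<in> carrier H" "t \<in> carrier H" "r \<otimes> s \<otimes> t = \<one>"
  shows "net (cyc n) (\<lambda>i. A (r \<otimes> g [^] i)) (\<lambda>i. B (s \<otimes> g [^] i)) (\<lambda>i. C (t \<otimes> g [^] i))"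
proof -
  have "det3 (A (r \<otimes> g [^] i)) (B (s \<otimes> g [^] j)) (C (t \<otimes> g [^] k)) = 0 \<longleftrightarrow> n dvd i + j + k" for i j k :: int
  proof -
    have "(r \<otimes> g [^] i) \<otimes> (s \<otimes> g [^] j) \<otimes> (t \<otimes> g [^] k) = (r \<otimes> s \<otimes> t) \<otimes> (g [^] i \<otimes> g [^] j \<otimes> g [^] k)"
      using c(1-3) g by (simp add: m_ac)
    also have "\<dots> = g [^] (i + j + k)" using c g by (simp add: int_pow_mult)
    finally show ?thesis using col c g int_pow_eq_id[OF g(1)] by simp
  qed
  moreover have "1 \<notin> cyc n" by (rule cyc_small) (use g in auto)
  then have "cyc n \<noteq> UNIV" by blast
  ultimately show ?thesis by (simp add: net_def)
qed

lemma cubic_on_class: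
  assumes F: "net_cubic F (\<lambda>i. A (g [^] i)) (\<lambda>i. B (g [^] i)) (\<lambda>i. C (g [^] i))" and h: "h \<in> carrier H"
  shows "F (A h) = 0"
proof (cases "\<exists>i::int. h = g [^] i")
  case True
  then show ?thesis using net_cubicD(3)[OF F] by auto
next
  case False
  \<comment> \<open>A homomorphism from pairs of integers to \<open>H\<close> with kernel
    \<open>Z\<close>. As \<open>h\<close> is no power of \<open>g\<close>, no \<open>(i, 1)\<close>
    lies in the kernel.\<close>
  define e where "e = (\<lambda>(i::int, s::int). g [^] i \<otimes> h [^] s)"
  define Z where "Z = {x. e x = \<one>}"
  have ec: "e x \<in> carrier H" for x using g h by (simp add: e_def case_prod_beta)
  have e_add: "e x \<otimes> e y = e (x + y)" for x y
    using g h by (simp add: e_def case_prod_beta int_pow_mult m_ac)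
  have Z0: "(i, 0) \<in> Z \<longleftrightarrow> n dvd i" for i
    using int_pow_eq_id[OF g(1), of i] g by (simp add: Z_def e_def)
  have Z1: "(i, 1) \<notin> Z" for i
  proof
    assume "(i, 1) \<in> Z"
    then have "h \<otimes> g [^] i = \<one>" using g h by (simp add: Z_def e_def m_comm)
    then have "h = inv (g [^] i)" using g h by (metis inv_equality int_pow_closed inv_inv inv_closed)
    also have "\<dots> = g [^] (- i)" using g by (simp add: int_pow_neg)
    finally show False using False by blast
  qed
  have "net Z (\<lambda>x. A (e x)) (\<lambda>x. B (e x)) (\<lambda>x. C (e x))"
    unfolding net_def
  proof (intro conjI allI ballI)
    show "det3 (A (e x)) (B (e y)) (C (e z)) = 0 \<longleftrightarrow> x + y + z \<in> Z" for x y z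
      using col[OF ec ec ec] by (simp add: Z_def e_add)
    show "0 \<in> Z" using Z0[of 0] by (simp add: zero_prod_def)
    show "x - y \<in> Z" if "x \<in> Z" "y \<in> Z" for x y
      using that e_add[of "x - y" y] ec by (simp add: Z_def)
    show "Z \<noteq> UNIV" using Z1 by blast
  qed
  then interpret coset_net n Z "\<lambda>x. A (e x)" "\<lambda>x. B (e x)" "\<lambda>x. C (e x)"
    using g Z0 Z1 by unfold_locales auto
  have "F (A (e (0, 1))) = 0"
    by (rule extend) (use F g h in \<open>simp add: e_def\<close>)
  then show ?thesis using g h by (simp add: e_def)
qed

lemma group_net_cubic:
  "\<exists>c. (\<exists>x. cubic_form c x \<noteq> 0) \<and>
    (\<forall>x\<in>carrier H. cubic_form c (A x) = 0 \<and> cubic_form c (B x) = 0 \<and> cubic_form c (C x) = 0)"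
proof -
  interpret R: group_net H B C A g by (rule group_net_rotate)
  interpret R': group_net H C A B g by (rule R.group_net_rotate)
  have N: "net (cyc n) (\<lambda>i. A (g [^] i)) (\<lambda>i. B (g [^] i)) (\<lambda>i. C (g [^] i))"
    using coset_slice[of \<one> \<one> \<one>] g by simp
  obtain F where F: "net_cubic F (\<lambda>i. A (g [^] i)) (\<lambda>i. B (g [^] i)) (\<lambda>i. C (g [^] i))"
    using cyclic_net_cubic[OF N] g unfolding net_cubic_def by auto
  have z: "F (A x) = 0" "F (B x) = 0" "F (C x) = 0" if "x \<in> carrier H" for x
    using cubic_on_class[OF F that] R.cubic_on_class[of F x] R'.cubic_on_class[of F x] F that
    unfolding net_cubic_def by blast+
  obtain c where "\<forall>x. F x = (\<Sum>m\<in>exps 3. c m * monom3 m x)"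
    using form_coeffs[OF net_cubicD(1)[OF F]] by blast
  then have "F = cubic_form c" by (simp add: cubic_form_eq fun_eq_iff)
  then show ?thesis using z net_cubicD(2)[OF F] by blast
qed

text \<open>Shifting the classes by \<open>h\<close>, its inverse and \<open>\<one>\<close> moves
  \<open>A h\<close> to index 0 of a cyclic net.\<close>

lemma group_net_regular:
  assumes F: "\<exists>x. cubic_form c x \<noteq> 0"
    and z: "\<And>x. x \<in> carrier H \<Longrightarrow> cubic_form c (A x) = 0" "\<And>x. x \<in> carrier H \<Longrightarrow> cubic_form c (B x) = 0"
      "\<And>x. x \<in> carrier H \<Longrightarrow> cubic_form c (C x) = 0"
    and h: "h \<in> carrier H" and t: "t \<noteq> 0"
  shows "\<exists>i. cubic_partial c i (t *s A h) \<noteq> 0"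
proof -
  have N: "net (cyc n) (\<lambda>i. A (h \<otimes> g [^] i)) (\<lambda>i. B (inv h \<otimes> g [^] i)) (\<lambda>i. C (\<one> \<otimes> g [^] i))"
    by (rule coset_slice) (use h in simp_all)
  show ?thesis
    using cyclic_net_regular[OF N _ F _ _ _ t] z h g by simp
qed

end

section \<open>From lines of the plane to dual points\<close>

text \<open>The cross product of a basis of \<open>l\<close> spans its annihilator, so one vector
  describes both the line and its dual point.\<close>

lemma proj_line_dual:
  assumes "l \<in> proj_lines"
  shows "\<exists>v. v \<noteq> 0 \<and> l = {x. lin v x = 0} \<and> dual_point l = range (\<lambda>t. t *s v)"
proof -
  have l: "vec.subspace l" "vec.dim l = 2" using assms by (auto simp: proj_lines_def)
  obtain S where S: "S \<subseteq> l" "vec.independent S" "l \<subseteq> vec.span S" "card S = 2"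
    using vec.basis_exists[of l] l(2) by metis
  obtain p q where pq: "S = {p, q}" "p \<noteq> q" using S(4) by (auto simp: card_2_iff)
  have "crs p q \<noteq> 0"
  proof
    assume "crs p q = 0"
    moreover have "q \<noteq> 0" using S(2) pq vec.dependent_zero by blast
    ultimately obtain t where "p = t *s q" using crs_eq_0_imp_multiple by blast
    then have "p \<in> vec.span {q}" by (simp add: vec.span_base vec.span_scale)
    then show False using S(2) pq vec.independent_insert[of p "{q}"] by auto
  qed
  define v where "v = crs p q"
  have pl: "p \<in> l" "q \<in> l" using S(1) pq by auto
  have comb: "u *s p + w *s q \<in> l" for u w
    using pl l(1) by (simp add: vec.subspace_add vec.subspace_scale)
  have comb': "\<exists>u w. x = u *s p + w *s q" if "x \<in> l" for x
  proof -
    have "x \<in> vec.span {p, q}" using that S(3) pq by blast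
    then obtain u where "x - u *s p \<in> vec.span {q}" by (auto simp: vec.span_breakdown_eq)
    then obtain w where "x - u *s p = w *s q" by (auto simp: vec.span_singleton)
    then have "x = u *s p + w *s q" by (metis add_diff_cancel_left' diff_add_cancel add.commute)
    then show ?thesis by blast
  qed
  have "l = {x. lin v x = 0}"
  proof (intro equalityI subsetI)
    fix x assume "x \<in> l"
    then show "x \<in> {x. lin v x = 0}" using comb'[of x] by (auto simp: v_def)
  next
    fix x assume "x \<in> {x. lin v x = 0}"
    then show "x \<in> l"
      using in_line_combination[of v p q x] \<open>crs p q \<noteq> 0\<close> comb by (auto simp: v_def)
  qed
  moreover have "dual_point l = range (\<lambda>t. t *s v)"
  proof (intro equalityI subsetI)
    fix a assume "a \<in> dual_point l"
    then have "lin a p = 0" "lin a q = 0" using pl by (auto simp: dual_point_def lin_def sum_3)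
    then obtain t where "a = t *s v" using line_through[of a p q] \<open>crs p q \<noteq> 0\<close> unfolding v_def by blast
    then show "a \<in> range (\<lambda>t. t *s v)" by blast
  next
    fix a assume "a \<in> range (\<lambda>t. t *s v)"
    then obtain t where "a = t *s v" by blast
    moreover have "(\<Sum>i\<in>UNIV. a $ i * x $ i) = lin a x" for a x by (simp add: lin_def sum_3)
    ultimately show "a \<in> dual_point l" using \<open>l = {x. lin v x = 0}\<close> by (simp add: dual_point_def)
  qed
  ultimately show ?thesis using \<open>crs p q \<noteq> 0\<close> v_def by blast
qed

lemma span_in_proj_points:
  assumes "v \<noteq> 0"
  shows "range (\<lambda>t. t *s v) \<in> proj_points"
proof -
  have r: "range (\<lambda>t. t *s v) = vec.span {v}" by (auto simp: vec.span_singleton)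
  have "vec.independent {v}" using assms by (simp add: vec.independent_insert)
  then have "vec.dim (vec.span {v}) = 1" using vec.dim_span_eq_card_independent by fastforce
  then show ?thesis unfolding r proj_points_def by simp
qed

lemma regular_pointI:
  assumes "v \<noteq> 0" "cubic_form c v = 0" "\<And>t. t \<noteq> 0 \<Longrightarrow> \<exists>i. cubic_partial c i (t *s v) \<noteq> 0"
  shows "range (\<lambda>t. t *s v) \<in> regular_points c"
proof -
  have "cubic_form c (t *s v) = 0" for t using form_homogeneous[OF form_cubic_form, of c t v] assms(2) by simp
  moreover have "\<exists>i. cubic_partial c i (t *s v) \<noteq> 0" if "t *s v \<noteq> 0" for t using assms(3)[of t] that by auto
  ultimately show ?thesis
    unfolding regular_points_def cubic_curve_def using span_in_proj_points[OF assms(1)] by blast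
qed

theorem theorem5p4:
  fixes H :: "('g, 'm) monoid_scheme"
    and A :: "3 \<Rightarrow> (complex ^ 3) set set"
    and X :: "(complex ^ 3) set set"
  assumes "comm_group H"
    and "finite (carrier H)"
    and "\<exists>h\<in>carrier H. group.ord H h > 9"
    and "three_net A X"
    and "realizes_group A H"
  shows "algebraic_net A"
proof -
  interpret comm_group H by fact
  obtain g where g: "g \<in> carrier H" "ord g > 9" using assms(3) by blast
  obtain \<phi> :: "3 \<Rightarrow> 'g \<Rightarrow> (complex ^ 3) set" where bij: "\<And>i. bij_betw (\<phi> i) (carrier H) (A i)"
    and real: "\<And>a b. a \<in> carrier H \<Longrightarrow> b \<in> carrier H \<Longrightarrow> \<phi> 1 a \<inter> \<phi> 2 b \<subseteq> \<phi> 3 (a \<otimes>\<^bsub>H\<^esub> b)"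
    using assms(5) unfolding realizes_group_def by blast
  note T = assms(4)[unfolded three_net_def, THEN conjunct2]
  note lines = T[THEN conjunct1]
    and disj = T[THEN conjunct2, THEN conjunct2, THEN conjunct1, rule_format]
  note T' = T[THEN conjunct2, THEN conjunct2, THEN conjunct2, THEN conjunct2, THEN conjunct2]
  note inX = T'[THEN conjunct1, rule_format] and uniq = T'[THEN conjunct2, rule_format]
  have \<phi>A: "\<phi> i a \<in> A i" if "a \<in> carrier H" for i a using bij[of i] that by (auto simp: bij_betw_def)
  define v where "v = (\<lambda>i a. SOME v. v \<noteq> 0 \<and> \<phi> i a = {x. lin v x = 0} \<and> dual_point (\<phi> i a) = range (\<lambda>t. t *s v))"
  have v: "v i a \<noteq> 0" "\<phi> i a = {x. lin (v i a) x = 0}" "dual_point (\<phi> i a) = range (\<lambda>t. t *s v i a)"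
    if a: "a \<in> carrier H" for i a
  proof -
    have "\<phi> i a \<in> proj_lines" using lines \<phi>A[OF a, of i] by blast
    from someI_ex[OF proj_line_dual[OF this]]
    show "v i a \<noteq> 0" "\<phi> i a = {x. lin (v i a) x = 0}" "dual_point (\<phi> i a) = range (\<lambda>t. t *s v i a)"
      unfolding v_def by blast+
  qed
  \<comment> \<open>Three lines are concurrent iff their dual points are collinear. Realization of
    the group gives one direction; the other holds because only one line of the third class passes
    through \<open>P\<close>.\<close>
  have concurrent: "det3 (v 1 a) (v 2 b) (v 3 c) = 0 \<longleftrightarrow> c = a \<otimes>\<^bsub>H\<^esub> b"
    if c: "a \<in> carrier H" "b \<in> carrier H" "c \<in> carrier H" for a b c
  proof -
    define w where "w = crs (v 1 a) (v 2 b)"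
    define P where "P = \<phi> 1 a \<inter> \<phi> 2 b"
    have ne: "w \<noteq> 0"
    proof
      assume "w = 0"
      then obtain t where t: "v 1 a = t *s v 2 b"
        using crs_eq_0_imp_multiple[of "v 1 a" "v 2 b"] v(1)[OF c(2), of 2] unfolding w_def by blast
      then have "t \<noteq> 0" using v(1)[OF c(1), of 1] by auto
      then have "\<phi> 1 a = \<phi> 2 b" using v(2)[OF c(1), of 1] v(2)[OF c(2), of 2] t by simp
      then show False using disj[of 1 2] \<phi>A[OF c(1), of 1] \<phi>A[OF c(2), of 2] by auto
    qed
    have P: "x \<in> P \<longleftrightarrow> lin x (v 1 a) = 0 \<and> lin x (v 2 b) = 0" for x
      using v(2)[OF c(1), of 1] v(2)[OF c(2), of 2] by (simp add: P_def lin_commute[of x])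
    have wP: "w \<in> P" unfolding P w_def by simp
    have Pw: "\<exists>t. x = t *s w" if "x \<in> P" for x
      using line_through[of x "v 1 a" "v 2 b"] that ne unfolding P w_def by blast
    have "P \<in> X" unfolding P_def by (rule inX[of 1 2]) (use \<phi>A c in auto)
    have det: "det3 (v 1 a) (v 2 b) (v 3 c) = 0 \<longleftrightarrow> w \<in> \<phi> 3 c"
      using v(2)[OF c(3), of 3] by (simp add: det3_def w_def lin_commute[of "v 3 c"])
    show ?thesis
    proof
      assume "c = a \<otimes>\<^bsub>H\<^esub> b"
      then show "det3 (v 1 a) (v 2 b) (v 3 c) = 0" using real[OF c(1,2)] wP det by (auto simp: P_def)
    next
      assume "det3 (v 1 a) (v 2 b) (v 3 c) = 0"
      then have "lin (v 3 c) w = 0" using det v(2)[OF c(3), of 3] by simp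
      then have "P \<subseteq> \<phi> 3 c" using Pw v(2)[OF c(3), of 3] by fastforce
      moreover have "P \<subseteq> \<phi> 3 (a \<otimes>\<^bsub>H\<^esub> b)" using real[OF c(1,2)] by (simp add: P_def)
      ultimately have "\<phi> 3 c = \<phi> 3 (a \<otimes>\<^bsub>H\<^esub> b)" using uniq[OF \<open>P \<in> X\<close>, of 3] \<phi>A[of c 3] \<phi>A[of "a \<otimes>\<^bsub>H\<^esub> b" 3] c by blast
      then show "c = a \<otimes>\<^bsub>H\<^esub> b" using bij[of 3] c by (auto simp: bij_betw_def inj_on_def)
    qed
  qed
  interpret G: group_net H "v 1" "v 2" "\<lambda>z. v 3 (inv\<^bsub>H\<^esub> z)" g
  proof
    fix x y z assume c: "x \<in> carrier H" "y \<in> carrier H" "z \<in> carrier H"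
    have "inv\<^bsub>H\<^esub> z = x \<otimes>\<^bsub>H\<^esub> y \<longleftrightarrow> x \<otimes>\<^bsub>H\<^esub> y \<otimes>\<^bsub>H\<^esub> z = \<one>\<^bsub>H\<^esub>"
      using c by (metis inv_equality l_inv m_closed)
    then show "det3 (v 1 x) (v 2 y) (v 3 (inv\<^bsub>H\<^esub> z)) = 0 \<longleftrightarrow> x \<otimes>\<^bsub>H\<^esub> y \<otimes>\<^bsub>H\<^esub> z = \<one>\<^bsub>H\<^esub>"
      using concurrent[of x y "inv\<^bsub>H\<^esub> z"] c by simp
  qed (rule g)+
  interpret R: group_net H "v 2" "\<lambda>z. v 3 (inv\<^bsub>H\<^esub> z)" "v 1" g by (rule G.group_net_rotate)
  interpret R': group_net H "\<lambda>z. v 3 (inv\<^bsub>H\<^esub> z)" "v 1" "v 2" g by (rule R.group_net_rotate)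
  obtain c where nz: "\<exists>x. cubic_form c x \<noteq> 0"
    and zero: "\<And>x. x \<in> carrier H \<Longrightarrow> cubic_form c (v 1 x) = 0" "\<And>x. x \<in> carrier H \<Longrightarrow> cubic_form c (v 2 x) = 0"
      "\<And>x. x \<in> carrier H \<Longrightarrow> cubic_form c (v 3 (inv\<^bsub>H\<^esub> x)) = 0"
    using G.group_net_cubic by blast
  have reg1: "dual_point (\<phi> 1 a) \<in> regular_points c" if "a \<in> carrier H" for a
    unfolding v(3)[OF that]
    by (rule regular_pointI) (use v(1) zero that G.group_net_regular[OF nz zero] in blast)+
  have reg2: "dual_point (\<phi> 2 a) \<in> regular_points c" if "a \<in> carrier H" for a
    unfolding v(3)[OF that]
    by (rule regular_pointI) (use v(1) zero that R.group_net_regular[OF nz zero(2,3,1)] in blast)+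
  have reg3: "dual_point (\<phi> 3 a) \<in> regular_points c" if a: "a \<in> carrier H" for a
  proof -
    have i: "inv\<^bsub>H\<^esub> (inv\<^bsub>H\<^esub> a) = a" "inv\<^bsub>H\<^esub> a \<in> carrier H" using a by simp_all
    have "cubic_form c (v 3 a) = 0" using zero(3)[OF i(2)] i(1) by simp
    moreover have "\<exists>j. cubic_partial c j (t *s v 3 a) \<noteq> 0" if "t \<noteq> 0" for t
      using R'.group_net_regular[OF nz zero(3,1,2) i(2) that] i(1) by simp
    ultimately show ?thesis unfolding v(3)[OF a] by (intro regular_pointI v(1)[OF a])
  qed
  have "nonzero_cubic c"
  proof (rule ccontr)
    assume "\<not> nonzero_cubic c"
    then have "cubic_form c x = 0" for x by (simp add: nonzero_cubic_def cubic_form_def)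
    then show False using nz by blast
  qed
  moreover have "dual_point ` (\<Union>i. A i) \<subseteq> regular_points c"
  proof clarify
    fix l i assume "l \<in> A i"
    then obtain a where a: "a \<in> carrier H" "l = \<phi> i a" using bij[of i] by (auto simp: bij_betw_def)
    then show "dual_point l \<in> regular_points c" using exhaust_3[of i] reg1 reg2 reg3 by blast
  qed
  ultimately show ?thesis unfolding algebraic_net_def by blast
qed

end
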